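(* Let $\mathfrak g$ be a complex Lie algebra and let $f:\Lambda^3\mathfrak g\to\mathbb C$ be a Chevalley--Eilenberg 3-cocycle with values in the trivial module $\mathbb C$. Let $\tilde\alpha\in C^2(\mathfrak g;(U\mathfrak g)^\vee)$ be given by $$\tilde\alpha(x,g_1,g_2)=\sum_{(x)}\int_0^1 f\big(\mathrm{pr}(x^{(1)}),A_t(x^{(2)},g_1),A_t(x^{(3)},g_2)\big)\,dt\qquad(x\in U\mathfrak g,\ g_1,g_2\in\mathfrak g),$$ and let $\alpha\in C^2(\mathfrak g;(U\mathfrak g^+)^\vee)$ be its restriction to $U\mathfrak g^+\subset U\mathfrak g$. Then the restriction of $d_{CE}(\tilde\alpha)$ to $\mathbb C\otimes\Lambda^3\mathfrak g\subset U\mathfrak g\otimes\Lambda^3\mathfrak g$ is $f$. In particular, $\alpha$ is a 2-cocycle in $C^2(\mathfrak g;(U\mathfrak g^+)^\vee)$ and $[f]=\partial[\alpha]$ in $H^3(\mathfrak g;\mathbb C)$, where $\partial:H^2(\mathfrak g;(U\mathfrak g^+)^\vee)\to H^3(\mathfrak g;\mathbb C)$ is the connecting homomorphism of the long exact sequence associated with the short exact sequence of $\mathfrak g$-modules $0\to\mathbb C\to(U\mathfrak g)^\vee\to(U\mathfrak g^+)^\vee\to 0$.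
   Context: $U\mathfrak g$ is the universal enveloping algebra, with unit $\eta:\mathbb C\to U\mathfrak g$, augmentation $\varepsilon:U\mathfrak g\to\mathbb C$, augmentation ideal $U\mathfrak g^+=\ker\varepsilon$, its standard cocommutative Hopf algebra structure, Sweedler notation $\sum_{(x)}x^{(1)}\otimes\cdots\otimes x^{(n)}$ for the iterated coproduct, and convolution product $\star$ on linear endomorphisms. $(-)^\vee$ is the full linear dual; $(U\mathfrak g)^\vee$ is a left $\mathfrak g$-module by $(g\cdot\varphi)(x)=\varphi(xg)$, similarly $(U\mathfrak g^+)^\vee$. The short exact sequence is dual to $0\to U\mathfrak g^+\to U\mathfrak g\xrightarrow{\varepsilon}\mathbb C\to0$ (so $\mathbb C\to(U\mathfrak g)^\vee$ sends $\lambda$ to $\lambda\varepsilon$). Definitions, for $x\in U\mathfrak g$, $g\in\mathfrak g$: $\mathrm{pr}=\sum_{k\ge0}\frac{(-1)^k}{k+1}(\mathrm{Id}-\eta\varepsilon)^{\star(k+1)}$ (the Eulerian idempotent, i.e. the convolution logarithm of $\mathrm{Id}$; it is known to take values in $\mathfrak g$); $\phi_t(x)=\sum_{n\ge0}\frac{t^n}{n!}\mathrm{pr}^{\star n}(x)\in U\mathfrak g\otimes\mathbb C[t]$, extended $\mathbb C[t]$-linearly; $A_t(x,g)=\sum_{(x)}\phi_{-t}(x^{(1)})\,\phi_t(x^{(2)}g)$, which is known to lie in $\mathfrak g\otimes\mathbb C[t]$. $f$ is extended $\mathbb C[t]$-multilinearly, so the integrand is a polynomial in $t$. Cochains in $C^p(\mathfrak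 g;(U\mathfrak g)^\vee)$ are identified with linear maps $U\mathfrak g\otimes\Lambda^p\mathfrak g\to\mathbb C$ and $d_{CE}$ is the Chevalley--Eilenberg coboundary; for $p=2$: $d_{CE}(\tilde\alpha)(x,g_1,g_2,g_3)=\tilde\alpha(xg_1,g_2,g_3)-\tilde\alpha(xg_2,g_1,g_3)+\tilde\alpha(xg_3,g_1,g_2)-\tilde\alpha(x,[g_1,g_2],g_3)+\tilde\alpha(x,[g_1,g_3],g_2)+\tilde\alpha(x,g_1,[g_2,g_3])$. *)

theory Defs
  imports
    "HOL-Analysis.Analysis"
    "HOL-Library.Poly_Mapping"
    "HOL-Computational_Algebra.Polynomial"
begin

section \<open>Complex vector spaces, algebras and Lie algebras\<close>

class scaleC =
  fixes scaleC :: "complex \<Rightarrow> 'a \<Rightarrow> 'a" (infixr \<open>*\<^sub>C\<close> 75)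

class complex_vector = scaleC + ab_group_add +
  assumes scaleC_add_right: "a *\<^sub>C (x + y) = a *\<^sub>C x + a *\<^sub>C y"
    and scaleC_add_left: "(a + b) *\<^sub>C x = a *\<^sub>C x + b *\<^sub>C x"
    and scaleC_scaleC: "a *\<^sub>C b *\<^sub>C x = (a * b) *\<^sub>C x"
    and scaleC_one: "1 *\<^sub>C x = x"

text \<open>Unital associative algebras; the zero algebra is allowed.\<close>

class complex_algebra = complex_vector + ring + monoid_mult +
  assumes mult_scaleC_left: "a *\<^sub>C x * y = a *\<^sub>C (x * y)"
    and mult_scaleC_right: "x * a *\<^sub>C y = a *\<^sub>C (x * y)"

class complex_lie_algebra = complex_vector +
  fixes bracket :: "'a \<Rightarrow> 'a \<Rightarrow> 'a"
  assumes bracket_add_left: "bracket (x + y) z = bracket x z + bracket y z"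
    and bracket_add_right: "bracket x (y + z) = bracket x y + bracket x z"
    and bracket_scaleC_left: "bracket (a *\<^sub>C x) y = a *\<^sub>C bracket x y"
    and bracket_scaleC_right: "bracket x (a *\<^sub>C y) = a *\<^sub>C bracket x y"
    and bracket_self: "bracket x x = 0"
    and jacobi: "bracket x (bracket y z) + bracket y (bracket z x) + bracket z (bracket x y) = 0"

global_interpretation complex_vector: vector_space "scaleC :: complex \<Rightarrow> 'a \<Rightarrow> 'a::complex_vector"
  by unfold_locales (simp_all add: scaleC_add_right scaleC_add_left scaleC_scaleC scaleC_one)

abbreviation clinear :: "('a::complex_vector \<Rightarrow> 'b::complex_vector) \<Rightarrow> bool"
  where "clinear \<equiv> Vector_Spaces.linear scaleC scaleC"

definition cbilinear :: "('a::complex_vector \<Rightarrow> 'b::complex_vector \<Rightarrow> 'c::complex_vector) \<Rightarrow> bool"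
  where "cbilinear m \<longleftrightarrow> (\<forall>b. clinear (\<lambda>a. m a b)) \<and> (\<forall>a. clinear (m a))"

lemma clinear_iff:
  fixes f :: "'a::complex_vector \<Rightarrow> 'b::complex_vector"
  shows "clinear f \<longleftrightarrow> (\<forall>x y. f (x + y) = f x + f y) \<and> (\<forall>c x. f (c *\<^sub>C x) = c *\<^sub>C f x)"
  by (simp add: Vector_Spaces.linear_iff complex_vector.vector_space_axioms)

lemma clinearI:
  "(\<And>x y. f (x + y) = f x + f y) \<Longrightarrow> (\<And>c x. f (c *\<^sub>C x) = c *\<^sub>C f x) \<Longrightarrow> clinear f"
  by (simp add: clinear_iff)

lemma clinear_add: "clinear f \<Longrightarrow> f (x + y) = f x + f y"
  and clinear_scaleC: "clinear f \<Longrightarrow> f (c *\<^sub>C x) = c *\<^sub>C f x"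
  by (simp_all add: clinear_iff)

lemma clinear_zero: "clinear f \<Longrightarrow> f 0 = 0"
  using clinear_add[of f 0 0] by simp

lemma clinear_diff: "clinear f \<Longrightarrow> f (x - y) = f x - f y"
  using clinear_add[of f "x - y" y] by (simp add: algebra_simps)

lemma clinear_sum: "clinear f \<Longrightarrow> f (sum g A) = (\<Sum>a\<in>A. f (g a))"
  by (induction A rule: infinite_finite_induct) (auto simp: clinear_zero clinear_add)

instantiation complex :: complex_algebra
begin
definition scaleC_complex :: "complex \<Rightarrow> complex \<Rightarrow> complex" where "scaleC_complex = (*)"
instance by standard (simp_all add: scaleC_complex_def algebra_simps)
end

instantiation poly :: ("{comm_ring_1, complex_algebra}") complex_algebra
begin
definition scaleC_poly :: "complex \<Rightarrow> 'a poly \<Rightarrow> 'a poly"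
  where "scaleC_poly c p = smult (c *\<^sub>C 1) p"
instance
proof
  fix a b :: complex and x y :: "'a poly"
  have *: "(a *\<^sub>C (1::'a)) * (b *\<^sub>C 1) = (a * b) *\<^sub>C 1"
    by (simp add: mult_scaleC_left scaleC_scaleC)
  show "a *\<^sub>C (x + y) = a *\<^sub>C x + a *\<^sub>C y" "(a + b) *\<^sub>C x = a *\<^sub>C x + b *\<^sub>C x"
    "a *\<^sub>C b *\<^sub>C x = (a * b) *\<^sub>C x" "1 *\<^sub>C x = x"
    "a *\<^sub>C x * y = a *\<^sub>C (x * y)" "x * a *\<^sub>C y = a *\<^sub>C (x * y)"
    by (simp_all add: scaleC_poly_def smult_add_right scaleC_add_left smult_add_left * scaleC_one)
qed
end

lemma scaleC_poly_eq_smult: "c *\<^sub>C (p :: complex poly) = smult c p"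
  by (simp add: scaleC_poly_def scaleC_complex_def)

instantiation poly_mapping :: (type, complex_vector) complex_vector
begin
lift_definition scaleC_poly_mapping :: "complex \<Rightarrow> ('a \<Rightarrow>\<^sub>0 'b) \<Rightarrow> ('a \<Rightarrow>\<^sub>0 'b)"
  is "\<lambda>c p x. c *\<^sub>C p x"
  by (erule finite_subset[rotated]) auto
instance
  by standard (transfer, simp add: fun_eq_iff scaleC_add_right scaleC_add_left scaleC_scaleC scaleC_one)+
end

text \<open>Linear extension of a map from the basis to the free vector space.\<close>

definition free_linear :: "('x \<Rightarrow> 'b::complex_vector) \<Rightarrow> ('x \<Rightarrow>\<^sub>0 complex) \<Rightarrow> 'b"
  where "free_linear m p = (\<Sum>x\<in>Poly_Mapping.keys p. Poly_Mapping.lookup p x *\<^sub>C m x)"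

lemma free_linear_superset:
  assumes "finite A" "Poly_Mapping.keys p \<subseteq> A"
  shows "free_linear m p = (\<Sum>x\<in>A. Poly_Mapping.lookup p x *\<^sub>C m x)"
  unfolding free_linear_def using assms
  by (intro sum.mono_neutral_left) (auto simp: in_keys_iff)

lemma clinear_free_linear: "clinear (free_linear m)"
proof (rule clinearI)
  fix p q :: "'a \<Rightarrow>\<^sub>0 complex" and c :: complex
  let ?A = "Poly_Mapping.keys p \<union> Poly_Mapping.keys q"
  show "free_linear m (p + q) = free_linear m p + free_linear m q"
    using Poly_Mapping.keys_add[of p q]
    by (simp add: free_linear_superset[of ?A] lookup_add scaleC_add_left sum.distrib)
  have "Poly_Mapping.keys (c *\<^sub>C p) \<subseteq> Poly_Mapping.keys p"
    by (auto simp: in_keys_iff scaleC_poly_mapping.rep_eq)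
  then show "free_linear m (c *\<^sub>C p) = c *\<^sub>C free_linear m p"
    by (simp add: free_linear_superset[of "Poly_Mapping.keys p"] scaleC_poly_mapping.rep_eq
        scaleC_complex_def complex_vector.scale_sum_right scaleC_scaleC)
qed

lemma free_linear_single: "free_linear m (Poly_Mapping.single x c) = c *\<^sub>C m x"
  by (auto simp: free_linear_def)

lemma poly_mapping_eq_sum_single:
  fixes p :: "'x \<Rightarrow>\<^sub>0 'b::comm_monoid_add"
  shows "p = (\<Sum>x\<in>Poly_Mapping.keys p. Poly_Mapping.single x (Poly_Mapping.lookup p x))"
  by (rule poly_mapping_eqI) (simp add: lookup_sum lookup_single when_def in_keys_iff)

lemma poly_mapping_single_induct:
  fixes p :: "'x \<Rightarrow>\<^sub>0 'b::comm_monoid_add"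
  assumes "P 0" "\<And>p q. P p \<Longrightarrow> P q \<Longrightarrow> P (p + q)" "\<And>x c. P (Poly_Mapping.single x c)"
  shows "P p"
proof -
  have "P (\<Sum>x\<in>A. Poly_Mapping.single x (Poly_Mapping.lookup p x))" for A
    by (induction A rule: infinite_finite_induct) (auto intro: assms)
  then show ?thesis by (subst poly_mapping_eq_sum_single)
qed

lemma scaleC_single: "c *\<^sub>C Poly_Mapping.single x (d::complex) = Poly_Mapping.single x (c * d)"
  by (rule poly_mapping_eqI)
    (simp add: scaleC_poly_mapping.rep_eq lookup_single when_def scaleC_complex_def)

section \<open>Tensor products\<close>

inductive_set tensor_relators :: "('a::complex_vector \<times> 'b::complex_vector \<Rightarrow>\<^sub>0 complex) set"
  where
    add_left: "Poly_Mapping.single (a + a', b) 1 - Poly_Mapping.single (a, b) 1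
        - Poly_Mapping.single (a', b) 1 \<in> tensor_relators"
  | add_right: "Poly_Mapping.single (a, b + b') 1 - Poly_Mapping.single (a, b) 1
        - Poly_Mapping.single (a, b') 1 \<in> tensor_relators"
  | scaleC_left: "Poly_Mapping.single (c *\<^sub>C a, b) 1 - Poly_Mapping.single (a, b) c \<in> tensor_relators"
  | scaleC_right: "Poly_Mapping.single (a, c *\<^sub>C b) 1 - Poly_Mapping.single (a, b) c \<in> tensor_relators"

definition tensor_null :: "('a::complex_vector \<times> 'b::complex_vector \<Rightarrow>\<^sub>0 complex) set"
  where "tensor_null = complex_vector.span tensor_relators"

lemma equivp_subspace_diff:
  assumes "complex_vector.subspace (N :: 'a::complex_vector set)"
  shows "equivp (\<lambda>p q. p - q \<in> N)"
proof (rule equivpI)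
  show "reflp (\<lambda>p q. p - q \<in> N)"
    using assms by (simp add: reflp_def complex_vector.subspace_0)
  show "symp (\<lambda>p q. p - q \<in> N)"
  proof (rule sympI)
    fix p q assume "p - q \<in> N"
    from complex_vector.subspace_neg[OF assms this] show "q - p \<in> N" by simp
  qed
  show "transp (\<lambda>p q. p - q \<in> N)"
  proof (rule transpI)
    fix p q r assume "p - q \<in> N" "q - r \<in> N"
    from complex_vector.subspace_add[OF assms this] show "p - r \<in> N" by simp
  qed
qed

lemma subspace_tensor_null: "complex_vector.subspace tensor_null"
  unfolding tensor_null_def by (rule complex_vector.subspace_span)

quotient_type (overloaded) ('a, 'b) tensor =
  "('a::complex_vector \<times> 'b::complex_vector) \<Rightarrow>\<^sub>0 complex" / "\<lambda>p q. p - q \<in> tensor_null"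
  by (rule equivp_subspace_diff[OF subspace_tensor_null])

instantiation tensor :: (complex_vector, complex_vector) complex_vector
begin
lift_definition zero_tensor :: "('a, 'b) tensor" is 0 .
lift_definition plus_tensor :: "('a, 'b) tensor \<Rightarrow> ('a, 'b) tensor \<Rightarrow> ('a, 'b) tensor" is "(+)"
  by (drule (1) complex_vector.subspace_add[OF subspace_tensor_null]) (simp add: algebra_simps)
lift_definition minus_tensor :: "('a, 'b) tensor \<Rightarrow> ('a, 'b) tensor \<Rightarrow> ('a, 'b) tensor" is "(-)"
  by (drule (1) complex_vector.subspace_diff[OF subspace_tensor_null]) (simp add: algebra_simps)
lift_definition uminus_tensor :: "('a, 'b) tensor \<Rightarrow> ('a, 'b) tensor" is uminus
  by (drule complex_vector.subspace_neg[OF subspace_tensor_null]) simp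
lift_definition scaleC_tensor :: "complex \<Rightarrow> ('a, 'b) tensor \<Rightarrow> ('a, 'b) tensor" is scaleC
  by (simp add: complex_vector.scale_right_diff_distrib[symmetric]
      complex_vector.subspace_scale[OF subspace_tensor_null])
instance
proof
  note zero_mem = complex_vector.subspace_0[OF subspace_tensor_null]
  fix a b :: complex and S T U :: "('a, 'b) tensor"
  show "S + T + U = S + (T + U)" "S + T = T + S" "0 + S = S" "- S + S = 0" "S - T = S + - T"
    by (transfer, simp add: zero_mem add_ac)+
  show "a *\<^sub>C (S + T) = a *\<^sub>C S + a *\<^sub>C T" "(a + b) *\<^sub>C S = a *\<^sub>C S + b *\<^sub>C S"
    "a *\<^sub>C b *\<^sub>C S = (a * b) *\<^sub>C S" "1 *\<^sub>C S = S"
    by (transfer, simp add: zero_mem scaleC_add_right scaleC_add_left)+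
qed
end

lift_definition tensor_pure :: "'a::complex_vector \<Rightarrow> 'b::complex_vector \<Rightarrow> ('a, 'b) tensor" (infixr \<open>\<otimes>\<close> 72)
  is "\<lambda>a b. Poly_Mapping.single (a, b) 1" .

text \<open>The linear map on the tensor product induced by a bilinear map \<open>m\<close>.\<close>

definition tensor_lift ::
    "('a::complex_vector \<Rightarrow> 'b::complex_vector \<Rightarrow> 'c::complex_vector) \<Rightarrow> ('a, 'b) tensor \<Rightarrow> 'c"
  where "tensor_lift m T = free_linear (\<lambda>(a, b). m a b) (rep_tensor T)"

lemma tensor_pure_add_left: "(a + a') \<otimes> b = a \<otimes> b + a' \<otimes> b"
  by transfer (metis tensor_null_def complex_vector.span_base diff_diff_eq tensor_relators.add_left)

lemma tensor_pure_add_right: "a \<otimes> (b + b') = a \<otimes> b + a \<otimes> b'"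
  by transfer (metis tensor_null_def complex_vector.span_base diff_diff_eq tensor_relators.add_right)

lemma tensor_pure_scaleC_left: "(c *\<^sub>C a) \<otimes> b = c *\<^sub>C (a \<otimes> b)"
  by transfer (simp add: tensor_null_def scaleC_single tensor_relators.scaleC_left
      complex_vector.span_base)

lemma tensor_pure_scaleC_right: "a \<otimes> (c *\<^sub>C b) = c *\<^sub>C (a \<otimes> b)"
  by transfer (simp add: tensor_null_def scaleC_single tensor_relators.scaleC_right
      complex_vector.span_base)

lemma tensor_induct [case_names zero add pure]:
  assumes "P 0" "\<And>S T. P S \<Longrightarrow> P T \<Longrightarrow> P (S + T)" "\<And>a b. P (a \<otimes> b)"
  shows "P T"
proof -
  have "P (abs_tensor p)" for p
  proof (induction p rule: poly_mapping_single_induct)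
    case 1
    show ?case using assms(1) unfolding zero_tensor_def .
  next
    case (2 p q)
    from assms(2)[OF this] show ?case by (simp only: plus_tensor.abs_eq)
  next
    case (3 x c)
    obtain a b where x: "x = (a, b)" by (cases x)
    have "abs_tensor (Poly_Mapping.single x c) = c *\<^sub>C (a \<otimes> b)"
      by (simp add: x tensor_pure.abs_eq scaleC_tensor.abs_eq scaleC_single)
    also have "\<dots> = (c *\<^sub>C a) \<otimes> b" by (simp only: tensor_pure_scaleC_left)
    finally show ?case using assms(3) by simp
  qed
  from this[of "rep_tensor T"] show ?thesis
    by (simp only: Quotient3_abs_rep[OF Quotient3_tensor])
qed

lemma free_linear_tensor_null:
  assumes "cbilinear m" "p \<in> tensor_null"
  shows "free_linear (\<lambda>(a, b). m a b) p = 0"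
proof -
  note lin = clinear_free_linear[of "\<lambda>(a, b). m a b"]
  have m: "m (a + a') b = m a b + m a' b" "m a (b + b') = m a b + m a b'"
     "m (c *\<^sub>C a) b = c *\<^sub>C m a b" "m a (c *\<^sub>C b) = c *\<^sub>C m a b" for a a' b b' c
    using assms(1) by (simp_all add: cbilinear_def clinear_iff)
  have "complex_vector.subspace {p. free_linear (\<lambda>(a, b). m a b) p = 0}"
    by (simp add: complex_vector.subspace_def clinear_add[OF lin] clinear_zero[OF lin]
        clinear_scaleC[OF lin])
  moreover have "tensor_relators \<subseteq> {p. free_linear (\<lambda>(a, b). m a b) p = 0}"
  proof
    fix p :: "'a \<times> 'b \<Rightarrow>\<^sub>0 complex" assume "p \<in> tensor_relators"
    then show "p \<in> {p. free_linear (\<lambda>(a, b). m a b) p = 0}"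
      by cases (simp_all add: clinear_diff[OF lin] free_linear_single m)
  qed
  ultimately show ?thesis
    using assms(2) complex_vector.span_minimal unfolding tensor_null_def by blast
qed

lemma tensor_abs_rep: "abs_tensor (rep_tensor T) = T"
  by (rule Quotient3_abs_rep[OF Quotient3_tensor])

lemma tensor_lift_abs:
  assumes "cbilinear m"
  shows "tensor_lift m (abs_tensor p) = free_linear (\<lambda>(a, b). m a b) p"
proof -
  have "p - p \<in> tensor_null"
    using complex_vector.subspace_0[OF subspace_tensor_null] by simp
  then have "rep_tensor (abs_tensor p) - p \<in> tensor_null"
    by (rule Quotient3_rep_abs[OF Quotient3_tensor])
  from free_linear_tensor_null[OF assms this]
  have "free_linear (\<lambda>(a, b). m a b) (rep_tensor (abs_tensor p)) - free_linear (\<lambda>(a, b). m a b) p = 0"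
    by (simp only: clinear_diff[OF clinear_free_linear])
  then show ?thesis
    unfolding tensor_lift_def by (simp only: right_minus_eq)
qed

lemma tensor_lift_pure:
  assumes "cbilinear m" shows "tensor_lift m (a \<otimes> b) = m a b"
  unfolding tensor_pure.abs_eq tensor_lift_abs[OF assms] by (simp add: free_linear_single)

lemma clinear_tensor_lift:
  assumes "cbilinear m" shows "clinear (tensor_lift m)"
proof (rule clinearI)
  fix S T :: "('a, 'b) tensor" and c
  note lin = clinear_free_linear[of "\<lambda>(a, b). m a b"]
  have *: "tensor_lift m (abs_tensor p + abs_tensor q) = tensor_lift m (abs_tensor p) + tensor_lift m (abs_tensor q)"
    "tensor_lift m (c *\<^sub>C abs_tensor p) = c *\<^sub>C tensor_lift m (abs_tensor p)" for p q
    by (simp_all only: plus_tensor.abs_eq scaleC_tensor.abs_eq tensor_lift_abs[OF assms]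
        clinear_add[OF lin] clinear_scaleC[OF lin])
  show "tensor_lift m (S + T) = tensor_lift m S + tensor_lift m T"
    using *(1)[of "rep_tensor S" "rep_tensor T"] by (simp only: tensor_abs_rep)
  show "tensor_lift m (c *\<^sub>C T) = c *\<^sub>C tensor_lift m T"
    using *(2)[of "rep_tensor T"] by (simp only: tensor_abs_rep)
qed

definition tensor_map ::
    "('a::complex_vector \<Rightarrow> 'c::complex_vector) \<Rightarrow> ('b::complex_vector \<Rightarrow> 'd::complex_vector)
      \<Rightarrow> ('a, 'b) tensor \<Rightarrow> ('c, 'd) tensor"
  where "tensor_map F G = tensor_lift (\<lambda>a b. F a \<otimes> G b)"

instantiation tensor :: (complex_algebra, complex_algebra) complex_algebra
begin
definition one_tensor :: "('a, 'b) tensor" where "one_tensor = 1 \<otimes> 1"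
definition times_tensor :: "('a, 'b) tensor \<Rightarrow> ('a, 'b) tensor \<Rightarrow> ('a, 'b) tensor"
  where "S * T = tensor_lift (\<lambda>a b. tensor_lift (\<lambda>c d. (a * c) \<otimes> (b * d)) T) S"
instance
proof
  note tensor_pure_simps = tensor_pure_add_left tensor_pure_add_right
    tensor_pure_scaleC_left tensor_pure_scaleC_right
  have bil: "cbilinear (\<lambda>c d. (a * c) \<otimes> (b * d))" for a :: 'a and b :: 'b
    by (simp add: cbilinear_def clinear_iff tensor_pure_simps distrib_left mult_scaleC_right)
  note lin = clinear_tensor_lift[OF bil]
  have bil': "cbilinear (\<lambda>a b. tensor_lift (\<lambda>c d. (a * c) \<otimes> (b * d)) T)" for T :: "('a, 'b) tensor"
  proof (induction T rule: tensor_induct)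
    case zero
    then show ?case by (simp add: cbilinear_def clinear_iff clinear_zero[OF lin])
  next
    case (add S T)
    then show ?case by (simp add: cbilinear_def clinear_iff clinear_add[OF lin] scaleC_add_right)
  next
    case (pure c d)
    then show ?case
      by (simp add: cbilinear_def clinear_iff tensor_lift_pure[OF bil] tensor_pure_simps
          distrib_right mult_scaleC_left)
  qed
  have pure_left: "(a \<otimes> b) * T = tensor_lift (\<lambda>c d. (a * c) \<otimes> (b * d)) T"
    for a :: 'a and b :: 'b and T
    by (simp only: times_tensor_def tensor_lift_pure[OF bil'])
  have pure_mult: "(a \<otimes> b) * (c \<otimes> d) = (a * c) \<otimes> (b * d)" for a c :: 'a and b d :: 'b
    by (simp add: pure_left tensor_lift_pure[OF bil])
  have addl: "(S + T) * R = S * R + T * R" and scl: "k *\<^sub>C S * R = k *\<^sub>C (S * R)"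
    for S T R :: "('a, 'b) tensor" and k
    by (simp_all add: times_tensor_def clinear_add[OF clinear_tensor_lift[OF bil']]
        clinear_scaleC[OF clinear_tensor_lift[OF bil']])
  have z0: "0 * R = 0" for R :: "('a, 'b) tensor"
    using addl[of 0 0 R] by simp
  have addr: "R * (S + T) = R * S + R * T" for S T R :: "('a, 'b) tensor"
  proof (induction R rule: tensor_induct)
    case (pure a b)
    then show ?case by (simp add: pure_left clinear_add[OF lin])
  qed (simp_all add: addl z0 add_ac)
  have r0: "R * 0 = 0" for R :: "('a, 'b) tensor"
    using addr[of R 0 0] by simp
  have scr: "R * k *\<^sub>C S = k *\<^sub>C (R * S)" for S R :: "('a, 'b) tensor" and k
  proof (induction R rule: tensor_induct)
    case (pure a b)
    then show ?case by (simp add: pure_left clinear_scaleC[OF lin])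
  qed (simp_all add: addl z0 scaleC_add_right)
  fix R S T :: "('a, 'b) tensor" and k :: complex
  show "(R + S) * T = R * T + S * T" "R * (S + T) = R * S + R * T"
    "k *\<^sub>C R * S = k *\<^sub>C (R * S)" "R * k *\<^sub>C S = k *\<^sub>C (R * S)"
    by (rule addl addr scl scr)+
  show "R * S * T = R * (S * T)"
  proof (induction R rule: tensor_induct)
    case (pure a b)
    show ?case
    proof (induction S rule: tensor_induct)
      case (pure c d)
      show ?case
        by (induction T rule: tensor_induct) (simp_all add: addr r0 pure_mult mult.assoc)
    qed (simp_all add: addl addr r0 z0)
  qed (simp_all add: addl z0)
  show "1 * R = R" "R * 1 = R"
    by (induction R rule: tensor_induct; simp add: addl addr r0 z0 pure_mult one_tensor_def)+
qed
end

lemma cbilinear_tensor_mult: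
  fixes a :: "'a::complex_algebra" and b :: "'b::complex_algebra"
  shows "cbilinear (\<lambda>c d. (a * c) \<otimes> (b * d))"
  by (simp add: cbilinear_def clinear_iff tensor_pure_add_left tensor_pure_add_right
      tensor_pure_scaleC_left tensor_pure_scaleC_right distrib_left mult_scaleC_right)

lemma tensor_pure_mult:
  fixes a c :: "'a::complex_algebra" and b d :: "'b::complex_algebra"
  shows "(a \<otimes> b) * (c \<otimes> d) = (a * c) \<otimes> (b * d)"
proof -
  have "cbilinear (\<lambda>a b. tensor_lift (\<lambda>c' d'. (a * c') \<otimes> (b * d')) (c \<otimes> d))"
    by (simp add: tensor_lift_pure[OF cbilinear_tensor_mult] cbilinear_def clinear_iff
      tensor_pure_add_left tensor_pure_add_right
      tensor_pure_scaleC_left tensor_pure_scaleC_right distrib_right mult_scaleC_left)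
  from tensor_lift_pure[OF this] show ?thesis
    by (simp add: times_tensor_def tensor_lift_pure[OF cbilinear_tensor_mult])
qed

section \<open>The universal enveloping algebra\<close>

text \<open>The free algebra on a set \<open>X\<close> is the algebra of the free monoid on \<open>X\<close>.\<close>

datatype 'a free_word = FWord (letters: "'a list")

instantiation free_word :: (type) monoid_add
begin
definition zero_free_word :: "'a free_word" where "0 = FWord []"
definition plus_free_word :: "'a free_word \<Rightarrow> 'a free_word \<Rightarrow> 'a free_word"
  where "v + w = FWord (letters v @ letters w)"
instance by standard (simp_all add: zero_free_word_def plus_free_word_def)
end

type_synonym 'a free_algebra = "'a free_word \<Rightarrow>\<^sub>0 complex"

definition free_gen :: "'a \<Rightarrow> 'a free_algebra"
  where "free_gen x = Poly_Mapping.single (FWord [x]) 1"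

lemma scaleC_eq_mult_left: "c *\<^sub>C p = Poly_Mapping.single 0 c * (p :: 'a free_algebra)"
proof (induction p rule: poly_mapping_single_induct)
  case (2 p q)
  then show ?case by (simp add: scaleC_add_right distrib_left)
qed (simp_all add: scaleC_single mult_single)

lemma scaleC_eq_mult_right: "c *\<^sub>C p = (p :: 'a free_algebra) * Poly_Mapping.single 0 c"
proof (induction p rule: poly_mapping_single_induct)
  case (2 p q)
  then show ?case by (simp add: scaleC_add_right distrib_right)
qed (simp_all add: scaleC_single mult_single mult.commute)

text \<open>The relators \<open>add\<close> and \<open>scaleC\<close> present the tensor algebra of the Lie algebra as a
  quotient of the free algebra on its underlying set.\<close>

inductive_set uea_relators :: "'g::complex_lie_algebra free_algebra set"
  where
    add: "free_gen (g + h) - free_gen g - free_gen h \<in> uea_relators"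
  | scaleC: "free_gen (c *\<^sub>C g) - c *\<^sub>C free_gen g \<in> uea_relators"
  | bracket: "free_gen g * free_gen h - free_gen h * free_gen g - free_gen (bracket g h) \<in> uea_relators"

inductive_set uea_ideal :: "'g::complex_lie_algebra free_algebra set"
  where
    relator: "p \<in> uea_relators \<Longrightarrow> p \<in> uea_ideal"
  | zero: "0 \<in> uea_ideal"
  | add: "p \<in> uea_ideal \<Longrightarrow> q \<in> uea_ideal \<Longrightarrow> p + q \<in> uea_ideal"
  | mult: "p \<in> uea_ideal \<Longrightarrow> a * p * b \<in> uea_ideal"

lemma subspace_uea_ideal: "complex_vector.subspace uea_ideal"
proof (rule complex_vector.subspaceI)
  fix c and p :: "'a free_algebra" assume "p \<in> uea_ideal"
  from uea_ideal.mult[OF this, of "Poly_Mapping.single 0 c" 1] show "c *\<^sub>C p \<in> uea_ideal"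
    by (simp add: scaleC_eq_mult_left)
qed (auto intro: uea_ideal.zero uea_ideal.add)

quotient_type (overloaded) 'g uea = "'g::complex_lie_algebra free_algebra" / "\<lambda>p q. p - q \<in> uea_ideal"
  by (rule equivp_subspace_diff[OF subspace_uea_ideal])

instantiation uea :: (complex_lie_algebra) complex_algebra
begin
lift_definition zero_uea :: "'a uea" is 0 .
lift_definition one_uea :: "'a uea" is 1 .
lift_definition plus_uea :: "'a uea \<Rightarrow> 'a uea \<Rightarrow> 'a uea" is "(+)"
  by (drule (1) complex_vector.subspace_add[OF subspace_uea_ideal]) (simp add: algebra_simps)
lift_definition minus_uea :: "'a uea \<Rightarrow> 'a uea \<Rightarrow> 'a uea" is "(-)"
  by (drule (1) complex_vector.subspace_diff[OF subspace_uea_ideal]) (simp add: algebra_simps)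
lift_definition uminus_uea :: "'a uea \<Rightarrow> 'a uea" is uminus
  by (drule complex_vector.subspace_neg[OF subspace_uea_ideal]) simp
lift_definition scaleC_uea :: "complex \<Rightarrow> 'a uea \<Rightarrow> 'a uea" is scaleC
  by (simp add: complex_vector.scale_right_diff_distrib[symmetric]
      complex_vector.subspace_scale[OF subspace_uea_ideal])
lift_definition times_uea :: "'a uea \<Rightarrow> 'a uea \<Rightarrow> 'a uea" is "(*)"
proof -
  fix p p' q q' :: "'a free_algebra"
  assume "p - p' \<in> uea_ideal" "q - q' \<in> uea_ideal"
  then have "1 * (p - p') * q + p' * (q - q') * 1 \<in> uea_ideal"
    by (intro uea_ideal.add uea_ideal.mult)
  moreover have "1 * (p - p') * q + p' * (q - q') * 1 = p * q - p' * q'"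
    by (simp add: left_diff_distrib right_diff_distrib)
  ultimately show "p * q - p' * q' \<in> uea_ideal" by simp
qed
instance
proof
  fix a b :: complex and u v w :: "'a uea"
  show "u + v + w = u + (v + w)" "u + v = v + u" "0 + u = u" "- u + u = 0" "u - v = u + - v"
    by (transfer, simp add: uea_ideal.zero add_ac)+
  show "a *\<^sub>C (u + v) = a *\<^sub>C u + a *\<^sub>C v" "(a + b) *\<^sub>C u = a *\<^sub>C u + b *\<^sub>C u"
    "a *\<^sub>C b *\<^sub>C u = (a * b) *\<^sub>C u" "1 *\<^sub>C u = u"
    by (transfer, simp add: uea_ideal.zero scaleC_add_right scaleC_add_left)+
  show "u * v * w = u * (v * w)" "(u + v) * w = u * w + v * w" "u * (v + w) = u * v + u * w"
    "1 * u = u" "u * 1 = u"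
    by (transfer, simp add: uea_ideal.zero mult.assoc distrib_left distrib_right)+
  show "a *\<^sub>C u * v = a *\<^sub>C (u * v)"
    by (transfer, simp add: uea_ideal.zero scaleC_eq_mult_left mult.assoc)
  show "u * a *\<^sub>C v = a *\<^sub>C (u * v)"
    by (transfer, simp add: uea_ideal.zero scaleC_eq_mult_right mult.assoc)
qed
end

lift_definition uea_embed :: "'g::complex_lie_algebra \<Rightarrow> 'g uea" is free_gen .

lemma clinear_uea_embed: "clinear (uea_embed :: 'g::complex_lie_algebra \<Rightarrow> 'g uea)"
proof (rule clinearI)
  fix g h :: 'g and c
  show "uea_embed (g + h) = uea_embed g + uea_embed h"
    using uea_ideal.relator[OF uea_relators.add, of g h] by transfer (simp add: algebra_simps)
  show "uea_embed (c *\<^sub>C g) = c *\<^sub>C uea_embed g"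
    using uea_ideal.relator[OF uea_relators.scaleC, of c g] by transfer
qed

lemma uea_embed_bracket:
  "uea_embed (bracket g h) = uea_embed g * uea_embed h - uea_embed h * uea_embed g"
proof -
  have "uea_embed g * uea_embed h - uea_embed h * uea_embed g = uea_embed (bracket g h)"
    by transfer (rule uea_ideal.relator[OF uea_relators.bracket])
  then show ?thesis by simp
qed

definition free_eval :: "('g \<Rightarrow> 'a::complex_algebra) \<Rightarrow> 'g free_algebra \<Rightarrow> 'a"
  where "free_eval j = free_linear (\<lambda>w. prod_list (map j (letters w)))"

text \<open>The algebra homomorphism on the universal enveloping algebra induced by a Lie algebra
  homomorphism \<open>j\<close> into an associative algebra.\<close>

definition uea_lift :: "('g::complex_lie_algebra \<Rightarrow> 'a::complex_algebra) \<Rightarrow> 'g uea \<Rightarrow> 'a"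
  where "uea_lift j u = free_eval j (rep_uea u)"

lemma clinear_free_eval: "clinear (free_eval j)"
  unfolding free_eval_def by (rule clinear_free_linear)

lemma free_eval_mult: "free_eval j (p * q) = free_eval j p * free_eval j q"
proof (induction p rule: poly_mapping_single_induct)
  case 1
  show ?case by (simp add: clinear_zero[OF clinear_free_eval])
next
  case (2 p p')
  then show ?case by (simp add: clinear_add[OF clinear_free_eval] distrib_right)
next
  case (3 v c)
  show ?case
  proof (induction q rule: poly_mapping_single_induct)
    case 1
    show ?case by (simp add: clinear_zero[OF clinear_free_eval])
  next
    case (2 q q')
    then show ?case by (simp add: clinear_add[OF clinear_free_eval] distrib_left)
  next
    case (3 w d)
    show ?case
      by (simp add: free_eval_def mult_single free_linear_single plus_free_word_def
          mult_scaleC_left mult_scaleC_right)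
  qed
qed

lemma free_eval_gen: "free_eval j (free_gen g) = j g"
  by (simp add: free_eval_def free_gen_def free_linear_single)

lemma free_eval_one: "free_eval j 1 = 1"
  unfolding free_eval_def single_one[symmetric] by (simp add: free_linear_single zero_free_word_def)

definition lie_hom_assoc :: "('g::complex_lie_algebra \<Rightarrow> 'a::complex_algebra) \<Rightarrow> bool"
  where "lie_hom_assoc j \<longleftrightarrow> clinear j \<and> (\<forall>g h. j (bracket g h) = j g * j h - j h * j g)"

lemma free_eval_ideal:
  assumes "lie_hom_assoc j" "p \<in> uea_ideal"
  shows "free_eval j p = 0"
  using assms(2)
proof induction
  case (relator p)
  then show ?case
    using assms(1)
    by cases (simp_all add: lie_hom_assoc_def clinear_diff[OF clinear_free_eval] free_eval_mult
        clinear_scaleC[OF clinear_free_eval] free_eval_gen clinear_iff)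
qed (simp_all add: clinear_zero[OF clinear_free_eval] clinear_add[OF clinear_free_eval] free_eval_mult)

lemma uea_abs_rep: "abs_uea (rep_uea u) = u"
  by (rule Quotient3_abs_rep[OF Quotient3_uea])

lemma uea_lift_abs:
  assumes "lie_hom_assoc j"
  shows "uea_lift j (abs_uea p) = free_eval j p"
proof -
  have "p - p \<in> uea_ideal" by (simp add: uea_ideal.zero)
  then have "rep_uea (abs_uea p) - p \<in> uea_ideal"
    by (rule Quotient3_rep_abs[OF Quotient3_uea])
  from free_eval_ideal[OF assms this]
  have "free_eval j (rep_uea (abs_uea p)) - free_eval j p = 0"
    by (simp only: clinear_diff[OF clinear_free_eval])
  then show ?thesis
    unfolding uea_lift_def by (simp only: right_minus_eq)
qed

lemma
  assumes "lie_hom_assoc j"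
  shows clinear_uea_lift: "clinear (uea_lift j)"
    and uea_lift_mult: "uea_lift j (u * v) = uea_lift j u * uea_lift j v"
    and uea_lift_one: "uea_lift j 1 = 1"
    and uea_lift_embed: "uea_lift j (uea_embed g) = j g"
proof -
  note lin = clinear_free_eval[of j]
  have *: "uea_lift j (abs_uea p + abs_uea q) = uea_lift j (abs_uea p) + uea_lift j (abs_uea q)"
    "uea_lift j (c *\<^sub>C abs_uea p) = c *\<^sub>C uea_lift j (abs_uea p)"
    "uea_lift j (abs_uea p * abs_uea q) = uea_lift j (abs_uea p) * uea_lift j (abs_uea q)" for p q c
    by (simp_all only: plus_uea.abs_eq scaleC_uea.abs_eq times_uea.abs_eq uea_lift_abs[OF assms]
        clinear_add[OF lin] clinear_scaleC[OF lin] free_eval_mult)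
  show "clinear (uea_lift j)"
  proof (rule clinearI)
    fix u v c
    show "uea_lift j (u + v) = uea_lift j u + uea_lift j v"
      using *(1)[of "rep_uea u" "rep_uea v"] by (simp only: uea_abs_rep)
    show "uea_lift j (c *\<^sub>C u) = c *\<^sub>C uea_lift j u"
      using *(2)[of c "rep_uea u"] by (simp only: uea_abs_rep)
  qed
  show "uea_lift j (u * v) = uea_lift j u * uea_lift j v"
    using *(3)[of "rep_uea u" "rep_uea v"] by (simp only: uea_abs_rep)
  show "uea_lift j 1 = 1"
    by (simp only: one_uea.abs_eq uea_lift_abs[OF assms] free_eval_one)
  show "uea_lift j (uea_embed g) = j g"
    by (simp only: uea_embed.abs_eq uea_lift_abs[OF assms] free_eval_gen)
qed

section \<open>Hopf algebra structure and the Eulerian idempotent\<close>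

definition uea_counit :: "'g::complex_lie_algebra uea \<Rightarrow> complex"
  where "uea_counit = uea_lift (\<lambda>_. 0)"

definition uea_unit :: "complex \<Rightarrow> 'g::complex_lie_algebra uea"
  where "uea_unit c = c *\<^sub>C 1"

definition uea_coproduct :: "'g::complex_lie_algebra uea \<Rightarrow> ('g uea, 'g uea) tensor"
  where "uea_coproduct = uea_lift (\<lambda>g. uea_embed g \<otimes> 1 + 1 \<otimes> uea_embed g)"

lemma lie_hom_assoc_counit: "lie_hom_assoc (\<lambda>_. 0 :: complex)"
  by (simp add: lie_hom_assoc_def clinear_iff)

lemmas clinear_uea_counit = clinear_uea_lift[OF lie_hom_assoc_counit, folded uea_counit_def]
lemmas uea_counit_mult = uea_lift_mult[OF lie_hom_assoc_counit, folded uea_counit_def]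
lemmas uea_counit_one = uea_lift_one[OF lie_hom_assoc_counit, folded uea_counit_def]
lemmas uea_counit_embed = uea_lift_embed[OF lie_hom_assoc_counit, folded uea_counit_def]

lemma uea_counit_minus: "uea_counit (- u) = - uea_counit u"
  using clinear_diff[OF clinear_uea_counit, of 0 u] by (simp add: clinear_zero[OF clinear_uea_counit])

lemma tensor_pure_diff_left: "(a - a') \<otimes> b = a \<otimes> b - a' \<otimes> b"
  by (metis tensor_pure_add_left diff_add_cancel add_diff_cancel)

lemma tensor_pure_diff_right: "a \<otimes> (b - b') = a \<otimes> b - a \<otimes> b'"
  by (metis tensor_pure_add_right diff_add_cancel add_diff_cancel)

lemma lie_hom_assoc_coproduct:
  "lie_hom_assoc (\<lambda>g :: 'g::complex_lie_algebra. uea_embed g \<otimes> 1 + 1 \<otimes> uea_embed g)"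
  unfolding lie_hom_assoc_def clinear_iff
  by (auto simp: clinear_add[OF clinear_uea_embed] clinear_scaleC[OF clinear_uea_embed]
      uea_embed_bracket tensor_pure_add_left tensor_pure_add_right tensor_pure_scaleC_left
      tensor_pure_scaleC_right tensor_pure_diff_left tensor_pure_diff_right scaleC_add_right
      tensor_pure_mult distrib_left distrib_right)

lemmas clinear_uea_coproduct = clinear_uea_lift[OF lie_hom_assoc_coproduct, folded uea_coproduct_def]
lemmas uea_coproduct_mult = uea_lift_mult[OF lie_hom_assoc_coproduct, folded uea_coproduct_def]
lemmas uea_coproduct_one = uea_lift_one[OF lie_hom_assoc_coproduct, folded uea_coproduct_def]
lemmas uea_coproduct_embed = uea_lift_embed[OF lie_hom_assoc_coproduct, folded uea_coproduct_def]

definition convolution ::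
    "('g::complex_lie_algebra uea \<Rightarrow> 'g uea) \<Rightarrow> ('g uea \<Rightarrow> 'g uea) \<Rightarrow> 'g uea \<Rightarrow> 'g uea"
  where "convolution F G x = tensor_lift (\<lambda>a b. F a * G b) (uea_coproduct x)"

primrec convolution_power ::
    "('g::complex_lie_algebra uea \<Rightarrow> 'g uea) \<Rightarrow> nat \<Rightarrow> 'g uea \<Rightarrow> 'g uea"
  where
    "convolution_power F 0 = (\<lambda>x. uea_unit (uea_counit x))"
  | "convolution_power F (Suc n) = convolution F (convolution_power F n)"

text \<open>The two series below are finite for each argument \<open>x\<close>; \<^const>\<open>Sum_any\<close> sums the
  finitely many nonzero terms.\<close>

definition eulerian :: "'g::complex_lie_algebra uea \<Rightarrow> 'g uea"
  where "eulerian x = Sum_any (\<lambda>k. ((-1) ^ k / of_nat (k + 1)) *\<^sub>C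
    convolution_power (\<lambda>y. y - uea_unit (uea_counit y)) (k + 1) x)"

text \<open>\<open>\<phi>\<^sub>s\<close> for a polynomial \<open>s\<close>; below \<open>s\<close> is the variable \<open>t = [:0, 1:]\<close> or \<open>- t = [:0, -1:]\<close>.\<close>

definition uea_phi ::
    "complex poly \<Rightarrow> 'g::complex_lie_algebra uea \<Rightarrow> ('g uea, complex poly) tensor"
  where "uea_phi s x = Sum_any (\<lambda>n. (1 / fact n) *\<^sub>C (convolution_power eulerian n x \<otimes> s ^ n))"

definition uea_A :: "'g::complex_lie_algebra uea \<Rightarrow> 'g \<Rightarrow> ('g uea, complex poly) tensor"
  where "uea_A x g =
    tensor_lift (\<lambda>y z. uea_phi [:0, -1:] y * uea_phi [:0, 1:] (z * uea_embed g)) (uea_coproduct x)"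

text \<open>The values of \<^const>\<open>eulerian\<close> and \<^const>\<open>uea_A\<close> lie in the images of the injections
  \<^const>\<open>uea_embed\<close> and \<open>tensor_map uea_embed id\<close>; here they are pulled back along them.\<close>

definition eulerian_lie :: "'g::complex_lie_algebra uea \<Rightarrow> 'g"
  where "eulerian_lie x = inv uea_embed (eulerian x)"

definition uea_A_lie :: "'g::complex_lie_algebra uea \<Rightarrow> 'g \<Rightarrow> ('g, complex poly) tensor"
  where "uea_A_lie x g = inv (tensor_map uea_embed id) (uea_A x g)"

section \<open>Lie algebra modules and Chevalley--Eilenberg cohomology\<close>

definition lie_module :: "('g::complex_lie_algebra \<Rightarrow> 'm::complex_vector \<Rightarrow> 'm) \<Rightarrow> bool"
  where "lie_module act \<longleftrightarrow> cbilinear act \<and>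
    (\<forall>g h m. act (bracket g h) m = act g (act h m) - act h (act g m))"

definition drop_nth :: "nat \<Rightarrow> 'a list \<Rightarrow> 'a list"
  where "drop_nth i xs = take i xs @ drop (Suc i) xs"

text \<open>A \<open>p\<close>-cochain is an alternating multilinear map on lists of length \<open>p\<close>, extended by zero
  to all other lists.\<close>

definition ce_cochains :: "nat \<Rightarrow> ('g::complex_lie_algebra list \<Rightarrow> 'm::complex_vector) set"
  where "ce_cochains p = {c.
    (\<forall>gs. length gs \<noteq> p \<longrightarrow> c gs = 0) \<and>
    (\<forall>gs i. length gs = p \<longrightarrow> i < p \<longrightarrow> clinear (\<lambda>g. c (gs[i := g]))) \<and>
    (\<forall>gs i j. length gs = p \<longrightarrow> i < j \<longrightarrow> j < p \<longrightarrow> gs ! i = gs ! j \<longrightarrow> c gs = 0)}"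

definition ce_d :: "('g::complex_lie_algebra \<Rightarrow> 'm::complex_vector \<Rightarrow> 'm)
    \<Rightarrow> ('g list \<Rightarrow> 'm) \<Rightarrow> 'g list \<Rightarrow> 'm"
  where "ce_d act c gs =
    (\<Sum>i<length gs. (-1) ^ i *\<^sub>C act (gs ! i) (c (drop_nth i gs))) +
    (\<Sum>j<length gs. \<Sum>i<j. (-1) ^ (i + j) *\<^sub>C
      c (bracket (gs ! i) (gs ! j) # drop_nth i (drop_nth j gs)))"

lemma ce_cochains_2_swap:
  assumes "c \<in> ce_cochains 2" shows "c [g, h] = - c [h, g]"
proof -
  have "\<forall>gs i. length gs = 2 \<longrightarrow> i < 2 \<longrightarrow> clinear (\<lambda>g. c (gs[i := g]))"
    and "\<forall>gs i j. length gs = 2 \<longrightarrow> i < j \<longrightarrow> j < 2 \<longrightarrow> gs ! i = gs ! j \<longrightarrow> c gs = 0"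
    using assms unfolding ce_cochains_def by blast+
  note lin = this(1)[rule_format, of "[a, b]" for a b] and alt = this(2)[rule_format, of "[a, a]" 0 1 for a]
  have "c [a + a', b] = c [a, b] + c [a', b]" "c [b, a + a'] = c [b, a] + c [b, a']" for a a' b
    using clinear_add[OF lin[of a b 0]] clinear_add[OF lin[of b a 1]] by simp_all
  then have "c [g + h, g + h] = c [g, g] + c [g, h] + (c [h, g] + c [h, h])"
    by (simp add: add_ac)
  then show ?thesis by (simp add: alt eq_neg_iff_add_eq_0)
qed

lemma ce_d_2:
  assumes "c \<in> ce_cochains 2"
  shows "ce_d act c [g1, g2, g3] =
    act g1 (c [g2, g3]) - act g2 (c [g1, g3]) + act g3 (c [g1, g2])
    - c [bracket g1 g2, g3] + c [bracket g1 g3, g2] + c [g1, bracket g2 g3]"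
  using ce_cochains_2_swap[OF assms, of g1 "bracket g2 g3"]
  by (simp add: ce_d_def drop_nth_def lessThan_Suc numeral_2_eq_2 numeral_3_eq_3 algebra_simps)

definition ce_cocycles :: "('g::complex_lie_algebra \<Rightarrow> 'm::complex_vector \<Rightarrow> 'm)
    \<Rightarrow> nat \<Rightarrow> ('g list \<Rightarrow> 'm) set"
  where "ce_cocycles act p = {c \<in> ce_cochains p. \<forall>gs. ce_d act c gs = 0}"

definition ce_coboundaries :: "('g::complex_lie_algebra \<Rightarrow> 'm::complex_vector \<Rightarrow> 'm)
    \<Rightarrow> nat \<Rightarrow> ('g list \<Rightarrow> 'm) set"
  where "ce_coboundaries act p = (case p of 0 \<Rightarrow> {\<lambda>_. 0} | Suc q \<Rightarrow> ce_d act ` ce_cochains q)"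

text \<open>The class of a cocycle in \<open>H\<^sup>p\<close>, as a coset of the space of coboundaries.\<close>

definition ce_class :: "('g::complex_lie_algebra \<Rightarrow> 'm::complex_vector \<Rightarrow> 'm)
    \<Rightarrow> nat \<Rightarrow> ('g list \<Rightarrow> 'm) \<Rightarrow> ('g list \<Rightarrow> 'm) set"
  where "ce_class act p c = {c' \<in> ce_cocycles act p. (\<lambda>gs. c' gs - c gs) \<in> ce_coboundaries act p}"

definition short_exact_lie_modules ::
    "('g::complex_lie_algebra \<Rightarrow> 'a::complex_vector \<Rightarrow> 'a) \<Rightarrow> ('g \<Rightarrow> 'b::complex_vector \<Rightarrow> 'b)
      \<Rightarrow> ('g \<Rightarrow> 'c::complex_vector \<Rightarrow> 'c) \<Rightarrow> ('a \<Rightarrow> 'b) \<Rightarrow> ('b \<Rightarrow> 'c) \<Rightarrow> bool"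
  where "short_exact_lie_modules actA actB actC i q \<longleftrightarrow>
    lie_module actA \<and> lie_module actB \<and> lie_module actC \<and> clinear i \<and> clinear q \<and>
    (\<forall>g a. i (actA g a) = actB g (i a)) \<and> (\<forall>g b. q (actB g b) = actC g (q b)) \<and>
    inj i \<and> surj q \<and> range i = {b. q b = 0}"

text \<open>The connecting homomorphism \<open>H\<^sup>p(C) \<rightarrow> H\<^sup>p\<^sup>+\<^sup>1(A)\<close> of a short exact sequence
  \<open>A \<rightarrow> B \<rightarrow> C\<close> with maps \<open>i\<close> and \<open>q\<close>: lift a representative of the given class to a \<open>B\<close>-valued
  cochain \<open>c\<close>; then \<open>d c\<close> is the image of an \<open>A\<close>-valued cocycle \<open>b\<close>, whose class is the value.\<close>

definition ce_connecting ::
    "('g::complex_lie_algebra \<Rightarrow> 'a::complex_vector \<Rightarrow> 'a) \<Rightarrow> ('g \<Rightarrow> 'b::complex_vector \<Rightarrow> 'b)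
      \<Rightarrow> ('a \<Rightarrow> 'b) \<Rightarrow> ('b \<Rightarrow> 'c::complex_vector) \<Rightarrow> nat \<Rightarrow> ('g list \<Rightarrow> 'c) set \<Rightarrow> ('g list \<Rightarrow> 'a) set"
  where "ce_connecting actA actB i q p X = ce_class actA (Suc p)
    (SOME b. b \<in> ce_cocycles actA (Suc p) \<and>
      (\<exists>c \<in> ce_cochains p. (\<lambda>gs. q (c gs)) \<in> X \<and> ce_d actB c = (\<lambda>gs. i (b gs))))"

section \<open>The modules dual to the enveloping algebra and to its augmentation ideal\<close>

typedef (overloaded) 'a dual = "{\<phi> :: 'a::complex_vector \<Rightarrow> complex. clinear \<phi>}"
  morphisms dual_apply Abs_dual
  by (rule exI[of _ "\<lambda>_. 0"]) (simp add: clinear_iff)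

setup_lifting type_definition_dual

lemma dual_eqI: "(\<And>x. dual_apply \<phi> x = dual_apply \<psi> x) \<Longrightarrow> \<phi> = \<psi>"
  by (metis dual_apply_inject ext)

instantiation dual :: (complex_vector) complex_vector
begin
lift_definition zero_dual :: "'a dual" is "\<lambda>_. 0" by (simp add: clinear_iff)
lift_definition plus_dual :: "'a dual \<Rightarrow> 'a dual \<Rightarrow> 'a dual" is "\<lambda>\<phi> \<psi> x. \<phi> x + \<psi> x"
  by (simp add: clinear_iff scaleC_add_right)
lift_definition minus_dual :: "'a dual \<Rightarrow> 'a dual \<Rightarrow> 'a dual" is "\<lambda>\<phi> \<psi> x. \<phi> x - \<psi> x"
  by (simp add: clinear_iff complex_vector.scale_right_diff_distrib)
lift_definition uminus_dual :: "'a dual \<Rightarrow> 'a dual" is "\<lambda>\<phi> x. - \<phi> x"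
  by (simp add: clinear_iff)
lift_definition scaleC_dual :: "complex \<Rightarrow> 'a dual \<Rightarrow> 'a dual" is "\<lambda>c \<phi> x. c *\<^sub>C \<phi> x"
  by (simp add: clinear_iff scaleC_add_right mult.commute)
instance
proof
  fix a b :: complex and u v w :: "'a dual"
  show "u + v + w = u + (v + w)" "u + v = v + u" "0 + u = u" "- u + u = 0" "u - v = u + - v"
    by (transfer, simp add: add_ac)+
  show "a *\<^sub>C (u + v) = a *\<^sub>C u + a *\<^sub>C v" "(a + b) *\<^sub>C u = a *\<^sub>C u + b *\<^sub>C u"
    "a *\<^sub>C b *\<^sub>C u = (a * b) *\<^sub>C u" "1 *\<^sub>C u = u"
    by (transfer, simp add: scaleC_add_right scaleC_add_left)+
qed
end

typedef (overloaded) 'g uea_aug = "{u :: 'g::complex_lie_algebra uea. uea_counit u = 0}"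
  by (rule exI[of _ 0]) (simp add: clinear_zero[OF clinear_uea_counit])

setup_lifting type_definition_uea_aug

lemma uea_counit_Rep_aug: "uea_counit (Rep_uea_aug y) = 0"
  using Rep_uea_aug[of y] by simp

instantiation uea_aug :: (complex_lie_algebra) complex_vector
begin
lift_definition zero_uea_aug :: "'a uea_aug" is 0
  by (simp add: clinear_zero[OF clinear_uea_counit])
lift_definition plus_uea_aug :: "'a uea_aug \<Rightarrow> 'a uea_aug \<Rightarrow> 'a uea_aug" is "(+)"
  by (simp add: clinear_add[OF clinear_uea_counit])
lift_definition minus_uea_aug :: "'a uea_aug \<Rightarrow> 'a uea_aug \<Rightarrow> 'a uea_aug" is "(-)"
  by (simp add: clinear_diff[OF clinear_uea_counit])
lift_definition uminus_uea_aug :: "'a uea_aug \<Rightarrow> 'a uea_aug" is uminus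
  by (simp add: uea_counit_minus)
lift_definition scaleC_uea_aug :: "complex \<Rightarrow> 'a uea_aug \<Rightarrow> 'a uea_aug" is scaleC
  by (simp add: clinear_scaleC[OF clinear_uea_counit])
instance
proof
  fix a b :: complex and u v w :: "'a uea_aug"
  show "u + v + w = u + (v + w)" "u + v = v + u" "0 + u = u" "- u + u = 0" "u - v = u + - v"
    by (transfer, simp add: add_ac)+
  show "a *\<^sub>C (u + v) = a *\<^sub>C u + a *\<^sub>C v" "(a + b) *\<^sub>C u = a *\<^sub>C u + b *\<^sub>C u"
    "a *\<^sub>C b *\<^sub>C u = (a * b) *\<^sub>C u" "1 *\<^sub>C u = u"
    by (transfer, simp add: scaleC_add_right scaleC_add_left)+
qed
end

definition trivial_act :: "'g::complex_lie_algebra \<Rightarrow> complex \<Rightarrow> complex"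
  where "trivial_act g c = 0"

lift_definition uea_dual_act :: "'g::complex_lie_algebra \<Rightarrow> 'g uea dual \<Rightarrow> 'g uea dual"
  is "\<lambda>g \<phi> x. \<phi> (x * uea_embed g)"
  by (simp add: clinear_iff distrib_right mult_scaleC_left)

lift_definition uea_aug_mult :: "'g::complex_lie_algebra uea_aug \<Rightarrow> 'g \<Rightarrow> 'g uea_aug"
  is "\<lambda>x g. x * uea_embed g"
  by (simp add: uea_counit_mult)

lift_definition uea_aug_dual_act :: "'g::complex_lie_algebra \<Rightarrow> 'g uea_aug dual \<Rightarrow> 'g uea_aug dual"
  is "\<lambda>g \<phi> x. \<phi> (uea_aug_mult x g)"
proof -
  fix g :: 'g and \<phi> :: "'g uea_aug \<Rightarrow> complex" assume "clinear \<phi>"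
  moreover have "uea_aug_mult (x + y) g = uea_aug_mult x g + uea_aug_mult y g"
    "uea_aug_mult (c *\<^sub>C x) g = c *\<^sub>C uea_aug_mult x g" for x y c
    by (transfer, simp add: distrib_right mult_scaleC_left)+
  ultimately show "clinear (\<lambda>x. \<phi> (uea_aug_mult x g))"
    by (simp add: clinear_iff)
qed

lift_definition uea_dual_counit :: "complex \<Rightarrow> 'g::complex_lie_algebra uea dual"
  is "\<lambda>c x. c * uea_counit x"
  by (rule clinearI) (simp_all add: clinear_add[OF clinear_uea_counit]
      clinear_scaleC[OF clinear_uea_counit] scaleC_complex_def algebra_simps)

lift_definition uea_dual_restrict :: "'g::complex_lie_algebra uea dual \<Rightarrow> 'g uea_aug dual"
  is "\<lambda>\<phi> x. \<phi> (Rep_uea_aug x)"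
  by (simp add: clinear_iff plus_uea_aug.rep_eq scaleC_uea_aug.rep_eq)

lemma short_exact_uea_dual:
  "short_exact_lie_modules (trivial_act :: 'g::complex_lie_algebra \<Rightarrow> _) uea_dual_act uea_aug_dual_act
    uea_dual_counit uea_dual_restrict"
proof -
  have triv: "lie_module (trivial_act :: 'g \<Rightarrow> _)"
    by (simp add: lie_module_def cbilinear_def trivial_act_def clinear_iff)
  have dual: "lie_module (uea_dual_act :: 'g \<Rightarrow> _)"
    unfolding lie_module_def cbilinear_def clinear_iff
  proof (intro conjI allI)
    fix g h :: 'g and \<phi> \<psi> :: "'g uea dual" and c
    show "uea_dual_act (g + h) \<phi> = uea_dual_act g \<phi> + uea_dual_act h \<phi>"
      by (transfer, simp add: clinear_add[OF clinear_uea_embed] distrib_left clinear_add)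
    show "uea_dual_act (c *\<^sub>C g) \<phi> = c *\<^sub>C uea_dual_act g \<phi>"
      by (transfer, simp add: clinear_scaleC[OF clinear_uea_embed] mult_scaleC_right clinear_scaleC)
    show "uea_dual_act g (\<phi> + \<psi>) = uea_dual_act g \<phi> + uea_dual_act g \<psi>"
      "uea_dual_act g (c *\<^sub>C \<phi>) = c *\<^sub>C uea_dual_act g \<phi>"
      by (transfer, simp)+
    show "uea_dual_act (bracket g h) \<phi> =
        uea_dual_act g (uea_dual_act h \<phi>) - uea_dual_act h (uea_dual_act g \<phi>)"
      by (transfer, simp add: uea_embed_bracket right_diff_distrib clinear_diff mult.assoc)
  qed
  have mult: "uea_aug_mult x (g + h) = uea_aug_mult x g + uea_aug_mult x h"
    "uea_aug_mult x (c *\<^sub>C g) = c *\<^sub>C uea_aug_mult x g"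
    "uea_aug_mult x (bracket g h) = uea_aug_mult (uea_aug_mult x g) h - uea_aug_mult (uea_aug_mult x h) g"
    for x and g h :: 'g and c
    by (transfer, simp add: clinear_add[OF clinear_uea_embed] clinear_scaleC[OF clinear_uea_embed]
        distrib_left mult_scaleC_right uea_embed_bracket right_diff_distrib mult.assoc)+
  have aug: "lie_module (uea_aug_dual_act :: 'g \<Rightarrow> _)"
    unfolding lie_module_def cbilinear_def clinear_iff
  proof (intro conjI allI)
    fix g h :: 'g and \<phi> \<psi> :: "'g uea_aug dual" and c
    show "uea_aug_dual_act (g + h) \<phi> = uea_aug_dual_act g \<phi> + uea_aug_dual_act h \<phi>"
      by (transfer, simp add: mult clinear_add)
    show "uea_aug_dual_act (c *\<^sub>C g) \<phi> = c *\<^sub>C uea_aug_dual_act g \<phi>"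
      by (transfer, simp add: mult clinear_scaleC)
    show "uea_aug_dual_act g (\<phi> + \<psi>) = uea_aug_dual_act g \<phi> + uea_aug_dual_act g \<psi>"
      "uea_aug_dual_act g (c *\<^sub>C \<phi>) = c *\<^sub>C uea_aug_dual_act g \<phi>"
      by (transfer, simp)+
    show "uea_aug_dual_act (bracket g h) \<phi> =
        uea_aug_dual_act g (uea_aug_dual_act h \<phi>) - uea_aug_dual_act h (uea_aug_dual_act g \<phi>)"
      by (transfer, simp add: mult clinear_diff)
  qed
  have lin_i: "clinear (uea_dual_counit :: _ \<Rightarrow> 'g uea dual)"
    by (rule clinearI; transfer; simp add: scaleC_complex_def algebra_simps)
  have lin_q: "clinear (uea_dual_restrict :: 'g uea dual \<Rightarrow> _)"
    by (rule clinearI; transfer; simp)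
  have equi_i: "uea_dual_counit (trivial_act g c) = uea_dual_act g (uea_dual_counit c)" for g :: 'g and c
    unfolding trivial_act_def by transfer (simp add: uea_counit_mult uea_counit_embed)
  have equi_q: "uea_dual_restrict (uea_dual_act g \<phi>) = uea_aug_dual_act g (uea_dual_restrict \<phi>)"
    for g :: 'g and \<phi>
    by transfer (simp add: uea_aug_mult.rep_eq)
  have inj_i: "inj (uea_dual_counit :: _ \<Rightarrow> 'g uea dual)"
  proof (rule injI)
    fix c d assume "(uea_dual_counit c :: 'g uea dual) = uea_dual_counit d"
    then have "dual_apply (uea_dual_counit c :: 'g uea dual) 1 = dual_apply (uea_dual_counit d :: 'g uea dual) 1"
      by simp
    then show "c = d" by (simp add: uea_dual_counit.rep_eq uea_counit_one)
  qed
  have surj_q: "surj (uea_dual_restrict :: 'g uea dual \<Rightarrow> _)"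
  proof (rule surjI)
    fix \<psi> :: "'g uea_aug dual"
    let ?P = "\<lambda>x. x - uea_counit x *\<^sub>C (1 :: 'g uea)"
    have P: "uea_counit (?P x) = 0" for x
      by (simp add: clinear_diff[OF clinear_uea_counit] clinear_scaleC[OF clinear_uea_counit]
          uea_counit_one scaleC_complex_def)
    let ?\<phi> = "\<lambda>x. dual_apply \<psi> (Abs_uea_aug (?P x))"
    have *: "Abs_uea_aug (?P (x + y)) = Abs_uea_aug (?P x) + Abs_uea_aug (?P y)"
       "Abs_uea_aug (?P (c *\<^sub>C x)) = c *\<^sub>C Abs_uea_aug (?P x)" for x y c
      using P
      by (simp_all add: plus_uea_aug_def scaleC_uea_aug_def Abs_uea_aug_inverse clinear_add[OF clinear_uea_counit]
          clinear_scaleC[OF clinear_uea_counit] scaleC_add_left scaleC_complex_def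
          complex_vector.scale_right_diff_distrib add_diff_add)
    have lin: "clinear (dual_apply \<psi>)" using dual_apply[of \<psi>] by simp
    have "clinear ?\<phi>"
      by (rule clinearI) (simp_all only: * clinear_add[OF lin] clinear_scaleC[OF lin])
    then have "dual_apply (Abs_dual ?\<phi>) = ?\<phi>" by (simp add: Abs_dual_inverse)
    then show "uea_dual_restrict (Abs_dual ?\<phi>) = \<psi>"
      by (intro dual_eqI) (simp add: uea_dual_restrict.rep_eq uea_counit_Rep_aug Rep_uea_aug_inverse)
  qed
  have exact: "range (uea_dual_counit :: _ \<Rightarrow> 'g uea dual) = {\<phi>. uea_dual_restrict \<phi> = 0}"
  proof (intro set_eqI iffI)
    fix \<phi> :: "'g uea dual" assume "\<phi> \<in> range uea_dual_counit"
    then obtain c where "\<phi> = uea_dual_counit c" by blast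
    then have "uea_dual_restrict \<phi> = 0"
      by (intro dual_eqI) (simp add: uea_dual_restrict.rep_eq uea_dual_counit.rep_eq
          zero_dual.rep_eq uea_counit_Rep_aug)
    then show "\<phi> \<in> {\<phi>. uea_dual_restrict \<phi> = 0}" by simp
  next
    fix \<phi> :: "'g uea dual" assume "\<phi> \<in> {\<phi>. uea_dual_restrict \<phi> = 0}"
    then have "uea_dual_restrict \<phi> = 0" by simp
    then have "dual_apply (uea_dual_restrict \<phi>) y = 0" for y by (simp add: zero_dual.rep_eq)
    then have 0: "dual_apply \<phi> (Rep_uea_aug y) = 0" for y by (simp add: uea_dual_restrict.rep_eq)
    have lin: "clinear (dual_apply \<phi>)" using dual_apply[of \<phi>] by simp
    have eq: "dual_apply \<phi> x = dual_apply \<phi> 1 * uea_counit x" for x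
    proof -
      have "uea_counit (x - uea_counit x *\<^sub>C (1 :: 'g uea)) = 0"
        by (simp add: clinear_diff[OF clinear_uea_counit] clinear_scaleC[OF clinear_uea_counit]
            uea_counit_one scaleC_complex_def)
      with 0[of "Abs_uea_aug (x - uea_counit x *\<^sub>C 1)"] show ?thesis
        by (simp add: Abs_uea_aug_inverse clinear_diff[OF lin] clinear_scaleC[OF lin] scaleC_complex_def)
    qed
    have "\<phi> = uea_dual_counit (dual_apply \<phi> 1)"
      by (rule dual_eqI, unfold uea_dual_counit.rep_eq, rule eq)
    then show "\<phi> \<in> range uea_dual_counit" by blast
  qed
  show ?thesis
    unfolding short_exact_lie_modules_def
    by (intro conjI allI triv dual aug lin_i lin_q equi_i equi_q inj_i surj_q exact)
qed

section \<open>The cochains\<close>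

text \<open>The \<open>\<complex>[t]\<close>-multilinear extension of the trilinear form \<open>(a, b, c) \<mapsto> f [a, b, c]\<close>.\<close>

definition trilinear_poly_ext :: "('g::complex_vector list \<Rightarrow> complex)
    \<Rightarrow> ('g, complex poly) tensor \<Rightarrow> ('g, complex poly) tensor \<Rightarrow> ('g, complex poly) tensor \<Rightarrow> complex poly"
  where "trilinear_poly_ext f R S T =
    tensor_lift (\<lambda>a p. tensor_lift (\<lambda>b q. tensor_lift (\<lambda>c r. smult (f [a, b, c]) (p * q * r)) T) S) R"

text \<open>The iterated coproduct is computed as \<open>(Id \<otimes> \<Delta>) \<circ> \<Delta>\<close>.\<close>

definition alpha_tilde_form :: "('g::complex_lie_algebra list \<Rightarrow> complex) \<Rightarrow> 'g uea \<Rightarrow> 'g \<Rightarrow> 'g \<Rightarrow> complex"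
  where "alpha_tilde_form f x g1 g2 =
    tensor_lift (\<lambda>x1 y. tensor_lift (\<lambda>x2 x3.
        integral {0..1} (\<lambda>t :: real. poly
          (trilinear_poly_ext f (eulerian_lie x1 \<otimes> 1) (uea_A_lie x2 g1) (uea_A_lie x3 g2))
          (complex_of_real t)))
      (uea_coproduct y)) (uea_coproduct x)"

definition alpha_tilde :: "('g::complex_lie_algebra list \<Rightarrow> complex) \<Rightarrow> 'g list \<Rightarrow> 'g uea dual"
  where "alpha_tilde f gs =
    (case gs of [g1, g2] \<Rightarrow> Abs_dual (\<lambda>x. alpha_tilde_form f x g1 g2) | _ \<Rightarrow> 0)"

definition alpha :: "('g::complex_lie_algebra list \<Rightarrow> complex) \<Rightarrow> 'g list \<Rightarrow> 'g uea_aug dual"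
  where "alpha f gs = uea_dual_restrict (alpha_tilde f gs)"

end

theory Submission
  imports Defs
begin

text \<open>Linear maps out of \<open>U\<gg>\<close> form a convolution algebra on which \<open>g \<in> \<gg>\<close> acts by the derivation
  \<open>(R\<^sub>g F)(x) = F (x g)\<close>, so cochains with values in \<open>(U\<gg>)\<^sup>\<or>\<close> behave like differential forms on a group. With
  \<open>\<phi>\<^sub>t = exp (t pr)\<close>, the element \<open>A\<^sub>t(g) = \<phi>\<^sub>-\<^sub>t \<star> R\<^sub>g \<phi>\<^sub>t\<close> is the pull-back of the Maurer--Cartan form along
  the contraction \<open>\<phi>\<^sub>t\<close>: it satisfies the Maurer--Cartan equation, \<open>d/dt A\<^sub>t(g) = R\<^sub>g pr + [A\<^sub>t(g), pr]\<close>,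
  \<open>A\<^sub>0 = 0\<close> and \<open>A\<^sub>1(g) = \<epsilon> g\<close>. For a cocycle \<open>f\<close> these give \<open>d f(pr, A\<^sub>t, A\<^sub>t) = d/dt f(A\<^sub>t, A\<^sub>t, A\<^sub>t)\<close>, as in the
  Poincare lemma, and integrating over \<open>t\<close> yields \<open>d \<alpha>\<^sup>~ = \<epsilon> f\<close>.

  Everything is computed on the powers of single elements of \<open>\<gg>\<close>, which span \<open>U\<gg>\<close>: there \<open>pr (y\<^sup>n) = 0\<close> for \<open>n \<noteq> 1\<close>
  and \<open>\<phi>\<^sub>t (y\<^sup>n) = t\<^sup>n y\<^sup>n\<close>. That \<open>\<gg>\<close> embeds into \<open>U\<gg>\<close> is first shown for \<open>s \<gg>[s]\<close>, which has an injective
  derivation, and descends to its quotient \<open>\<gg>\<close> because \<open>pr\<close> preserves ideals.\<close>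

section \<open>Powers span the enveloping algebra\<close>

text \<open>The spanning set is chosen for the coproduct: y^n / n! goes to the sum of y^i / i!
  tensor y^(n-i) / (n-i)!, so on divided powers of a fixed y a linear map is a sequence and
  convolution is the Cauchy product. Coassociativity and cocommutativity turn into reindexing of
  finite sums, and the Eulerian series into the power series of ln and exp. The obstacle is that
  \<open>eulerian_lie\<close> and \<open>uea_A_lie\<close> are preimages under
  \<open>uea_embed\<close>: without injectivity nothing would make them linear. Only injectivity is
  required, not a PBW basis. An injective derivation gives it through a small module, but a general
  \<gg> has none; s \<gg>[s] has one because it is graded in positive degrees. The facts about pr
  and A are therefore proved under an injectivity assumption and used twice, for s \<gg>[s] and for
  \<gg>. That A takes values in the Lie algebra also comes from its differential equation, read as a
  recursion for the coefficients of t whose right-hand side stays in the Lie algebra.\<close>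

lemma uea_induct [case_names one add scale mult]:
  fixes u :: "'g::complex_lie_algebra uea"
  assumes "P 1" "\<And>u v. P u \<Longrightarrow> P v \<Longrightarrow> P (u + v)" "\<And>c u. P u \<Longrightarrow> P (c *\<^sub>C u)"
    and "\<And>g u. P u \<Longrightarrow> P (uea_embed g * u)"
  shows "P u"
proof -
  have zero: "P 0" using assms(3)[OF assms(1), of 0] by simp
  have word: "P (abs_uea (Poly_Mapping.single (FWord xs) 1))" for xs :: "'g list"
  proof (induction xs)
    case Nil
    have "Poly_Mapping.single (FWord ([] :: 'g list)) (1::complex) = 1"
      by (simp flip: single_one add: zero_free_word_def)
    then show ?case using assms(1) by (simp add: one_uea.abs_eq)
  next
    case (Cons x xs)
    have "abs_uea (Poly_Mapping.single (FWord (x # xs)) 1) =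
        uea_embed x * abs_uea (Poly_Mapping.single (FWord xs) 1)"
      by (simp add: uea_embed.abs_eq times_uea.abs_eq free_gen_def mult_single plus_free_word_def)
    then show ?case using assms(4)[OF Cons] by simp
  qed
  have "P (abs_uea p)" for p
  proof (induction p rule: poly_mapping_single_induct)
    case 1
    show ?case using zero unfolding zero_uea.abs_eq .
  next
    case (2 p q)
    from assms(2)[OF this] show ?case by (simp only: plus_uea.abs_eq)
  next
    case (3 x c)
    have "abs_uea (Poly_Mapping.single x c) = c *\<^sub>C abs_uea (Poly_Mapping.single (FWord (letters x)) 1)"
      by (simp add: scaleC_uea.abs_eq scaleC_single)
    then show ?case using assms(3)[OF word] by metis
  qed
  from this[of "rep_uea u"] show ?thesis by (simp only: uea_abs_rep)
qed

text \<open>Polarisation: one homogeneous part is picked out of an expression known to lie in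
  \<open>W\<close> for every s. Replacing s by 2 s and subtracting 2^(N+1) times the original
  cancels the top coefficient and multiplies the others by nonzero scalars, which stands in for a
  Vandermonde determinant.\<close>

lemma subspace_coefficients:
  assumes W: "complex_vector.subspace W" and mem: "\<And>s. (\<Sum>k\<le>N. s ^ k *\<^sub>C v k) \<in> W" and "k \<le> N"
  shows "v k \<in> W"
  using mem \<open>k \<le> N\<close>
proof (induction N arbitrary: v k)
  case 0
  from "0.prems"(1)[of 1] "0.prems"(2) show ?case by (simp add: scaleC_one)
next
  case (Suc N)
  have low: "v j \<in> W" if "j \<le> N" for j
  proof -
    let ?w = "\<lambda>k. (2 ^ k - 2 ^ Suc N :: complex) *\<^sub>C v k"
    have "(\<Sum>k\<le>N. s ^ k *\<^sub>C ?w k) \<in> W" for s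
    proof -
      have "(\<Sum>k\<le>Suc N. (2 * s) ^ k *\<^sub>C v k) - 2 ^ Suc N *\<^sub>C (\<Sum>k\<le>Suc N. s ^ k *\<^sub>C v k) \<in> W"
        using Suc.prems(1) W by (blast intro: complex_vector.subspace_diff complex_vector.subspace_scale)
      also have "(\<Sum>k\<le>Suc N. (2 * s) ^ k *\<^sub>C v k) - 2 ^ Suc N *\<^sub>C (\<Sum>k\<le>Suc N. s ^ k *\<^sub>C v k)
          = (\<Sum>k\<le>Suc N. s ^ k *\<^sub>C ?w k)"
        unfolding complex_vector.scale_sum_right sum_subtractf[symmetric]
        by (intro sum.cong refl)
          (simp add: complex_vector.scale_left_diff_distrib complex_vector.scale_right_diff_distrib power_mult_distrib mult_ac)
      also have "\<dots> = (\<Sum>k\<le>N. s ^ k *\<^sub>C ?w k)" by simp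
      finally show ?thesis .
    qed
    from Suc.IH[OF this that] have "?w j \<in> W" .
    from complex_vector.subspace_scale[OF W this, of "1 / (2 ^ j - 2 ^ Suc N)"]
    have "((2 ^ j - 2 ^ Suc N) / (2 ^ j - 2 ^ Suc N) :: complex) *\<^sub>C v j \<in> W"
      by (simp only: scaleC_scaleC times_divide_eq_left mult_1_left)
    moreover have "(2 ^ j - 2 ^ Suc N :: complex) \<noteq> 0"
    proof
      assume "(2 ^ j - 2 ^ Suc N :: complex) = 0"
      then have "(2::complex) ^ j = 2 ^ Suc N" by simp
      then have "of_nat (2 ^ j) = (of_nat (2 ^ Suc N) :: complex)" by simp
      then have "(2::nat) ^ j = 2 ^ Suc N" by (simp only: of_nat_eq_iff)
      then have "j = Suc N" by (metis power_inject_exp one_less_numeral_iff semiring_norm(76))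
      with that show False by simp
    qed
    ultimately show ?thesis by (simp add: scaleC_one)
  qed
  show ?case
  proof (cases "k \<le> N")
    case False
    then have k: "k = Suc N" using Suc.prems by simp
    have "(\<Sum>k\<le>N. v k) + v (Suc N) \<in> W"
      using Suc.prems(1)[of 1] by (simp add: scaleC_one)
    moreover have "(\<Sum>k\<le>N. v k) \<in> W"
      using low by (intro complex_vector.subspace_sum[OF W]) simp
    ultimately have "(\<Sum>k\<le>N. v k) + v (Suc N) - (\<Sum>k\<le>N. v k) \<in> W"
      by (rule complex_vector.subspace_diff[OF W])
    then show ?thesis using k by simp
  qed (rule low)
qed

text \<open>Only the coefficients of 1 and of s matter; the latter collects all words of length n
  with a single x among letters y. The index runs to \<open>Suc n\<close>, one more than the degree,
  so that index 1 exists also for n = 0.\<close>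

lemma power_expansion:
  fixes x y :: "'a::complex_algebra"
  shows "\<exists>v. (\<forall>s. (y + s *\<^sub>C x) ^ n = (\<Sum>k\<le>Suc n. s ^ k *\<^sub>C v k)) \<and> v 0 = y ^ n \<and>
    v 1 = (\<Sum>i<n. y ^ i * x * y ^ (n - Suc i))"
proof (induction n)
  case 0
  show ?case by (rule exI[of _ "\<lambda>k. if k = 0 then 1 else 0"]) (simp add: scaleC_one)
next
  case (Suc n)
  then obtain v where v: "\<And>s. (y + s *\<^sub>C x) ^ n = (\<Sum>k\<le>Suc n. s ^ k *\<^sub>C v k)" "v 0 = y ^ n"
    "v 1 = (\<Sum>i<n. y ^ i * x * y ^ (n - Suc i))" by blast
  \<comment> \<open>\<open>v\<close> is unconstrained beyond \<open>Suc n\<close>, so the first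
    summand is cut off there.\<close>
  define w where "w k = (if k \<le> Suc n then y * v k else 0) + (if k = 0 then 0 else x * v (k - 1))" for k
  have "(y + s *\<^sub>C x) ^ Suc n = (\<Sum>k\<le>Suc (Suc n). s ^ k *\<^sub>C w k)" for s
  proof -
    have "(y + s *\<^sub>C x) ^ Suc n = (\<Sum>k\<le>Suc n. s ^ k *\<^sub>C (y * v k)) + (\<Sum>k\<le>Suc n. s ^ Suc k *\<^sub>C (x * v k))"
      unfolding power_Suc v(1)
      by (simp add: distrib_right sum_distrib_left mult_scaleC_left mult_scaleC_right scaleC_scaleC
          scaleC_add_right sum.distrib mult_ac del: sum.atMost_Suc)
    also have "(\<Sum>k\<le>Suc n. s ^ k *\<^sub>C (y * v k)) =
        (\<Sum>k\<le>Suc (Suc n). s ^ k *\<^sub>C (if k \<le> Suc n then y * v k else 0))"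
      by simp
    also have "(\<Sum>k\<le>Suc n. s ^ Suc k *\<^sub>C (x * v k)) =
        (\<Sum>k\<le>Suc (Suc n). s ^ k *\<^sub>C (if k = 0 then 0 else x * v (k - 1)))"
      by (subst (2) sum.atMost_Suc_shift) simp
    finally show ?thesis by (simp only: w_def scaleC_add_right sum.distrib)
  qed
  moreover have "w 1 = (\<Sum>i<Suc n. y ^ i * x * y ^ (Suc n - Suc i))"
    using v(2,3) unfolding sum.lessThan_Suc_shift
    by (simp add: w_def sum_distrib_left mult.assoc add.commute)
  ultimately show ?case
    using v(2) by (intro exI[of _ w]) (simp add: w_def)
qed

text \<open>It suffices that the span is closed under left multiplication by Lie algebra elements,
  that is, contains x y^n. Modulo words with fewer letters the position of x among the y is
  irrelevant, and the sum over all positions is the linear coefficient of (y + s x)^(n+1).\<close>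

lemma uea_span_powers:
  "complex_vector.span (range (\<lambda>(y, n). uea_embed y ^ n)) = (UNIV :: 'g::complex_lie_algebra uea set)"
    (is "?W = UNIV")
proof -
  have W: "complex_vector.subspace ?W" by (rule complex_vector.subspace_span)
  have pow: "uea_embed y ^ n \<in> ?W" for y :: 'g and n
    by (rule complex_vector.span_base) force
  \<comment> \<open>Induction on the number n of letters y, for all x at once: exchanging x with a
    neighbouring y costs a word with \<open>bracket y x\<close> in place of x and one y
    fewer.\<close>
  have mid: "uea_embed y ^ i * uea_embed x * uea_embed y ^ (n - i) \<in> ?W" if "i \<le> n" for x y :: 'g and i n
    using that
  proof (induction n arbitrary: i x rule: less_induct)
    case (less n)
    let ?m = "\<lambda>i. uea_embed y ^ i * uea_embed x * uea_embed y ^ (n - i)"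
    have step: "?m (Suc i) - ?m i \<in> ?W" if "i < n" for i
    proof -
      from that obtain j where j: "n = Suc (i + j)" using less_imp_Suc_add by blast
      have "?m (Suc i) - ?m i = uea_embed y ^ i * uea_embed (bracket y x) * uea_embed y ^ (n - 1 - i)"
        using power_commutes[of "uea_embed y" i]
        by (simp add: j uea_embed_bracket left_diff_distrib right_diff_distrib flip: mult.assoc)
      moreover have "\<dots> \<in> ?W" using that by (intro less.IH) auto
      ultimately show ?thesis by simp
    qed
    have rel: "?m i - ?m 0 \<in> ?W" if "i \<le> n" for i
      using that
    proof (induction i)
      case 0
      show ?case using complex_vector.subspace_0[OF W] by simp
    next
      case (Suc i)
      from complex_vector.subspace_add[OF W step[of i] Suc.IH] Suc.prems
      show ?case by simp
    qed
    have sumW: "(\<Sum>i\<le>n. ?m i) \<in> ?W"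
    proof -
      obtain v where v: "\<And>s. (uea_embed y + s *\<^sub>C uea_embed x) ^ Suc n = (\<Sum>k\<le>Suc (Suc n). s ^ k *\<^sub>C v k)"
        "v 1 = (\<Sum>i<Suc n. uea_embed y ^ i * uea_embed x * uea_embed y ^ (Suc n - Suc i))"
        using power_expansion[of "uea_embed y" "uea_embed x" "Suc n"] by blast
      have "(\<Sum>k\<le>Suc (Suc n). s ^ k *\<^sub>C v k) \<in> ?W" for s
        using pow[of "y + s *\<^sub>C x" "Suc n"]
        by (simp only: v(1)[symmetric] clinear_add[OF clinear_uea_embed] clinear_scaleC[OF clinear_uea_embed])
      from subspace_coefficients[OF W this, of 1] show ?thesis
        unfolding v(2) by (simp add: lessThan_Suc_atMost)
    qed
    \<comment> \<open>Subtracting these differences from \<open>sumW\<close> leaves n + 1 copies of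
      the word with x in front; characteristic zero lets one divide.\<close>
    have "(\<Sum>i\<le>n. ?m i - ?m 0) \<in> ?W"
      using rel by (intro complex_vector.subspace_sum[OF W]) simp
    from complex_vector.subspace_diff[OF W sumW this]
    have "(\<Sum>i\<le>n. ?m 0) \<in> ?W" by (simp add: sum_subtractf)
    then have "of_nat (Suc n) *\<^sub>C ?m 0 \<in> ?W" by (simp add: complex_vector.sum_constant_scale del: of_nat_Suc)
    from complex_vector.subspace_scale[OF W this, of "1 / of_nat (Suc n)"]
    have "?m 0 \<in> ?W" by (simp add: scaleC_scaleC scaleC_one del: of_nat_Suc)
    from complex_vector.subspace_add[OF W rel[OF less.prems] this] show ?case by simp
  qed
  have left_mult: "uea_embed x * u \<in> ?W" if "u \<in> ?W" for x u
    using that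
  proof (induction u rule: complex_vector.span_induct_alt)
    case base
    show ?case using complex_vector.subspace_0[OF W] by simp
  next
    case (step c u v)
    from step(1) obtain y n where u: "u = uea_embed y ^ n" by auto
    have "uea_embed x * u \<in> ?W" using mid[of 0 n y x] u by simp
    from complex_vector.subspace_add[OF W complex_vector.subspace_scale[OF W this] step(2)]
    show ?case by (simp add: distrib_left mult_scaleC_right)
  qed
  have "u \<in> ?W" for u
  proof (induction u rule: uea_induct)
    case one
    show ?case using pow[of 0 0] by simp
  next
    case (add u v)
    then show ?case by (rule complex_vector.subspace_add[OF W])
  next
    case (scale c u)
    then show ?case by (rule complex_vector.subspace_scale[OF W])
  next
    case (mult g u)
    then show ?case by (rule left_mult)
  qed
  then show ?thesis by blast
qed

text \<open>The factorials are absorbed here so that the coproduct has no binomial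
  coefficients.\<close>

definition divided_power :: "'g::complex_lie_algebra \<Rightarrow> nat \<Rightarrow> 'g uea"
  where "divided_power y n = (1 / fact n) *\<^sub>C uea_embed y ^ n"

lemma divided_power_0 [simp]: "divided_power y 0 = 1"
  by (simp add: divided_power_def scaleC_one)

lemma power_eq_divided_power: "uea_embed y ^ n = fact n *\<^sub>C divided_power y n"
  by (simp add: divided_power_def scaleC_scaleC scaleC_one)

lemma embed_mult_divided_power: "uea_embed y * divided_power y n = of_nat (Suc n) *\<^sub>C divided_power y (Suc n)"
  by (simp add: divided_power_def mult_scaleC_right scaleC_scaleC field_simps del: of_nat_Suc)

lemma divided_power_induct [case_names zero add scale power]:
  fixes u :: "'g::complex_lie_algebra uea"
  assumes "P 0" "\<And>u v. P u \<Longrightarrow> P v \<Longrightarrow> P (u + v)" "\<And>c u. P u \<Longrightarrow> P (c *\<^sub>C u)"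
    and "\<And>y n. P (divided_power y n)"
  shows "P u"
proof -
  have "u \<in> complex_vector.span (range (\<lambda>(y, n). uea_embed y ^ n))"
    by (simp add: uea_span_powers)
  then show ?thesis
    by (induction rule: complex_vector.span_induct_alt)
      (auto simp: power_eq_divided_power intro!: assms)
qed

lemma clinear_eq_on_divided_powers:
  assumes "clinear F" "clinear G" "\<And>y n. F (divided_power y n) = G (divided_power y n)"
  shows "F u = G u"
  by (induction u rule: divided_power_induct)
    (simp_all add: assms clinear_zero clinear_add clinear_scaleC)

section \<open>Convolution\<close>

lemma cbilinearI:
  assumes "\<And>a a' b. m (a + a') b = m a b + m a' b" "\<And>a b b'. m a (b + b') = m a b + m a b'"
    "\<And>c a b. m (c *\<^sub>C a) b = c *\<^sub>C m a b" "\<And>c a b. m a (c *\<^sub>C b) = c *\<^sub>C m a b"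
  shows "cbilinear m"
  using assms by (simp add: cbilinear_def clinear_iff)

lemma cbilinearD:
  assumes "cbilinear m"
  shows "m (a + a') b = m a b + m a' b" "m a (b + b') = m a b + m a b'"
    "m (c *\<^sub>C a) b = c *\<^sub>C m a b" "m a (c *\<^sub>C b) = c *\<^sub>C m a b"
    "m 0 b = 0" "m a 0 = 0"
proof -
  have *: "clinear (\<lambda>a. m a b)" "clinear (m a)" for a b using assms by (simp_all add: cbilinear_def)
  show "m (a + a') b = m a b + m a' b" "m a (b + b') = m a b + m a b'"
    "m (c *\<^sub>C a) b = c *\<^sub>C m a b" "m a (c *\<^sub>C b) = c *\<^sub>C m a b" "m 0 b = 0" "m a 0 = 0"
    using clinear_add[OF *(1)] clinear_add[OF *(2)] clinear_scaleC[OF *(1)] clinear_scaleC[OF *(2)]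
      clinear_zero[OF *(1)] clinear_zero[OF *(2)] by simp_all
qed

lemma cbilinear_compose:
  assumes "cbilinear m" "clinear F" "clinear G"
  shows "cbilinear (\<lambda>a b. m (F a) (G b))"
  by (rule cbilinearI)
    (simp_all add: cbilinearD[OF assms(1)] clinear_add[OF assms(2)] clinear_add[OF assms(3)]
      clinear_scaleC[OF assms(2)] clinear_scaleC[OF assms(3)])

lemma clinear_compose_cbilinear:
  assumes "cbilinear m" "clinear h"
  shows "cbilinear (\<lambda>a b. h (m a b))"
  by (rule cbilinearI)
    (simp_all add: cbilinearD[OF assms(1)] clinear_add[OF assms(2)] clinear_scaleC[OF assms(2)])

lemma clinear_compose: "clinear F \<Longrightarrow> clinear G \<Longrightarrow> clinear (\<lambda>x. F (G x))"
  by (simp add: clinear_iff)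

lemma clinear_ident: "clinear (\<lambda>x. x)"
  by (simp add: clinear_iff)

lemma clinear_mult_right: "clinear (\<lambda>x. x * (a::'a::complex_algebra))"
  by (simp add: clinear_iff distrib_right mult_scaleC_left)

lemma cbilinear_mult: "cbilinear ((*) :: 'a::complex_algebra \<Rightarrow> _)"
  by (rule cbilinearI) (simp_all add: distrib_left distrib_right mult_scaleC_left mult_scaleC_right)

lemma cbilinear_bracket: "cbilinear (bracket :: 'a::complex_lie_algebra \<Rightarrow> _)"
  by (rule cbilinearI)
    (simp_all add: bracket_add_left bracket_add_right bracket_scaleC_left bracket_scaleC_right)

lemma cbilinear_tensor_pure: "cbilinear (\<otimes>)"
  by (rule cbilinearI)
    (simp_all add: tensor_pure_add_left tensor_pure_add_right tensor_pure_scaleC_left tensor_pure_scaleC_right)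

lemma tensor_lift_cong_linear:
  assumes "cbilinear m" "clinear h"
  shows "h (tensor_lift m T) = tensor_lift (\<lambda>a b. h (m a b)) T"
proof -
  note b = clinear_compose_cbilinear[OF assms]
  note lin = clinear_tensor_lift[OF assms(1)] clinear_tensor_lift[OF b]
  show ?thesis
    by (induction T rule: tensor_induct)
      (simp_all add: tensor_lift_pure[OF assms(1)] tensor_lift_pure[OF b] clinear_zero[OF assms(2)]
        clinear_add[OF assms(2)] clinear_zero[OF lin(1)] clinear_add[OF lin(1)]
        clinear_zero[OF lin(2)] clinear_add[OF lin(2)])
qed

text \<open>The generating series exp (z y) is group-like. Since y times the n-th term is n + 1
  times the next one, a summand with exponents i and n + 1 - i receives weight i from one leg and n
  + 1 - i from the other.\<close>

lemma coproduct_divided_power: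
  "uea_coproduct (divided_power y n) = (\<Sum>i\<le>n. divided_power y i \<otimes> divided_power y (n - i))"
proof (induction n)
  case 0
  show ?case by (simp add: uea_coproduct_one one_tensor_def)
next
  case (Suc n)
  let ?d = "divided_power y"
  have "of_nat (Suc n) *\<^sub>C uea_coproduct (?d (Suc n)) = uea_coproduct (uea_embed y * ?d n)"
    by (simp only: embed_mult_divided_power clinear_scaleC[OF clinear_uea_coproduct])
  also have "\<dots> = (uea_embed y \<otimes> 1 + 1 \<otimes> uea_embed y) * (\<Sum>i\<le>n. ?d i \<otimes> ?d (n - i))"
    by (simp only: uea_coproduct_mult uea_coproduct_embed Suc)
  also have "\<dots> = (\<Sum>i\<le>n. of_nat (Suc i) *\<^sub>C (?d (Suc i) \<otimes> ?d (n - i)))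
      + (\<Sum>i\<le>n. of_nat (Suc (n - i)) *\<^sub>C (?d i \<otimes> ?d (Suc (n - i))))"
    by (simp only: distrib_right sum_distrib_left tensor_pure_mult mult_1_left embed_mult_divided_power
        tensor_pure_scaleC_left tensor_pure_scaleC_right sum.distrib)
  also have "(\<Sum>i\<le>n. of_nat (Suc i) *\<^sub>C (?d (Suc i) \<otimes> ?d (n - i))) =
      (\<Sum>i\<le>Suc n. of_nat i *\<^sub>C (?d i \<otimes> ?d (Suc n - i)))"
    by (subst sum.atMost_Suc_shift) simp
  also have "(\<Sum>i\<le>n. of_nat (Suc (n - i)) *\<^sub>C (?d i \<otimes> ?d (Suc (n - i)))) =
      (\<Sum>i\<le>Suc n. of_nat (Suc n - i) *\<^sub>C (?d i \<otimes> ?d (Suc n - i)))"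
    by (auto intro!: sum.cong simp: Suc_diff_le simp del: of_nat_Suc of_nat_diff)
  also have "(\<Sum>i\<le>Suc n. of_nat i *\<^sub>C (?d i \<otimes> ?d (Suc n - i))) +
      (\<Sum>i\<le>Suc n. of_nat (Suc n - i) *\<^sub>C (?d i \<otimes> ?d (Suc n - i))) =
      (\<Sum>i\<le>Suc n. of_nat (Suc n) *\<^sub>C (?d i \<otimes> ?d (Suc n - i)))"
    unfolding sum.distrib[symmetric] scaleC_add_left[symmetric] of_nat_add[symmetric]
    by (intro sum.cong) simp_all
  also have "\<dots> = of_nat (Suc n) *\<^sub>C (\<Sum>i\<le>Suc n. ?d i \<otimes> ?d (Suc n - i))"
    by (simp only: complex_vector.scale_sum_right)
  finally show ?case
    by (simp only: complex_vector.scale_cancel_left of_nat_eq_0_iff nat.distinct simp_thms)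
qed

definition sweedler ::
    "('g::complex_lie_algebra uea \<Rightarrow> 'g uea \<Rightarrow> 'a::complex_vector) \<Rightarrow> 'g uea \<Rightarrow> 'a"
  where "sweedler m x = tensor_lift m (uea_coproduct x)"

lemma clinear_sweedler: "cbilinear m \<Longrightarrow> clinear (sweedler m)"
  using clinear_compose[OF clinear_tensor_lift clinear_uea_coproduct, of m]
  by (simp add: sweedler_def [abs_def])

lemma sweedler_divided_power:
  "cbilinear m \<Longrightarrow> sweedler m (divided_power y n) = (\<Sum>i\<le>n. m (divided_power y i) (divided_power y (n - i)))"
  by (simp add: sweedler_def coproduct_divided_power clinear_sum[OF clinear_tensor_lift] tensor_lift_pure)

lemma sweedler_linear:
  "cbilinear m \<Longrightarrow> clinear h \<Longrightarrow> h (sweedler m x) = sweedler (\<lambda>a b. h (m a b)) x"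
  unfolding sweedler_def by (rule tensor_lift_cong_linear)

lemma sweedler_add:
  assumes "cbilinear m" "cbilinear m'"
  shows "sweedler (\<lambda>a b. m a b + m' a b) x = sweedler m x + sweedler m' x"
proof (rule clinear_eq_on_divided_powers[where u = x])
  have *: "cbilinear (\<lambda>a b. m a b + m' a b)"
    by (rule cbilinearI) (simp_all add: cbilinearD[OF assms(1)] cbilinearD[OF assms(2)] scaleC_add_right)
  show "clinear (sweedler (\<lambda>a b. m a b + m' a b))" by (rule clinear_sweedler[OF *])
  show "clinear (\<lambda>x. sweedler m x + sweedler m' x)"
    using clinear_sweedler[OF assms(1)] clinear_sweedler[OF assms(2)]
    by (simp add: clinear_iff scaleC_add_right)
  show "sweedler (\<lambda>a b. m a b + m' a b) (divided_power y n) =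
      sweedler m (divided_power y n) + sweedler m' (divided_power y n)" for y n
    by (simp add: sweedler_divided_power * assms sum.distrib)
qed

text \<open>Elements of \<gg> are primitive, so right multiplication by g is a coderivation; the
  Leibniz rules for \<open>right_translate\<close> come from here.\<close>

lemma sweedler_mult_embed:
  assumes "cbilinear m"
  shows "sweedler m (x * uea_embed g) = sweedler (\<lambda>a b. m (a * uea_embed g) b) x
    + sweedler (\<lambda>a b. m a (b * uea_embed g)) x"
proof -
  have b: "cbilinear (\<lambda>a b. m (a * uea_embed g) b)" "cbilinear (\<lambda>a b. m a (b * uea_embed g))"
    using assms by (auto intro: cbilinear_compose clinear_ident clinear_mult_right)
  note l = clinear_tensor_lift[OF assms] clinear_tensor_lift[OF b(1)] clinear_tensor_lift[OF b(2)]
  note l = l[THEN clinear_zero] l[THEN clinear_add]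
  have "tensor_lift m (T * (uea_embed g \<otimes> 1 + 1 \<otimes> uea_embed g)) =
      tensor_lift (\<lambda>a b. m (a * uea_embed g) b) T + tensor_lift (\<lambda>a b. m a (b * uea_embed g)) T" for T
  proof (induction T rule: tensor_induct)
    case zero
    show ?case by (simp add: l)
  next
    case (add S T)
    then show ?case by (simp add: l distrib_right add_ac)
  next
    case (pure a b)
    show ?case
      by (simp add: distrib_left tensor_pure_mult tensor_lift_pure[OF assms] tensor_lift_pure[OF b(1)]
          tensor_lift_pure[OF b(2)] l)
  qed
  then show ?thesis
    by (simp add: sweedler_def uea_coproduct_mult uea_coproduct_embed)
qed

lemma counit_divided_power: "uea_counit (divided_power y n) = (if n = 0 then 1 else 0)"
proof -
  have "uea_counit (uea_embed y ^ n) = 0 ^ n"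
    by (induction n) (simp_all add: uea_counit_one uea_counit_mult uea_counit_embed)
  then show ?thesis
    by (simp add: divided_power_def clinear_scaleC[OF clinear_uea_counit] scaleC_complex_def)
qed

section \<open>Linear maps out of the enveloping algebra under convolution\<close>

typedef (overloaded) ('g, 'a) uea_map = "{F :: 'g::complex_lie_algebra uea \<Rightarrow> 'a::complex_vector. clinear F}"
  morphisms map_apply Abs_uea_map
  by (rule exI[of _ "\<lambda>_. 0"]) (simp add: clinear_iff)

setup_lifting type_definition_uea_map

lemma clinear_map_apply: "clinear (map_apply F)"
  using map_apply[of F] by simp

lemma map_apply_Abs: "clinear F \<Longrightarrow> map_apply (Abs_uea_map F) = F"
  by (simp add: Abs_uea_map_inverse)

lemma uea_map_eqI:
  "(\<And>y n. map_apply F (divided_power y n) = map_apply G (divided_power y n)) \<Longrightarrow> F = G"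
  by (subst map_apply_inject[symmetric], rule ext,
      rule clinear_eq_on_divided_powers[OF clinear_map_apply clinear_map_apply])

instantiation uea_map :: (complex_lie_algebra, complex_vector) complex_vector
begin
lift_definition zero_uea_map :: "('a, 'b) uea_map" is "\<lambda>_. 0" by (simp add: clinear_iff)
lift_definition plus_uea_map :: "('a, 'b) uea_map \<Rightarrow> ('a, 'b) uea_map \<Rightarrow> ('a, 'b) uea_map" is "\<lambda>F G x. F x + G x"
  by (simp add: clinear_iff scaleC_add_right)
lift_definition minus_uea_map :: "('a, 'b) uea_map \<Rightarrow> ('a, 'b) uea_map \<Rightarrow> ('a, 'b) uea_map" is "\<lambda>F G x. F x - G x"
  by (simp add: clinear_iff complex_vector.scale_right_diff_distrib)
lift_definition uminus_uea_map :: "('a, 'b) uea_map \<Rightarrow> ('a, 'b) uea_map" is "\<lambda>F x. - F x"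
  by (simp add: clinear_iff)
lift_definition scaleC_uea_map :: "complex \<Rightarrow> ('a, 'b) uea_map \<Rightarrow> ('a, 'b) uea_map" is "\<lambda>c F x. c *\<^sub>C F x"
  by (simp add: clinear_iff scaleC_add_right mult.commute)
instance
proof
  fix a b :: complex and u v w :: "('a, 'b) uea_map"
  show "u + v + w = u + (v + w)" "u + v = v + u" "0 + u = u" "- u + u = 0" "u - v = u + - v"
    by (transfer, simp add: add_ac)+
  show "a *\<^sub>C (u + v) = a *\<^sub>C u + a *\<^sub>C v" "(a + b) *\<^sub>C u = a *\<^sub>C u + b *\<^sub>C u"
    "a *\<^sub>C b *\<^sub>C u = (a * b) *\<^sub>C u" "1 *\<^sub>C u = u"
    by (transfer, simp add: scaleC_add_right scaleC_add_left)+
qed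
end

lemmas map_apply_simps = zero_uea_map.rep_eq plus_uea_map.rep_eq minus_uea_map.rep_eq
  uminus_uea_map.rep_eq scaleC_uea_map.rep_eq

text \<open>Parametrised by the pairing: multiplication yields the convolution algebra, the bracket
  a Lie algebra of Lie-algebra-valued maps.\<close>

definition convolve ::
    "('a::complex_vector \<Rightarrow> 'b::complex_vector \<Rightarrow> 'c::complex_vector)
      \<Rightarrow> ('g::complex_lie_algebra, 'a) uea_map \<Rightarrow> ('g, 'b) uea_map \<Rightarrow> ('g, 'c) uea_map"
  where "convolve m F G = Abs_uea_map (sweedler (\<lambda>a b. m (map_apply F a) (map_apply G b)))"

lemma cbilinear_map_apply: "cbilinear m \<Longrightarrow> cbilinear (\<lambda>a b. m (map_apply F a) (map_apply G b))"
  by (rule cbilinear_compose[OF _ clinear_map_apply clinear_map_apply])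

lemma map_apply_convolve:
  "cbilinear m \<Longrightarrow> map_apply (convolve m F G) x = sweedler (\<lambda>a b. m (map_apply F a) (map_apply G b)) x"
  unfolding convolve_def
  by (subst map_apply_Abs) (auto intro!: clinear_sweedler cbilinear_map_apply)

lemma convolve_divided_power:
  "cbilinear m \<Longrightarrow> map_apply (convolve m F G) (divided_power y n) =
    (\<Sum>i\<le>n. m (map_apply F (divided_power y i)) (map_apply G (divided_power y (n - i))))"
  by (simp add: map_apply_convolve sweedler_divided_power cbilinear_map_apply)

text \<open>Both sides run over the triples with total n, in rotated order. Such reindexings take
  the place of coassociativity and cocommutativity.\<close>

lemma sum_sum_rotate:
  fixes h :: "nat \<Rightarrow> nat \<Rightarrow> nat \<Rightarrow> 'a::comm_monoid_add"
  shows "(\<Sum>i\<le>n. \<Sum>j\<le>n - i. h i j (n - i - j)) = (\<Sum>i\<le>n. \<Sum>j\<le>n - i. h j (n - i - j) i)"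
  unfolding sum.Sigma[OF finite_atMost ballI[OF finite_atMost]]
  by (rule sum.reindex_bij_witness[of _ "\<lambda>(i, j). (j, n - i - j)" "\<lambda>(i, j). (n - i - j, i)"])
    (auto split: prod.splits)

lemma sum_sum_swap:
  fixes h :: "nat \<Rightarrow> nat \<Rightarrow> nat \<Rightarrow> 'a::comm_monoid_add"
  shows "(\<Sum>i\<le>n. \<Sum>j\<le>n - i. h i j (n - i - j)) = (\<Sum>i\<le>n. \<Sum>j\<le>n - i. h j i (n - i - j))"
  unfolding sum.Sigma[OF finite_atMost ballI[OF finite_atMost]]
  by (rule sum.reindex_bij_witness[of _ "\<lambda>(i, j). (j, i)" "\<lambda>(i, j). (j, i)"])
    (auto split: prod.splits simp: add.commute)

lemma sum_sum_assoc:
  fixes h :: "nat \<Rightarrow> nat \<Rightarrow> nat \<Rightarrow> 'a::comm_monoid_add"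
  shows "(\<Sum>i\<le>n. \<Sum>j\<le>i. h j (i - j) (n - i)) = (\<Sum>i\<le>n. \<Sum>j\<le>n - i. h i j (n - i - j))"
  unfolding sum.Sigma[OF finite_atMost ballI[OF finite_atMost]]
  by (rule sum.reindex_bij_witness[of _ "\<lambda>(i, j). (i + j, i)" "\<lambda>(i, j). (j, i - j)"])
    (auto split: prod.splits)

instantiation uea_map :: (complex_lie_algebra, complex_algebra) complex_algebra
begin
definition times_uea_map :: "('a, 'b) uea_map \<Rightarrow> ('a, 'b) uea_map \<Rightarrow> ('a, 'b) uea_map"
  where "times_uea_map = convolve (*)"
lift_definition one_uea_map :: "('a, 'b) uea_map" is "\<lambda>x. uea_counit x *\<^sub>C 1"
  by (rule clinearI) (simp_all add: clinear_add[OF clinear_uea_counit] clinear_scaleC[OF clinear_uea_counit]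
      scaleC_add_left scaleC_scaleC scaleC_complex_def)
instance
proof
  note simps = times_uea_map_def convolve_divided_power[OF cbilinear_mult] map_apply_simps
    one_uea_map.rep_eq counit_divided_power
  fix F G H :: "('a, 'b) uea_map" and c :: complex
  show "F * G * H = F * (G * H)"
  proof (rule uea_map_eqI)
    fix y :: 'a and n
    let ?a = "\<lambda>F i. map_apply F (divided_power y i)"
    show "?a (F * G * H) n = ?a (F * (G * H)) n"
      using sum_sum_assoc[of "\<lambda>i j k. ?a F i * (?a G j * ?a H k)" n]
      by (simp add: simps sum_distrib_left sum_distrib_right mult.assoc)
  qed
  show "(F + G) * H = F * H + G * H" "F * (G + H) = F * G + F * H" "c *\<^sub>C F * G = c *\<^sub>C (F * G)"
    "F * c *\<^sub>C G = c *\<^sub>C (F * G)"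
    by (rule uea_map_eqI, simp add: simps distrib_left distrib_right sum.distrib mult_scaleC_left
        mult_scaleC_right complex_vector.scale_sum_right)+
  show "1 * F = F"
  proof (rule uea_map_eqI)
    fix y :: 'a and n
    have "map_apply (1 * F) (divided_power y n) =
        (\<Sum>i\<le>n. if i = 0 then map_apply F (divided_power y (n - i)) else 0)"
      unfolding simps by (rule sum.cong) (auto simp: mult_scaleC_left scaleC_one)
    then show "map_apply (1 * F) (divided_power y n) = map_apply F (divided_power y n)" by simp
  qed
  show "F * 1 = F"
  proof (rule uea_map_eqI)
    fix y :: 'a and n
    have "map_apply (F * 1) (divided_power y n) =
        (\<Sum>i\<le>n. if i = n then map_apply F (divided_power y i) else 0)"
      unfolding simps by (rule sum.cong) (auto simp: mult_scaleC_right scaleC_one)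
    then show "map_apply (F * 1) (divided_power y n) = map_apply F (divided_power y n)" by simp
  qed
qed
end

lemma bracket_anticommute: "bracket x y = - bracket y x"
proof -
  have "bracket (x + y) (x + y) = bracket x y + bracket y x"
    unfolding bracket_add_left bracket_add_right by (simp add: bracket_self)
  then show ?thesis by (simp add: bracket_self eq_neg_iff_add_eq_0)
qed

lemma eq_minus_self_zero:
  fixes z :: "'a::complex_vector"
  assumes "z = - z"
  shows "z = 0"
proof -
  from assms have "z + z = 0" by (simp add: eq_neg_iff_add_eq_0)
  then have "(2::complex) *\<^sub>C z = 0"
    using scaleC_add_left[of 1 1 z] by (simp add: scaleC_one)
  then show ?thesis by simp
qed

instantiation uea_map :: (complex_lie_algebra, complex_lie_algebra) complex_lie_algebra
begin
definition bracket_uea_map :: "('a, 'b) uea_map \<Rightarrow> ('a, 'b) uea_map \<Rightarrow> ('a, 'b) uea_map"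
  where "bracket_uea_map = convolve bracket"
instance
proof
  note simps = bracket_uea_map_def convolve_divided_power[OF cbilinear_bracket] map_apply_simps
  fix F G H :: "('a, 'b) uea_map" and c :: complex
  show "bracket (F + G) H = bracket F H + bracket G H"
    by (rule uea_map_eqI) (simp only: simps bracket_add_left sum.distrib)
  show "bracket F (G + H) = bracket F G + bracket F H"
    by (rule uea_map_eqI) (simp only: simps bracket_add_right sum.distrib)
  show "bracket (c *\<^sub>C F) G = c *\<^sub>C bracket F G"
    by (rule uea_map_eqI) (simp only: simps bracket_scaleC_left complex_vector.scale_sum_right)
  show "bracket F (c *\<^sub>C G) = c *\<^sub>C bracket F G"
    by (rule uea_map_eqI) (simp only: simps bracket_scaleC_right complex_vector.scale_sum_right)
  show "bracket F F = 0"
  proof (rule uea_map_eqI)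
    fix y :: 'a and n
    let ?a = "\<lambda>F i. map_apply F (divided_power y i)"
    \<comment> \<open>Reversing the summation is cocommutativity; it is what makes the convolution
      bracket alternating.\<close>
    have "(\<Sum>i\<le>n. bracket (?a F i) (?a F (n - i))) = (\<Sum>i\<le>n. bracket (?a F (n - i)) (?a F i))"
      by (rule sum.reindex_bij_witness[of _ "\<lambda>i. n - i" "\<lambda>i. n - i"]) auto
    also have "\<dots> = - (\<Sum>i\<le>n. bracket (?a F i) (?a F (n - i)))"
      unfolding sum_negf[symmetric] by (intro sum.cong refl bracket_anticommute)
    finally show "?a (bracket F F) n = ?a 0 n" by (auto dest: eq_minus_self_zero simp: simps)
  qed
  show "bracket F (bracket G H) + bracket G (bracket H F) + bracket H (bracket F G) = 0"
  proof (rule uea_map_eqI)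
    fix y :: 'a and n
    let ?a = "\<lambda>F i. map_apply F (divided_power y i)"
    have exp: "?a (bracket A (bracket B C)) n =
        (\<Sum>i\<le>n. \<Sum>j\<le>n - i. bracket (?a A i) (bracket (?a B j) (?a C (n - i - j))))" for A B C :: "('a, 'b) uea_map"
      by (simp add: simps clinear_sum[of "bracket _"] clinear_iff bracket_add_right bracket_scaleC_right)
    have 1: "?a (bracket G (bracket H F)) n =
        (\<Sum>i\<le>n. \<Sum>j\<le>n - i. bracket (?a G j) (bracket (?a H (n - i - j)) (?a F i)))"
      unfolding exp by (rule sum_sum_rotate)
    have 2: "?a (bracket H (bracket F G)) n =
        (\<Sum>i\<le>n. \<Sum>j\<le>n - i. bracket (?a H (n - i - j)) (bracket (?a F i) (?a G j)))"
      unfolding exp by (rule sum_sum_rotate[symmetric])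
    show "?a (bracket F (bracket G H) + bracket G (bracket H F) + bracket H (bracket F G)) n = ?a 0 n"
      by (simp only: map_apply_simps 1 2 exp[of F] sum.distrib[symmetric] jacobi) simp
  qed
qed
end

text \<open>For scalar values this is the formula of \<open>uea_dual_act\<close>; arbitrary targets
  allow pr, the family phi and A to be differentiated along g in the same way.\<close>

lift_definition right_translate ::
    "'g::complex_lie_algebra \<Rightarrow> ('g, 'a::complex_vector) uea_map \<Rightarrow> ('g, 'a) uea_map"
  is "\<lambda>g F x. F (x * uea_embed g)"
  by (simp add: clinear_iff distrib_right mult_scaleC_left)

lemma uea_map_ext: "(\<And>x. map_apply F x = map_apply G x) \<Longrightarrow> F = G"
  by (rule uea_map_eqI)

lemma right_translate_bracket:
  "right_translate (bracket g h) F =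
    right_translate g (right_translate h F) - right_translate h (right_translate g F)"
  by (rule uea_map_ext)
    (simp add: right_translate.rep_eq minus_uea_map.rep_eq uea_embed_bracket right_diff_distrib
      clinear_diff[OF clinear_map_apply] mult.assoc)

lemma right_translate_one: "right_translate g (1 :: ('g::complex_lie_algebra, 'a::complex_algebra) uea_map) = 0"
  by transfer (simp add: uea_counit_mult uea_counit_embed)

lemma right_translate_convolve:
  assumes "cbilinear m"
  shows "right_translate g (convolve m F G) =
    convolve m (right_translate g F) G + convolve m F (right_translate g G)"
  by (rule uea_map_ext)
    (simp add: right_translate.rep_eq map_apply_convolve assms map_apply_simps
      sweedler_mult_embed cbilinear_map_apply)

lemma right_translate_mult:
  "right_translate g (F * G) = right_translate g F * G + F * right_translate g G"
  unfolding times_uea_map_def by (rule right_translate_convolve[OF cbilinear_mult])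

definition post_compose ::
    "('a::complex_vector \<Rightarrow> 'b::complex_vector) \<Rightarrow> ('g::complex_lie_algebra, 'a) uea_map \<Rightarrow> ('g, 'b) uea_map"
  where "post_compose h F = Abs_uea_map (\<lambda>x. h (map_apply F x))"

lemma map_apply_post_compose: "clinear h \<Longrightarrow> map_apply (post_compose h F) x = h (map_apply F x)"
  unfolding post_compose_def by (subst map_apply_Abs) (auto intro: clinear_compose[OF _ clinear_map_apply])

section \<open>Trilinear convolution products\<close>

definition ctrilinear ::
    "('a::complex_vector \<Rightarrow> 'b::complex_vector \<Rightarrow> 'c::complex_vector \<Rightarrow> 'd::complex_vector) \<Rightarrow> bool"
  where "ctrilinear m \<longleftrightarrow> (\<forall>a. cbilinear (m a)) \<and> (\<forall>b c. clinear (\<lambda>a. m a b c))"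

lemma ctrilinearI:
  assumes "\<And>a a' b c. m (a + a') b c = m a b c + m a' b c" "\<And>k a b c. m (k *\<^sub>C a) b c = k *\<^sub>C m a b c"
    "\<And>a b b' c. m a (b + b') c = m a b c + m a b' c" "\<And>k a b c. m a (k *\<^sub>C b) c = k *\<^sub>C m a b c"
    "\<And>a b c c'. m a b (c + c') = m a b c + m a b c'" "\<And>k a b c. m a b (k *\<^sub>C c) = k *\<^sub>C m a b c"
  shows "ctrilinear m"
  using assms by (simp add: ctrilinear_def cbilinear_def clinear_iff)

lemma ctrilinearD:
  assumes "ctrilinear m"
  shows "m (a + a') b c = m a b c + m a' b c" "m (k *\<^sub>C a) b c = k *\<^sub>C m a b c"
    "m a (b + b') c = m a b c + m a b' c" "m a (k *\<^sub>C b) c = k *\<^sub>C m a b c"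
    "m a b (c + c') = m a b c + m a b c'" "m a b (k *\<^sub>C c) = k *\<^sub>C m a b c"
  using assms by (simp_all add: ctrilinear_def cbilinear_def clinear_iff)

lemma ctrilinear_clinear:
  assumes "ctrilinear m"
  shows "clinear (\<lambda>a. m a b c)" "clinear (\<lambda>b. m a b c)" "clinear (\<lambda>c. m a b c)"
  using assms by (simp_all add: ctrilinear_def cbilinear_def clinear_iff)

text \<open>Nested like the iterated coproduct in \<open>alpha_tilde_form\<close>, so that the
  cochain becomes an instance by unfolding.\<close>

definition convolve3 ::
    "('a::complex_vector \<Rightarrow> 'b::complex_vector \<Rightarrow> 'c::complex_vector \<Rightarrow> 'd::complex_vector)
      \<Rightarrow> ('g::complex_lie_algebra, 'a) uea_map \<Rightarrow> ('g, 'b) uea_map \<Rightarrow> ('g, 'c) uea_map \<Rightarrow> ('g, 'd) uea_map"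
  where "convolve3 m F G H = Abs_uea_map (sweedler (\<lambda>a y.
    sweedler (\<lambda>b c. m (map_apply F a) (map_apply G b) (map_apply H c)) y))"

lemma cbilinear_convolve3_inner:
  assumes "ctrilinear m"
  shows "cbilinear (\<lambda>b c. m a (map_apply G b) (map_apply H c))"
  using assms by (intro cbilinear_map_apply) (simp add: ctrilinear_def)

lemma cbilinear_convolve3:
  assumes "ctrilinear m"
  shows "cbilinear (\<lambda>a y. sweedler (\<lambda>b c. m (map_apply F a) (map_apply G b) (map_apply H c)) y)"
proof (rule cbilinearI)
  note bil = cbilinear_convolve3_inner[OF assms]
  fix a a' b b' and k
  note [simp] = clinear_add[OF clinear_map_apply] clinear_scaleC[OF clinear_map_apply]
  show "sweedler (\<lambda>b c. m (map_apply F (a + a')) (map_apply G b) (map_apply H c)) b =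
      sweedler (\<lambda>b c. m (map_apply F a) (map_apply G b) (map_apply H c)) b +
      sweedler (\<lambda>b c. m (map_apply F a') (map_apply G b) (map_apply H c)) b"
    by (simp add: ctrilinearD[OF assms] sweedler_add bil)
  have sc: "clinear (\<lambda>x. k *\<^sub>C x :: 'd)"
    by (simp add: clinear_iff scaleC_add_right mult.commute)
  show "sweedler (\<lambda>b c. m (map_apply F (k *\<^sub>C a)) (map_apply G b) (map_apply H c)) b =
      k *\<^sub>C sweedler (\<lambda>b c. m (map_apply F a) (map_apply G b) (map_apply H c)) b"
    by (simp add: ctrilinearD[OF assms] sweedler_linear[OF bil sc])
qed (simp_all add: clinear_add[OF clinear_sweedler[OF cbilinear_convolve3_inner[OF assms]]]
    clinear_scaleC[OF clinear_sweedler[OF cbilinear_convolve3_inner[OF assms]]])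

lemma map_apply_convolve3:
  assumes "ctrilinear m"
  shows "map_apply (convolve3 m F G H) x =
    sweedler (\<lambda>a y. sweedler (\<lambda>b c. m (map_apply F a) (map_apply G b) (map_apply H c)) y) x"
  unfolding convolve3_def
  by (subst map_apply_Abs[OF clinear_sweedler[OF cbilinear_convolve3[OF assms]]]) simp

lemma convolve3_divided_power:
  assumes "ctrilinear m"
  shows "map_apply (convolve3 m F G H) (divided_power y n) =
    (\<Sum>i\<le>n. \<Sum>j\<le>n - i. m (map_apply F (divided_power y i)) (map_apply G (divided_power y j))
      (map_apply H (divided_power y (n - i - j))))"
  by (simp add: map_apply_convolve3[OF assms] sweedler_divided_power[OF cbilinear_convolve3[OF assms]]
      sweedler_divided_power[OF cbilinear_convolve3_inner[OF assms]])

lemma ctrilinear_convolve3: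
  assumes "ctrilinear m"
  shows "ctrilinear (convolve3 m)"
  by (rule ctrilinearI; rule uea_map_eqI; simp add: convolve3_divided_power[OF assms] map_apply_simps
      ctrilinearD[OF assms] sum.distrib complex_vector.scale_sum_right)

lemma right_translate_convolve3:
  assumes "ctrilinear m"
  shows "right_translate g (convolve3 m F G H) = convolve3 m (right_translate g F) G H +
    convolve3 m F (right_translate g G) H + convolve3 m F G (right_translate g H)"
proof (rule uea_map_ext)
  fix x
  note inner = cbilinear_convolve3_inner[OF assms] and outer = cbilinear_convolve3[OF assms]
  have *: "sweedler (\<lambda>b c. m (map_apply F a) (map_apply G b) (map_apply H c)) (y * uea_embed g) =
      sweedler (\<lambda>b c. m (map_apply F a) (map_apply (right_translate g G) b) (map_apply H c)) y +
      sweedler (\<lambda>b c. m (map_apply F a) (map_apply G b) (map_apply (right_translate g H) c)) y" for a y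
    by (simp add: sweedler_mult_embed[OF inner] right_translate.rep_eq)
  show "map_apply (right_translate g (convolve3 m F G H)) x = map_apply (convolve3 m (right_translate g F) G H +
    convolve3 m F (right_translate g G) H + convolve3 m F G (right_translate g H)) x"
    unfolding right_translate.rep_eq[of g "convolve3 m F G H"] map_apply_simps map_apply_convolve3[OF assms]
      sweedler_mult_embed[OF outer] *
    unfolding sweedler_add[OF outer outer]
    by (simp add: right_translate.rep_eq add.assoc)
qed

text \<open>Antisymmetry of m survives convolution because permuting the legs of the coproduct
  changes nothing.\<close>

lemma convolve3_swap12:
  fixes F G :: "('g::complex_lie_algebra, 'a::complex_vector) uea_map"
  assumes "ctrilinear m" "\<And>a b c. m a b c = - m b a c"
  shows "convolve3 m F G H = - convolve3 m G F H"
proof (rule uea_map_eqI)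
  fix y :: 'g and n
  let ?a = "\<lambda>F i. map_apply F (divided_power y i)"
  have "(\<Sum>i\<le>n. \<Sum>j\<le>n - i. m (?a F i) (?a G j) (?a H (n - i - j))) =
      (\<Sum>i\<le>n. \<Sum>j\<le>n - i. m (?a F j) (?a G i) (?a H (n - i - j)))"
    by (rule sum_sum_swap)
  also have "\<dots> = - (\<Sum>i\<le>n. \<Sum>j\<le>n - i. m (?a G i) (?a F j) (?a H (n - i - j)))"
    unfolding sum_negf[symmetric] by (intro sum.cong refl assms(2))
  finally show "?a (convolve3 m F G H) n = ?a (- convolve3 m G F H) n"
    by (simp add: convolve3_divided_power[OF assms(1)] map_apply_simps)
qed

lemma convolve3_swap23:
  fixes F :: "('g::complex_lie_algebra, 'a::complex_vector) uea_map"
  assumes "ctrilinear m" "\<And>a b c. m a b c = - m a c b"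
  shows "convolve3 m F G H = - convolve3 m F H G"
proof (rule uea_map_eqI)
  fix y :: 'g and n
  let ?a = "\<lambda>F i. map_apply F (divided_power y i)"
  have "(\<Sum>j\<le>k. m u (?a G j) (?a H (k - j))) = - (\<Sum>j\<le>k. m u (?a H j) (?a G (k - j)))" for u k
  proof -
    have "(\<Sum>j\<le>k. m u (?a G j) (?a H (k - j))) = (\<Sum>j\<le>k. - m u (?a H (k - j)) (?a G j))"
      by (intro sum.cong refl assms(2))
    also have "\<dots> = (\<Sum>j\<le>k. - m u (?a H j) (?a G (k - j)))"
      by (rule sum.reindex_bij_witness[of _ "\<lambda>j. k - j" "\<lambda>j. k - j"]) auto
    finally show ?thesis by (simp add: sum_negf)
  qed
  then show "?a (convolve3 m F G H) n = ?a (- convolve3 m F H G) n"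
    by (simp only: convolve3_divided_power[OF assms(1)] map_apply_simps sum_negf)
qed

lemma convolve3_linear:
  assumes "ctrilinear m" "clinear h"
  shows "h (map_apply (convolve3 m F G H) x) = map_apply (convolve3 (\<lambda>a b c. h (m a b c)) F G H) x"
proof -
  have m': "ctrilinear (\<lambda>a b c. h (m a b c))"
    by (rule ctrilinearI)
      (simp_all add: ctrilinearD[OF assms(1)] clinear_add[OF assms(2)] clinear_scaleC[OF assms(2)])
  show ?thesis
    unfolding map_apply_convolve3[OF assms(1)] map_apply_convolve3[OF m']
      sweedler_linear[OF cbilinear_convolve3[OF assms(1)] assms(2)]
      sweedler_linear[OF cbilinear_convolve3_inner[OF assms(1)] assms(2)] ..
qed

text \<open>A form of the fourfold sum that is insensitive to the order of its entries: the six
  terms of the cocycle identity distribute the same four degrees over different slots and have to be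
  aligned.\<close>

definition quad_sum :: "nat \<Rightarrow> (nat \<Rightarrow> nat \<Rightarrow> nat \<Rightarrow> nat \<Rightarrow> 'a::comm_monoid_add) \<Rightarrow> 'a"
  where "quad_sum n h = (\<Sum>(a, b, c, d) \<in> {(a, b, c, d). a + b + c + d = n}. h a b c d)"

lemma quad_sum_eq:
  "(\<Sum>i\<le>n. \<Sum>j\<le>n - i. \<Sum>k\<le>i. h k (i - k) j (n - i - j)) = quad_sum n h"
proof -
  have "(\<Sum>i\<le>n. \<Sum>j\<le>n - i. \<Sum>k\<le>i. h k (i - k) j (n - i - j)) =
    (\<Sum>(i, j, k) \<in> Sigma {..n} (\<lambda>i. {..n - i} \<times> {..i}). h k (i - k) j (n - i - j))"
    by (simp add: sum.cartesian_product sum.Sigma split_def)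
  also have "\<dots> = quad_sum n h"
    unfolding quad_sum_def
    by (rule sum.reindex_bij_witness[of _ "\<lambda>(a, b, c, d). (a + b, c, a)" "\<lambda>(i, j, k). (k, i - k, j, n - i - j)"])
      auto
  finally show ?thesis .
qed

lemma quad_sum_permute:
  "quad_sum n (\<lambda>a c b d. h a b c d) = quad_sum n h"
  "quad_sum n (\<lambda>a d b c. h a b c d) = quad_sum n h"
  "quad_sum n (\<lambda>b c a d. h a b c d) = quad_sum n h"
  "quad_sum n (\<lambda>b d a c. h a b c d) = quad_sum n h"
  "quad_sum n (\<lambda>c d a b. h a b c d) = quad_sum n h"
  unfolding quad_sum_def
  by (rule sum.reindex_bij_witness[of _ "\<lambda>(a, b, c, d). (a, c, b, d)" "\<lambda>(a, c, b, d). (a, b, c, d)"]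
      sum.reindex_bij_witness[of _ "\<lambda>(a, b, c, d). (a, d, b, c)" "\<lambda>(a, d, b, c). (a, b, c, d)"]
      sum.reindex_bij_witness[of _ "\<lambda>(a, b, c, d). (b, c, a, d)" "\<lambda>(b, c, a, d). (a, b, c, d)"]
      sum.reindex_bij_witness[of _ "\<lambda>(a, b, c, d). (b, d, a, c)" "\<lambda>(b, d, a, c). (a, b, c, d)"]
      sum.reindex_bij_witness[of _ "\<lambda>(a, b, c, d). (c, d, a, b)" "\<lambda>(c, d, a, b). (a, b, c, d)"]; force)+

lemma convolve3_bracket:
  fixes m :: "'a::complex_lie_algebra \<Rightarrow> 'a \<Rightarrow> 'a \<Rightarrow> 'b::complex_vector"
  assumes "ctrilinear m"
  shows "map_apply (convolve3 m (bracket A B) C D) (divided_power y n) =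
    quad_sum n (\<lambda>a b c d. m (bracket (map_apply A (divided_power y a)) (map_apply B (divided_power y b)))
      (map_apply C (divided_power y c)) (map_apply D (divided_power y d)))"
  unfolding quad_sum_eq[symmetric] convolve3_divided_power[OF assms]
  by (simp add: bracket_uea_map_def convolve_divided_power[OF cbilinear_bracket]
      clinear_sum[OF ctrilinear_clinear(1)[OF assms]])

text \<open>Once the quadruple sums are aligned, the identity for m applies summand by summand. Thus
  a 3-cocycle identity on a Lie algebra passes to the convolution Lie algebra of maps into
  it.\<close>

lemma convolve3_cocycle:
  fixes A B C D :: "('g::complex_lie_algebra, 'a::complex_lie_algebra) uea_map"
    and m :: "'a::complex_lie_algebra \<Rightarrow> 'a \<Rightarrow> 'a \<Rightarrow> 'b::complex_vector"
  assumes "ctrilinear m"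
    and coc: "\<And>a b c d. m (bracket a b) c d - m (bracket a c) b d + m (bracket a d) b c
      + m (bracket b c) a d - m (bracket b d) a c + m (bracket c d) a b = 0"
  shows "convolve3 m (bracket A B) C D - convolve3 m (bracket A C) B D + convolve3 m (bracket A D) B C
      + convolve3 m (bracket B C) A D - convolve3 m (bracket B D) A C + convolve3 m (bracket C D) A B = 0"
proof (rule uea_map_eqI)
  fix y :: 'g and n
  let ?a = "\<lambda>F i. map_apply F (divided_power y i)"
  note br = convolve3_bracket[OF assms(1), of _ _ _ _ y n]
  have eqs:
    "?a (convolve3 m (bracket A C) B D) n = quad_sum n (\<lambda>a b c d. m (bracket (?a A a) (?a C c)) (?a B b) (?a D d))"
    "?a (convolve3 m (bracket A D) B C) n = quad_sum n (\<lambda>a b c d. m (bracket (?a A a) (?a D d)) (?a B b) (?a C c))"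
    "?a (convolve3 m (bracket B C) A D) n = quad_sum n (\<lambda>a b c d. m (bracket (?a B b) (?a C c)) (?a A a) (?a D d))"
    "?a (convolve3 m (bracket B D) A C) n = quad_sum n (\<lambda>a b c d. m (bracket (?a B b) (?a D d)) (?a A a) (?a C c))"
    "?a (convolve3 m (bracket C D) A B) n = quad_sum n (\<lambda>a b c d. m (bracket (?a C c) (?a D d)) (?a A a) (?a B b))"
    unfolding br by (rule quad_sum_permute)+
  have lin: "quad_sum n h1 - quad_sum n h2 + quad_sum n h3 + quad_sum n h4 - quad_sum n h5 + quad_sum n h6
    = quad_sum n (\<lambda>a b c d. h1 a b c d - h2 a b c d + h3 a b c d + h4 a b c d - h5 a b c d + h6 a b c d)"
    for h1 h2 h3 h4 h5 h6 :: "nat \<Rightarrow> nat \<Rightarrow> nat \<Rightarrow> nat \<Rightarrow> 'b"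
    by (simp add: quad_sum_def split_def sum.distrib sum_subtractf)
  show "?a (convolve3 m (bracket A B) C D - convolve3 m (bracket A C) B D + convolve3 m (bracket A D) B C
      + convolve3 m (bracket B C) A D - convolve3 m (bracket B D) A C + convolve3 m (bracket C D) A B) n = ?a 0 n"
    unfolding map_apply_simps eqs br[of A B C D] lin coc by (simp add: quad_sum_def)
qed

section \<open>The Eulerian idempotent on powers\<close>

lemma locally_finite_bound:
  fixes T :: "nat \<Rightarrow> 'g::complex_lie_algebra uea \<Rightarrow> 'a::complex_vector"
  assumes lin: "\<And>k. clinear (T k)" and "\<And>y n k. n < k \<Longrightarrow> T k (divided_power y n) = 0"
  shows "\<exists>N. \<forall>k\<ge>N. T k x = 0"
proof (induction x rule: divided_power_induct)
  case (add u v)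
  then obtain N M where "\<forall>k\<ge>N. T k u = 0" "\<forall>k\<ge>M. T k v = 0" by blast
  then show ?case by (intro exI[of _ "max N M"]) (simp add: clinear_add[OF lin])
next
  case (power y n)
  show ?case using assms(2) by (intro exI[of _ "Suc n"]) simp
qed (auto simp: clinear_zero[OF lin] clinear_scaleC[OF lin])

lemma Sum_any_eq_sum_bound:
  fixes T :: "nat \<Rightarrow> 'a::comm_monoid_add"
  assumes "\<forall>k\<ge>N. T k = 0"
  shows "Sum_any T = (\<Sum>k<N. T k)"
  using assms by (intro Sum_any.expand_superset) (auto simp: not_le[symmetric])

text \<open>\<open>Sum_any\<close> is additive only on finite supports, and the number of nonzero
  terms depends on the argument; a bound common to both arguments reduces everything to ordinary
  finite sums.\<close>

lemma clinear_Sum_any: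
  fixes T :: "nat \<Rightarrow> 'g::complex_lie_algebra uea \<Rightarrow> 'a::complex_vector"
  assumes lin: "\<And>k. clinear (T k)" and "\<And>y n k. n < k \<Longrightarrow> T k (divided_power y n) = 0"
  shows "clinear (\<lambda>x. Sum_any (\<lambda>k. T k x))"
proof (rule clinearI)
  fix x y c
  obtain N M where NM: "\<forall>k\<ge>N. T k x = 0" "\<forall>k\<ge>M. T k y = 0"
    using locally_finite_bound[of T, OF assms] by metis
  define K where "K = max N M"
  have K: "\<forall>k\<ge>K. T k x = 0" "\<forall>k\<ge>K. T k y = 0" using NM by (simp_all add: K_def)
  have K': "\<forall>k\<ge>K. T k (x + y) = 0" "\<forall>k\<ge>K. T k (c *\<^sub>C x) = 0"
    using K by (simp_all add: clinear_add[OF lin] clinear_scaleC[OF lin])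
  show "Sum_any (\<lambda>k. T k (x + y)) = Sum_any (\<lambda>k. T k x) + Sum_any (\<lambda>k. T k y)"
    unfolding Sum_any_eq_sum_bound[OF K'(1)] Sum_any_eq_sum_bound[OF K(1)] Sum_any_eq_sum_bound[OF K(2)]
    by (simp add: clinear_add[OF lin] sum.distrib)
  show "Sum_any (\<lambda>k. T k (c *\<^sub>C x)) = c *\<^sub>C Sum_any (\<lambda>k. T k x)"
    unfolding Sum_any_eq_sum_bound[OF K'(2)] Sum_any_eq_sum_bound[OF K(1)]
    by (simp add: clinear_scaleC[OF lin] complex_vector.scale_sum_right)
qed

lemma clinear_scale: "clinear F \<Longrightarrow> clinear (\<lambda>x. c *\<^sub>C F x)"
  by (rule clinearI) (simp_all add: clinear_add clinear_scaleC scaleC_add_right scaleC_scaleC mult.commute)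

lemma convolution_power_eq:
  assumes "clinear F"
  shows "convolution_power F n = map_apply (Abs_uea_map F ^ n)"
proof (induction n)
  case 0
  show ?case by (simp add: fun_eq_iff one_uea_map.rep_eq uea_unit_def)
next
  case (Suc n)
  show ?case
    by (simp add: fun_eq_iff Suc convolution_def times_uea_map_def map_apply_convolve[OF cbilinear_mult]
        sweedler_def map_apply_Abs[OF assms])
qed

lemma clinear_convolution_power: "clinear F \<Longrightarrow> clinear (convolution_power F n)"
  by (simp add: convolution_power_eq clinear_map_apply)

lemma convolution_power_Suc_divided_power:
  assumes "clinear F"
  shows "convolution_power F (Suc n) (divided_power y m) =
    (\<Sum>i\<le>m. convolution_power F n (divided_power y i) * F (divided_power y (m - i)))"
  unfolding convolution_power_eq[OF assms] power_Suc2 times_uea_map_def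
  by (simp add: convolve_divided_power[OF cbilinear_mult] map_apply_Abs[OF assms])

text \<open>Equal to m! S(n, m) / n! with the Stirling numbers S of the second kind.\<close>

definition exp_minus_one_power :: "nat \<Rightarrow> nat \<Rightarrow> complex"
  where "exp_minus_one_power m n = fps_nth ((fps_exp 1 - 1) ^ m) n"

lemma clinear_minus_counit: "clinear (\<lambda>x :: 'g::complex_lie_algebra uea. x - uea_unit (uea_counit x))"
  unfolding uea_unit_def
  by (rule clinearI) (simp_all add: clinear_add[OF clinear_uea_counit] clinear_scaleC[OF clinear_uea_counit]
      scaleC_add_left complex_vector.scale_right_diff_distrib scaleC_scaleC scaleC_complex_def)

text \<open>The map Id - \<eta>\<epsilon> sends exp (z y) to exp (z y) - 1, and its convolution
  powers become powers of this series.\<close>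

lemma convolution_power_minus_counit:
  "convolution_power (\<lambda>x. x - uea_unit (uea_counit x)) m (divided_power y n) =
    exp_minus_one_power m n *\<^sub>C uea_embed y ^ n"
proof (induction m arbitrary: n)
  case 0
  show ?case
    by (simp add: exp_minus_one_power_def uea_unit_def counit_divided_power)
next
  case (Suc m)
  have 1: "divided_power y k - uea_unit (uea_counit (divided_power y k)) =
      fps_nth (fps_exp 1 - 1) k *\<^sub>C uea_embed y ^ k" for k
    unfolding counit_divided_power
    by (cases "k = 0") (simp_all add: uea_unit_def scaleC_one divided_power_def)
  show ?case
    unfolding convolution_power_Suc_divided_power[OF clinear_minus_counit] Suc 1
    by (simp add: exp_minus_one_power_def power_Suc2 fps_mult_nth atLeast0AtMost complex_vector.scale_sum_left
        mult_scaleC_left mult_scaleC_right scaleC_scaleC flip: power_add del: power_Suc)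
      (simp add: mult.commute)
qed

lemma exp_minus_one_power_eq_0: "n < m \<Longrightarrow> exp_minus_one_power m n = 0"
  unfolding exp_minus_one_power_def by (rule startsby_zero_power_prefix[rule_format]) simp_all

lemma eulerian_series_linear:
  "clinear (\<lambda>x. ((-1) ^ k / of_nat (k + 1)) *\<^sub>C
    convolution_power (\<lambda>y. y - uea_unit (uea_counit y)) (k + 1) x)"
  by (rule clinear_scale[OF clinear_convolution_power[OF clinear_minus_counit]])

lemma clinear_eulerian: "clinear eulerian"
  unfolding eulerian_def[abs_def]
  by (rule clinear_Sum_any[OF eulerian_series_linear])
    (simp add: convolution_power_minus_counit exp_minus_one_power_eq_0 del: convolution_power.simps)

text \<open>On powers of one element, the Eulerian idempotent reads off the coefficients of
  \<open>ln (1 + (exp z - 1)) = z\<close>.\<close>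

lemma eulerian_divided_power: "eulerian (divided_power y n) = (if n = 1 then uea_embed y else 0)"
proof -
  have "fps_ln (1::complex) oo (fps_exp 1 - 1) = fps_X"
    unfolding fps_ln_fps_exp_inv[of "1::complex", simplified] by (rule fps_inv) simp_all
  then have "fps_nth fps_X n = (\<Sum>i=0..n. fps_nth (fps_ln 1) i * exp_minus_one_power i n)"
    by (simp add: exp_minus_one_power_def fps_compose_nth[symmetric])
  also have "\<dots> = (\<Sum>k<n. (-1) ^ k / of_nat (k + 1) * exp_minus_one_power (k + 1) n)"
    unfolding atLeast0AtMost lessThan_Suc_atMost[symmetric] sum.lessThan_Suc_shift by (simp add: fps_ln_nth)
  finally have *: "(\<Sum>k<n. (-1) ^ k / of_nat (k + 1) * exp_minus_one_power (k + 1) n) = (if n = 1 then 1 else 0)"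
    by simp
  have "eulerian (divided_power y n) = (\<Sum>k<n. ((-1) ^ k / of_nat (k + 1)) *\<^sub>C
      exp_minus_one_power (k + 1) n *\<^sub>C uea_embed y ^ n)"
    unfolding eulerian_def convolution_power_minus_counit
    by (rule Sum_any_eq_sum_bound) (simp add: exp_minus_one_power_eq_0)
  also have "\<dots> = (\<Sum>k<n. (-1) ^ k / of_nat (k + 1) * exp_minus_one_power (k + 1) n) *\<^sub>C uea_embed y ^ n"
    by (simp only: complex_vector.scale_sum_left scaleC_scaleC)
  finally show ?thesis unfolding * by (simp add: scaleC_one)
qed

text \<open>The series exp (z y) is sent by pr to z y, hence by the n-th convolution power to z^n
  y^n. The missing 1 / n! is supplied by the definition of \<open>uea_phi\<close>, which therefore
  rescales exp (z y) to exp (s z y).\<close>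

lemma convolution_power_eulerian:
  "convolution_power eulerian n (divided_power y m) = (if m = n then uea_embed y ^ n else 0)"
proof (induction n arbitrary: m)
  case 0
  show ?case by (simp add: uea_unit_def counit_divided_power scaleC_one)
next
  case (Suc n)
  have "convolution_power eulerian (Suc n) (divided_power y m) =
      (\<Sum>i\<le>m. if i = n then uea_embed y ^ n * (if m - n = 1 then uea_embed y else 0) else 0)"
    unfolding convolution_power_Suc_divided_power[OF clinear_eulerian] Suc eulerian_divided_power
    by (rule sum.cong) auto
  then show ?case by (auto simp: power_Suc2 simp del: convolution_power.simps power_Suc)
qed

lemma tensor_pure_zero: "0 \<otimes> b = 0" "a \<otimes> 0 = 0"
  using cbilinearD(5,6)[OF cbilinear_tensor_pure] by blast+

lemma clinear_uea_phi_term: "clinear (\<lambda>x. (1 / fact n) *\<^sub>C (convolution_power eulerian n x \<otimes> s ^ n))"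
proof (rule clinear_scale)
  note lin = clinear_convolution_power[OF clinear_eulerian, of n]
  show "clinear (\<lambda>x. convolution_power eulerian n x \<otimes> s ^ n)"
    by (rule clinearI)
      (simp_all only: clinear_add[OF lin] clinear_scaleC[OF lin] tensor_pure_add_left tensor_pure_scaleC_left)
qed

lemma clinear_uea_phi: "clinear (uea_phi s)"
  unfolding uea_phi_def[abs_def]
  by (rule clinear_Sum_any[OF clinear_uea_phi_term])
    (simp add: convolution_power_eulerian tensor_pure_zero)

lemma uea_phi_divided_power: "uea_phi s (divided_power y n) = divided_power y n \<otimes> s ^ n"
proof -
  have "uea_phi s (divided_power y n) = (\<Sum>k<Suc n. (1 / fact k) *\<^sub>C
      (convolution_power eulerian k (divided_power y n) \<otimes> s ^ k))"
    unfolding uea_phi_def by (rule Sum_any_eq_sum_bound) (simp add: convolution_power_eulerian tensor_pure_zero)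
  also have "\<dots> = (\<Sum>k<Suc n. if k = n then divided_power y n \<otimes> s ^ n else 0)"
    unfolding convolution_power_eulerian
    by (rule sum.cong) (simp_all add: tensor_pure_zero divided_power_def tensor_pure_scaleC_left)
  finally show ?thesis by simp
qed

section \<open>Tensoring with polynomials\<close>

text \<open>Evaluation at t and extraction of a coefficient are both contractions of the polynomial
  factor with a functional, and so share their lemmas.\<close>

definition poly_functional :: "(complex poly \<Rightarrow> complex) \<Rightarrow> ('a::complex_vector, complex poly) tensor \<Rightarrow> 'a"
  where "poly_functional l = tensor_lift (\<lambda>a p. l p *\<^sub>C a)"

lemma cbilinear_poly_functional: "clinear l \<Longrightarrow> cbilinear (\<lambda>a p. l p *\<^sub>C a)"
  by (rule cbilinearI)
    (simp_all add: scaleC_add_right scaleC_add_left clinear_add clinear_scaleC scaleC_scaleC scaleC_complex_def mult.commute)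

lemma clinear_poly_functional: "clinear l \<Longrightarrow> clinear (poly_functional l)"
  unfolding poly_functional_def by (intro clinear_tensor_lift cbilinear_poly_functional)

lemma poly_functional_pure: "clinear l \<Longrightarrow> poly_functional l (a \<otimes> p) = l p *\<^sub>C a"
  unfolding poly_functional_def by (rule tensor_lift_pure[OF cbilinear_poly_functional])

lemma cbilinear_tensor_map:
  assumes "clinear F" "clinear G"
  shows "cbilinear (\<lambda>a b. F a \<otimes> G b)"
  by (intro cbilinear_compose[OF cbilinear_tensor_pure] assms)

lemma clinear_tensor_map: "clinear F \<Longrightarrow> clinear G \<Longrightarrow> clinear (tensor_map F G)"
  unfolding tensor_map_def by (intro clinear_tensor_lift cbilinear_tensor_map)

lemma tensor_map_pure: "clinear F \<Longrightarrow> clinear G \<Longrightarrow> tensor_map F G (a \<otimes> b) = F a \<otimes> G b"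
  unfolding tensor_map_def by (rule tensor_lift_pure[OF cbilinear_tensor_map])

lemma tensor_linear_eqI:
  assumes "clinear F" "clinear G" "\<And>a b. F (a \<otimes> b) = G (a \<otimes> b)"
  shows "F T = G T"
  by (induction T rule: tensor_induct)
    (simp_all add: assms(3) clinear_zero[OF assms(1)] clinear_zero[OF assms(2)]
      clinear_add[OF assms(1)] clinear_add[OF assms(2)])

lemma poly_functional_tensor_map:
  assumes "clinear l" "clinear F"
  shows "poly_functional l (tensor_map F (\<lambda>p. p) T) = F (poly_functional l T)"
proof (rule tensor_linear_eqI[of _ _ T])
  show "clinear (\<lambda>T. poly_functional l (tensor_map F (\<lambda>p. p) T))"
    by (rule clinear_compose[OF clinear_poly_functional[OF assms(1)] clinear_tensor_map[OF assms(2) clinear_ident]])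
  show "clinear (\<lambda>T. F (poly_functional l T))"
    by (rule clinear_compose[OF assms(2) clinear_poly_functional[OF assms(1)]])
qed (simp add: tensor_map_pure[OF assms(2) clinear_ident] poly_functional_pure[OF assms(1)]
    clinear_scaleC[OF assms(2)])

abbreviation eval_at :: "complex \<Rightarrow> ('a::complex_vector, complex poly) tensor \<Rightarrow> 'a"
  where "eval_at t \<equiv> poly_functional (\<lambda>p. poly p t)"

abbreviation tcoeff :: "nat \<Rightarrow> ('a::complex_vector, complex poly) tensor \<Rightarrow> 'a"
  where "tcoeff n \<equiv> poly_functional (\<lambda>p. coeff p n)"

abbreviation tderiv :: "('a::complex_vector, complex poly) tensor \<Rightarrow> ('a, complex poly) tensor"
  where "tderiv \<equiv> tensor_map (\<lambda>a. a) pderiv"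

lemma clinear_poly: "clinear (\<lambda>p. poly p (t::complex))"
  by (rule clinearI) (simp_all add: scaleC_poly_eq_smult scaleC_complex_def)

lemma clinear_coeff: "clinear (\<lambda>p. coeff p n :: complex)"
  by (rule clinearI) (simp_all add: scaleC_poly_eq_smult scaleC_complex_def)

lemma clinear_pderiv: "clinear (pderiv :: complex poly \<Rightarrow> _)"
  by (rule clinearI) (simp_all add: scaleC_poly_eq_smult pderiv_add pderiv_smult)

lemmas clinear_eval_at = clinear_poly_functional[OF clinear_poly]
lemmas clinear_tcoeff = clinear_poly_functional[OF clinear_coeff]
lemmas clinear_tderiv = clinear_tensor_map[OF clinear_ident clinear_pderiv]
lemmas eval_at_pure = poly_functional_pure[OF clinear_poly]
lemmas tcoeff_pure = poly_functional_pure[OF clinear_coeff]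
lemmas tderiv_pure = tensor_map_pure[OF clinear_ident clinear_pderiv]

text \<open>Stated for all large M, since two tensors may have to be expanded to a common length,
  and one application asks for at least two terms.\<close>

lemma tensor_eq_sum_tcoeff:
  fixes T :: "('a::complex_vector, complex poly) tensor"
  shows "\<exists>N. \<forall>M\<ge>N. T = (\<Sum>n<M. tcoeff n T \<otimes> monom 1 n)"
proof (induction T rule: tensor_induct)
  case zero
  show ?case by (simp add: clinear_zero[OF clinear_tcoeff] tensor_pure_zero)
next
  case (add S T)
  then obtain N M where NM: "\<And>K. K \<ge> N \<Longrightarrow> S = (\<Sum>n<K. tcoeff n S \<otimes> monom 1 n)"
    "\<And>K. K \<ge> M \<Longrightarrow> T = (\<Sum>n<K. tcoeff n T \<otimes> monom 1 n)" by blast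
  show ?case
  proof (intro exI[of _ "max N M"] allI impI)
    fix K assume "max N M \<le> K"
    then have "S + T = (\<Sum>n<K. tcoeff n S \<otimes> monom 1 n) + (\<Sum>n<K. tcoeff n T \<otimes> monom 1 n)"
      by (intro arg_cong2[of _ _ _ _ "(+)"] NM) simp_all
    then show "S + T = (\<Sum>n<K. tcoeff n (S + T) \<otimes> monom 1 n)"
      unfolding clinear_add[OF clinear_tcoeff] tensor_pure_add_left sum.distrib .
  qed
next
  case (pure a p)
  show ?case
  proof (intro exI[of _ "Suc (degree p)"] allI impI)
    fix M assume "Suc (degree p) \<le> M"
    then have "p = (\<Sum>n<M. monom (coeff p n) n)"
      by (intro poly_eqI) (auto simp: coeff_sum coeff_eq_0 if_distrib cong: if_cong)
    then have "a \<otimes> p = a \<otimes> (\<Sum>n<M. coeff p n *\<^sub>C monom 1 n)"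
      by (simp add: scaleC_poly_eq_smult smult_monom)
    also have "\<dots> = (\<Sum>n<M. a \<otimes> (coeff p n *\<^sub>C monom 1 n))"
      by (rule clinear_sum[OF clinearI]) (simp_all add: tensor_pure_add_right tensor_pure_scaleC_right)
    finally show "a \<otimes> p = (\<Sum>n<M. tcoeff n (a \<otimes> p) \<otimes> monom 1 n)"
      unfolding tcoeff_pure tensor_pure_scaleC_left tensor_pure_scaleC_right .
  qed
qed

lemma eval_at_eq_sum_tcoeff:
  assumes "T = (\<Sum>n<M. tcoeff n T \<otimes> monom 1 n)"
  shows "eval_at t T = (\<Sum>n<M. t ^ n *\<^sub>C tcoeff n T)"
  by (subst assms) (simp add: clinear_sum[OF clinear_eval_at] eval_at_pure poly_monom)

text \<open>A tensor with polynomials is determined by its coefficients, which lie in the first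
  factor, and there injectivity is given.\<close>

lemma tensor_map_inject:
  fixes F :: "'a::complex_vector \<Rightarrow> 'b::complex_vector"
  assumes "clinear F" "inj F"
  shows "inj (tensor_map F (\<lambda>p. p) :: ('a, complex poly) tensor \<Rightarrow> _)"
proof (rule injI)
  fix S T :: "('a, complex poly) tensor" assume eq: "tensor_map F (\<lambda>p. p) S = tensor_map F (\<lambda>p. p) T"
  have same: "tcoeff n S = tcoeff n T" for n
    using arg_cong[OF eq, of "tcoeff n"] assms
    by (simp add: poly_functional_tensor_map[OF clinear_coeff assms(1)] inj_eq)
  obtain N where N: "\<forall>K\<ge>N. S = (\<Sum>n<K. tcoeff n S \<otimes> monom 1 n)"
    using tensor_eq_sum_tcoeff by blast
  obtain M where M: "\<forall>K\<ge>M. T = (\<Sum>n<K. tcoeff n T \<otimes> monom 1 n)"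
    using tensor_eq_sum_tcoeff by blast
  have "S = (\<Sum>n<max N M. tcoeff n S \<otimes> monom 1 n)" by (rule N[rule_format]) simp
  also have "\<dots> = T" unfolding same by (rule M[rule_format, symmetric]) simp
  finally show "S = T" .
qed

lemma tcoeff_Suc: "of_nat (Suc n) *\<^sub>C tcoeff (Suc n) T = tcoeff n (tderiv T)"
proof (rule tensor_linear_eqI[of _ _ T, OF clinear_scale[OF clinear_tcoeff] clinear_compose[OF clinear_tcoeff clinear_tderiv]])
  show "of_nat (Suc n) *\<^sub>C tcoeff (Suc n) (a \<otimes> p) = tcoeff n (tderiv (a \<otimes> p))" for a p
    unfolding tderiv_pure tcoeff_pure by (simp add: scaleC_scaleC coeff_pderiv del: of_nat_Suc)
qed

lemma tcoeff_0: "tcoeff 0 T = eval_at 0 T"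
  by (simp add: poly_0_coeff_0)

lemma eval_at_mult:
  fixes S T :: "('a::complex_algebra, complex poly) tensor"
  shows "eval_at t (S * T) = eval_at t S * eval_at t T"
proof (induction S rule: tensor_induct)
  case zero
  show ?case by (simp add: clinear_zero[OF clinear_eval_at])
next
  case (add S S')
  then show ?case by (simp add: distrib_right clinear_add[OF clinear_eval_at])
next
  case (pure a p)
  show ?case
    by (induction T rule: tensor_induct)
      (simp_all add: clinear_zero[OF clinear_eval_at] distrib_left clinear_add[OF clinear_eval_at]
        tensor_pure_mult eval_at_pure mult_scaleC_left mult_scaleC_right scaleC_scaleC mult.commute)
qed

lemma tderiv_mult:
  fixes S T :: "('a::complex_algebra, complex poly) tensor"
  shows "tderiv (S * T) = tderiv S * T + S * tderiv T"
proof (induction S rule: tensor_induct)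
  case zero
  show ?case by (simp add: clinear_zero[OF clinear_tderiv])
next
  case (add S S')
  then show ?case by (simp add: distrib_right clinear_add[OF clinear_tderiv])
next
  case (pure a p)
  show ?case
  proof (induction T rule: tensor_induct)
    case (pure b q)
    show ?case by (simp add: tensor_pure_mult tderiv_pure pderiv_mult tensor_pure_add_right mult.commute add.commute)
  qed (simp_all add: clinear_zero[OF clinear_tderiv] distrib_left clinear_add[OF clinear_tderiv])
qed

lemma tcoeff_mult_pure_one:
  fixes T :: "('a::complex_algebra, complex poly) tensor"
  shows "tcoeff n (T * (b \<otimes> 1)) = tcoeff n T * b" "tcoeff n ((b \<otimes> 1) * T) = b * tcoeff n T"
  by (induction T rule: tensor_induct;
      simp add: clinear_zero[OF clinear_tcoeff] distrib_left distrib_right clinear_add[OF clinear_tcoeff]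
        tensor_pure_mult tcoeff_pure mult_scaleC_left mult_scaleC_right)+

section \<open>The logarithmic derivative of the exponential family\<close>

lemma post_compose_eqI:
  assumes "clinear h" "clinear k" "\<And>y n. h (map_apply F (divided_power y n)) = k (map_apply G (divided_power y n))"
  shows "post_compose h F = post_compose k G"
  by (rule uea_map_eqI) (simp add: map_apply_post_compose assms)

lemma
  assumes "clinear h"
  shows post_compose_add: "post_compose h (F + G) = post_compose h F + post_compose h G"
    and post_compose_diff: "post_compose h (F - G) = post_compose h F - post_compose h G"
    and post_compose_scaleC: "post_compose h (c *\<^sub>C F) = c *\<^sub>C post_compose h F"
    and post_compose_zero: "post_compose h 0 = 0"
    and post_compose_right_translate: "post_compose h (right_translate g F) = right_translate g (post_compose h F)"
  by (rule uea_map_eqI, simp add: map_apply_post_compose[OF assms] map_apply_simps right_translate.rep_eq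
      clinear_add[OF assms] clinear_diff[OF assms] clinear_scaleC[OF assms] clinear_zero[OF assms])+

lemma times_uea_map_divided_power:
  "map_apply (F * G) (divided_power y n) =
    (\<Sum>i\<le>n. map_apply F (divided_power y i) * map_apply G (divided_power y (n - i)))"
  unfolding times_uea_map_def by (rule convolve_divided_power[OF cbilinear_mult])

lemma times_uea_map_apply:
  "map_apply (F * G) x = sweedler (\<lambda>a b. map_apply F a * map_apply G b) x"
  unfolding times_uea_map_def by (rule map_apply_convolve[OF cbilinear_mult])

lemma post_compose_mult:
  assumes "clinear h" "\<And>a b. h (a * b) = h a * h b"
  shows "post_compose h (F * G) = post_compose h F * post_compose h G"
  by (rule uea_map_eqI)
    (simp add: map_apply_post_compose[OF assms(1)] times_uea_map_divided_power clinear_sum[OF assms(1)] assms(2))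

lemma post_compose_derivation:
  assumes "clinear D" "\<And>a b. D (a * b) = D a * b + a * D b"
  shows "post_compose D (F * G) = post_compose D F * G + F * post_compose D G"
  by (rule uea_map_eqI)
    (simp add: map_apply_post_compose[OF assms(1)] times_uea_map_divided_power clinear_sum[OF assms(1)] assms(2)
      map_apply_simps sum.distrib)

definition eulerian_map :: "('g::complex_lie_algebra, 'g uea) uea_map"
  where "eulerian_map = Abs_uea_map eulerian"

lemma map_apply_eulerian_map: "map_apply eulerian_map = eulerian"
  unfolding eulerian_map_def by (rule map_apply_Abs[OF clinear_eulerian])

definition phi_map :: "complex poly \<Rightarrow> ('g::complex_lie_algebra, ('g uea, complex poly) tensor) uea_map"
  where "phi_map s = Abs_uea_map (uea_phi s)"

lemma map_apply_phi_map: "map_apply (phi_map s) = uea_phi s"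
  unfolding phi_map_def by (rule map_apply_Abs[OF clinear_uea_phi])

definition A_map :: "'g::complex_lie_algebra \<Rightarrow> ('g, ('g uea, complex poly) tensor) uea_map"
  where "A_map g = phi_map [:0, -1:] * right_translate g (phi_map [:0, 1:])"

lemma map_apply_A_map: "map_apply (A_map g) x = uea_A x g"
  unfolding A_map_def times_uea_map_apply uea_A_def sweedler_def map_apply_phi_map right_translate.rep_eq ..

text \<open>Powers of one y commute, so on them this is the binomial theorem for (r + s)^n, which
  vanishes unless n = 0.\<close>

lemma phi_map_inverse:
  assumes "r + s = 0"
  shows "phi_map r * phi_map s = (1 :: ('g::complex_lie_algebra, _) uea_map)"
proof (rule uea_map_eqI)
  fix y :: 'g and n
  have *: "divided_power y i * divided_power y (n - i) = (of_nat (n choose i) / fact n) *\<^sub>C uea_embed y ^ n"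
    if "i \<le> n" for i
    using that by (simp add: divided_power_def mult_scaleC_left mult_scaleC_right scaleC_scaleC binomial_fact
        flip: power_add)
  have "map_apply (phi_map r * phi_map s) (divided_power y n) =
      (\<Sum>i\<le>n. (divided_power y i * divided_power y (n - i)) \<otimes> (r ^ i * s ^ (n - i)))"
    by (simp only: times_uea_map_divided_power map_apply_phi_map uea_phi_divided_power tensor_pure_mult)
  also have "\<dots> = (\<Sum>i\<le>n. divided_power y n \<otimes> (of_nat (n choose i) * r ^ i * s ^ (n - i)))"
  proof (rule sum.cong[OF refl])
    fix i assume "i \<in> {..n}"
    then have i: "i \<le> n" by simp
    have "(divided_power y i * divided_power y (n - i)) \<otimes> (r ^ i * s ^ (n - i)) =
        of_nat (n choose i) *\<^sub>C divided_power y n \<otimes> (r ^ i * s ^ (n - i))"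
      unfolding *[OF i] by (simp add: divided_power_def scaleC_scaleC)
    also have "\<dots> = divided_power y n \<otimes> (of_nat (n choose i) *\<^sub>C (r ^ i * s ^ (n - i)))"
      by (simp only: tensor_pure_scaleC_left tensor_pure_scaleC_right)
    also have "of_nat (n choose i) *\<^sub>C (r ^ i * s ^ (n - i)) = of_nat (n choose i) * r ^ i * s ^ (n - i)"
      by (simp add: scaleC_poly_eq_smult of_nat_poly)
    finally show "(divided_power y i * divided_power y (n - i)) \<otimes> (r ^ i * s ^ (n - i)) =
        divided_power y n \<otimes> (of_nat (n choose i) * r ^ i * s ^ (n - i))" .
  qed
  also have "\<dots> = divided_power y n \<otimes> (r + s) ^ n"
    unfolding binomial_ring
    by (rule clinear_sum[OF clinearI, symmetric]) (simp_all add: tensor_pure_add_right tensor_pure_scaleC_right)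
  also have "\<dots> = map_apply 1 (divided_power y n)"
    by (cases n)
      (simp_all add: assms one_uea_map.rep_eq counit_divided_power one_tensor_def uea_counit_one scaleC_one
        tensor_pure_zero)
  finally show "map_apply (phi_map r * phi_map s) (divided_power y n) = map_apply 1 (divided_power y n)" .
qed

definition eulerian_const :: "('g::complex_lie_algebra, ('g uea, complex poly) tensor) uea_map"
  where "eulerian_const = post_compose (\<lambda>u. u \<otimes> 1) eulerian_map"

lemma clinear_pure_one: "clinear (\<lambda>u. u \<otimes> (1 :: complex poly))"
  by (rule clinearI) (simp_all add: tensor_pure_add_left tensor_pure_scaleC_left)

lemma eulerian_const_divided_power:
  "map_apply eulerian_const (divided_power y n) = (if n = 1 then uea_embed y \<otimes> 1 else 0)"
  unfolding eulerian_const_def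
  by (simp add: map_apply_post_compose[OF clinear_pure_one] map_apply_eulerian_map eulerian_divided_power
      tensor_pure_zero)

lemma embed_power_mult: "divided_power y n * uea_embed y = of_nat (Suc n) *\<^sub>C divided_power y (Suc n)"
  unfolding embed_mult_divided_power[symmetric]
  by (simp add: divided_power_def mult_scaleC_left mult_scaleC_right power_commutes)

lemma tderiv_phi_map_plus: "post_compose tderiv (phi_map [:0, 1:]) = phi_map [:0, 1:] * eulerian_const"
proof (rule uea_map_eqI)
  fix y :: 'a and n
  show "map_apply (post_compose tderiv (phi_map [:0, 1:])) (divided_power y n) =
      map_apply (phi_map [:0, 1:] * eulerian_const) (divided_power y n)"
  proof (cases n)
    case 0
    then show ?thesis
      unfolding times_uea_map_divided_power map_apply_post_compose[OF clinear_tderiv] map_apply_phi_map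
        uea_phi_divided_power eulerian_const_divided_power tderiv_pure
      by (simp add: tensor_pure_zero)
  next
    case (Suc k)
    \<comment> \<open>Since pr only sees the first power, i = k alone survives; the factor k + 1
      from multiplying by y is the one that differentiating t^(k+1) produces.\<close>
    have "map_apply (phi_map [:0, 1:] * eulerian_const) (divided_power y (Suc k)) =
        (\<Sum>i\<le>Suc k. if i = k then (divided_power y k * uea_embed y) \<otimes> [:0, 1:] ^ k else 0)"
      unfolding times_uea_map_divided_power map_apply_phi_map uea_phi_divided_power eulerian_const_divided_power
      by (rule sum.cong) (auto simp: tensor_pure_mult)
    also have "\<dots> = (of_nat (Suc k) *\<^sub>C divided_power y (Suc k)) \<otimes> [:0, 1:] ^ k"
      by (simp add: embed_power_mult del: of_nat_Suc)
    also have "\<dots> = divided_power y (Suc k) \<otimes> pderiv ([:0, 1:] ^ Suc k)"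
      unfolding tensor_pure_scaleC_left tensor_pure_scaleC_right[symmetric]
      by (simp add: pderiv_power_Suc scaleC_poly_eq_smult pderiv_pCons del: of_nat_Suc power_Suc)
    finally show ?thesis
      by (simp add: Suc map_apply_post_compose[OF clinear_tderiv] map_apply_phi_map uea_phi_divided_power
          tderiv_pure del: power_Suc)
  qed
qed

text \<open>Differentiate phi_{-t} \<star> phi_t = 1 instead of computing. This puts pr on the left,
  the order in which the derivative of A becomes a commutator.\<close>

lemma tderiv_phi_map_minus: "post_compose tderiv (phi_map [:0, -1:]) = - (eulerian_const * phi_map [:0, -1:])"
proof -
  let ?P = "phi_map [:0, 1:] :: ('a, _) uea_map" and ?M = "phi_map [:0, -1:] :: ('a, _) uea_map"
  have inv: "?M * ?P = 1" "?P * ?M = 1" by (rule phi_map_inverse, simp)+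
  have "post_compose tderiv (1 :: ('a, ('a uea, complex poly) tensor) uea_map) = 0"
  proof -
    have "tderiv (1 :: ('a uea, complex poly) tensor) = 0"
      by (simp add: one_tensor_def tderiv_pure tensor_pure_zero)
    then show ?thesis
      by (intro uea_map_eqI)
        (simp add: map_apply_post_compose[OF clinear_tderiv] one_uea_map.rep_eq
          clinear_scaleC[OF clinear_tderiv] map_apply_simps)
  qed
  then have "post_compose tderiv ?M * ?P + ?M * (?P * eulerian_const) = 0"
    using post_compose_derivation[OF clinear_tderiv tderiv_mult, of ?M ?P] inv
    by (simp add: tderiv_phi_map_plus)
  then have "post_compose tderiv ?M * ?P = - eulerian_const"
    by (simp add: inv mult.assoc[symmetric] eq_neg_iff_add_eq_0)
  then have "post_compose tderiv ?M * ?P * ?M = - eulerian_const * ?M" by simp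
  then show ?thesis by (simp add: mult.assoc inv)
qed

lemma tderiv_A_map:
  "post_compose tderiv (A_map g) =
    right_translate g eulerian_const + A_map g * eulerian_const - eulerian_const * A_map g"
proof -
  have "phi_map [:0, -1:] * phi_map [:0, 1:] = (1 :: ('a, _) uea_map)"
    by (rule phi_map_inverse) simp
  then have 1: "phi_map [:0, -1:] * (phi_map [:0, 1:] * X) = X" for X :: "('a, _) uea_map"
    by (simp add: mult.assoc[symmetric])
  show ?thesis
    unfolding A_map_def post_compose_derivation[OF clinear_tderiv tderiv_mult]
      post_compose_right_translate[OF clinear_tderiv] tderiv_phi_map_minus tderiv_phi_map_plus right_translate_mult
    by (simp add: distrib_left 1 mult.assoc)
qed

section \<open>The family A at a fixed number t\<close>

abbreviation A_at :: "complex \<Rightarrow> 'g::complex_lie_algebra \<Rightarrow> ('g, 'g uea) uea_map"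
  where "A_at t g \<equiv> post_compose (eval_at t) (A_map g)"

lemma A_at_eq:
  "A_at t g = post_compose (eval_at t) (phi_map [:0, -1:]) * right_translate g (post_compose (eval_at t) (phi_map [:0, 1:]))"
  unfolding A_map_def post_compose_mult[OF clinear_eval_at eval_at_mult]
    post_compose_right_translate[OF clinear_eval_at] ..

lemma eval_at_one: "eval_at t (1 :: ('a::complex_algebra, complex poly) tensor) = 1"
  by (simp add: one_tensor_def eval_at_pure scaleC_one)

lemma eval_at_phi_map_inverse:
  assumes "r + s = 0"
  shows "post_compose (eval_at t) (phi_map r) * post_compose (eval_at t) (phi_map s) =
    (1 :: ('g::complex_lie_algebra, 'g uea) uea_map)"
  unfolding post_compose_mult[OF clinear_eval_at eval_at_mult, symmetric] phi_map_inverse[OF assms]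
  by (rule uea_map_eqI)
    (simp add: map_apply_post_compose[OF clinear_eval_at] one_uea_map.rep_eq clinear_scaleC[OF clinear_eval_at]
      eval_at_one)

text \<open>With M inverse to P, A(g) = M R_g P is a logarithmic derivative of P. Differentiating M
  P = 1 determines R_g M, and the terms with two translations of P cancel by
  \<open>right_translate_bracket\<close>.\<close>

lemma A_at_maurer_cartan:
  "right_translate g (A_at t h) - right_translate h (A_at t g) - A_at t (bracket g h) =
    - (A_at t g * A_at t h - A_at t h * A_at t g)"
proof -
  define M P where "M = post_compose (eval_at t) (phi_map [:0, -1:] :: ('a, _) uea_map)"
    and "P = post_compose (eval_at t) (phi_map [:0, 1:] :: ('a, _) uea_map)"
  have A: "A_at t k = M * right_translate k P" for k
    unfolding A_at_eq M_def P_def ..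
  have inv: "M * P = 1" "P * M = 1" unfolding M_def P_def by (rule eval_at_phi_map_inverse, simp)+
  have RM: "right_translate k M = - (M * right_translate k P * M)" for k
  proof -
    have "right_translate k M * P = - (M * right_translate k P)"
      using right_translate_mult[of k M P] by (simp add: inv right_translate_one eq_neg_iff_add_eq_0)
    then have "right_translate k M * P * M = - (M * right_translate k P * M)" by simp
    then show ?thesis by (simp add: mult.assoc inv)
  qed
  have *: "right_translate k (M * right_translate l P) =
      - (M * right_translate k P * (M * right_translate l P)) + M * right_translate k (right_translate l P)" for k l
    by (simp add: right_translate_mult RM mult.assoc)
  show ?thesis
    unfolding A * right_translate_bracket by (simp add: algebra_simps)
qed

lemma A_at_0: "A_at 0 g = 0"
proof -
  have "post_compose (eval_at 0) (phi_map [:0, 1:]) = (1 :: ('a, 'a uea) uea_map)"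
  proof (rule uea_map_eqI)
    fix y :: 'a and n
    show "map_apply (post_compose (eval_at 0) (phi_map [:0, 1:])) (divided_power y n) = map_apply 1 (divided_power y n)"
      unfolding map_apply_post_compose[OF clinear_eval_at] map_apply_phi_map uea_phi_divided_power eval_at_pure
        one_uea_map.rep_eq counit_divided_power
      by (cases n) simp_all
  qed
  then show ?thesis by (simp add: A_at_eq right_translate_one)
qed

text \<open>Here phi_1 is the identity, so phi_{-1} is the antipode; after g is pulled out to the
  right, its convolution with the identity gives the counit.\<close>

lemma A_at_1: "map_apply (A_at 1 g) x = uea_counit x *\<^sub>C uea_embed g"
proof -
  have id: "map_apply (post_compose (eval_at 1) (phi_map [:0, 1:])) u = u" for u :: "'a uea"
    unfolding map_apply_post_compose[OF clinear_eval_at] map_apply_phi_map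
    by (rule clinear_eq_on_divided_powers[OF clinear_compose[OF clinear_eval_at clinear_uea_phi] clinear_ident])
      (simp add: uea_phi_divided_power eval_at_pure scaleC_one)
  let ?M = "post_compose (eval_at 1) (phi_map [:0, -1:]) :: ('a, 'a uea) uea_map"
  let ?P = "post_compose (eval_at 1) (phi_map [:0, 1:]) :: ('a, 'a uea) uea_map"
  have "map_apply (A_at 1 g) x = sweedler (\<lambda>a b. map_apply ?M a * (b * uea_embed g)) x"
    unfolding A_at_eq times_uea_map_apply right_translate.rep_eq id ..
  also have "\<dots> = sweedler (\<lambda>a b. map_apply ?M a * b) x * uea_embed g"
    by (subst sweedler_linear[OF cbilinear_compose[OF cbilinear_mult clinear_map_apply clinear_ident] clinear_mult_right])
      (simp add: mult.assoc)
  also have "sweedler (\<lambda>a b. map_apply ?M a * b) x = map_apply (?M * ?P) x"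
    unfolding times_uea_map_apply id ..
  also have "?M * ?P = 1" by (rule eval_at_phi_map_inverse) simp
  finally show ?thesis by (simp add: one_uea_map.rep_eq mult_scaleC_left)
qed

section \<open>Values in the Lie algebra\<close>

lemma eulerian_in_range: "eulerian x \<in> range uea_embed"
proof (induction x rule: divided_power_induct)
  case zero
  show ?case using clinear_zero[OF clinear_uea_embed] by (auto simp: clinear_zero[OF clinear_eulerian] image_iff intro: exI[of _ 0])
next
  case (add u v)
  then show ?case by (auto simp: clinear_add[OF clinear_eulerian] clinear_add[OF clinear_uea_embed, symmetric])
next
  case (scale c u)
  then show ?case by (auto simp: clinear_scaleC[OF clinear_eulerian] clinear_scaleC[OF clinear_uea_embed, symmetric])
next
  case (power y n)
  show ?case using clinear_zero[OF clinear_uea_embed] by (auto simp: eulerian_divided_power image_iff intro: exI[of _ 0])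
qed

lemma embed_eulerian_lie: "uea_embed (eulerian_lie x) = eulerian x"
  unfolding eulerian_lie_def by (rule f_inv_into_f[OF eulerian_in_range])

lemma post_embed_bracket:
  "post_compose uea_embed (bracket F G) =
    post_compose uea_embed F * post_compose uea_embed G - post_compose uea_embed G * post_compose uea_embed F"
proof (rule uea_map_eqI)
  fix y :: 'a and n
  let ?a = "\<lambda>F i. map_apply F (divided_power y i)"
  have "(\<Sum>i\<le>n. uea_embed (?a G (n - i)) * uea_embed (?a F i)) = (\<Sum>i\<le>n. uea_embed (?a G i) * uea_embed (?a F (n - i)))"
    by (rule sum.reindex_bij_witness[of _ "\<lambda>i. n - i" "\<lambda>i. n - i"]) auto
  then show "?a (post_compose uea_embed (bracket F G)) n =
    ?a (post_compose uea_embed F * post_compose uea_embed G - post_compose uea_embed G * post_compose uea_embed F) n"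
    by (simp add: map_apply_post_compose[OF clinear_uea_embed] bracket_uea_map_def
        convolve_divided_power[OF cbilinear_bracket] clinear_sum[OF clinear_uea_embed] uea_embed_bracket
        map_apply_simps times_uea_map_divided_power sum_subtractf)
qed

lemma tcoeff_mult_eulerian:
  "post_compose (tcoeff n) (F * eulerian_const) = post_compose (tcoeff n) F * eulerian_map"
  "post_compose (tcoeff n) (eulerian_const * F) = eulerian_map * post_compose (tcoeff n) F"
  by (rule uea_map_eqI, simp add: map_apply_post_compose[OF clinear_tcoeff] times_uea_map_divided_power
      clinear_sum[OF clinear_tcoeff] eulerian_const_def map_apply_post_compose[OF clinear_pure_one]
      tcoeff_mult_pure_one)+

lemma tcoeff_eulerian_const: "post_compose (tcoeff n) eulerian_const = (if n = 0 then eulerian_map else 0)"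
  by (rule uea_map_eqI)
    (simp add: map_apply_post_compose[OF clinear_tcoeff] eulerian_const_def map_apply_post_compose[OF clinear_pure_one]
      tcoeff_pure map_apply_simps scaleC_one)

text \<open>The differential equation of A coefficient by coefficient; R_g pr is constant in t and
  enters only for n = 0.\<close>

lemma tcoeff_A_map_Suc:
  "of_nat (Suc n) *\<^sub>C post_compose (tcoeff (Suc n)) (A_map g) =
    (if n = 0 then right_translate g eulerian_map else 0) +
    post_compose (tcoeff n) (A_map g) * eulerian_map - eulerian_map * post_compose (tcoeff n) (A_map g)"
proof -
  have "of_nat (Suc n) *\<^sub>C post_compose (tcoeff (Suc n)) (A_map g) = post_compose (tcoeff n) (post_compose tderiv (A_map g))"
    by (rule uea_map_eqI)
      (simp only: map_apply_post_compose[OF clinear_tcoeff] map_apply_post_compose[OF clinear_tderiv]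
        map_apply_simps tcoeff_Suc)
  also have "\<dots> = post_compose (tcoeff n) (right_translate g eulerian_const) +
    post_compose (tcoeff n) (A_map g) * eulerian_map - eulerian_map * post_compose (tcoeff n) (A_map g)"
    unfolding tderiv_A_map post_compose_add[OF clinear_tcoeff] post_compose_diff[OF clinear_tcoeff]
      tcoeff_mult_eulerian ..
  also have "post_compose (tcoeff n) (right_translate g eulerian_const) = (if n = 0 then right_translate g eulerian_map else 0)"
    unfolding post_compose_right_translate[OF clinear_tcoeff] tcoeff_eulerian_const
    by (auto intro: uea_map_eqI simp: right_translate.rep_eq map_apply_simps)
  finally show ?thesis .
qed

definition eulerian_lie_map :: "('g::complex_lie_algebra, 'g) uea_map"
  where "eulerian_lie_map = Abs_uea_map eulerian_lie"

text \<open>The power series solution of the same equation with initial value 0, written with the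
  bracket of \<gg>; it exhibits the values of A in \<gg>.\<close>

primrec A_lie_coeff :: "'g::complex_lie_algebra \<Rightarrow> nat \<Rightarrow> ('g, 'g) uea_map" where
  "A_lie_coeff g 0 = 0"
| "A_lie_coeff g (Suc n) = (1 / of_nat (Suc n)) *\<^sub>C
    ((if n = 0 then right_translate g eulerian_lie_map else 0) + bracket (A_lie_coeff g n) eulerian_lie_map)"

definition A_lie_map :: "'g::complex_lie_algebra \<Rightarrow> ('g, ('g, complex poly) tensor) uea_map"
  where "A_lie_map g = Abs_uea_map (\<lambda>x. uea_A_lie x g)"

abbreviation A_lie_at :: "complex \<Rightarrow> 'g::complex_lie_algebra \<Rightarrow> ('g, 'g) uea_map"
  where "A_lie_at t g \<equiv> post_compose (eval_at t) (A_lie_map g)"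

text \<open>Injectivity is an assumption here, since these results are needed for s \<gg>[s] in
  order to establish it for \<gg>.\<close>

context
  assumes inj: "inj (uea_embed :: 'g::complex_lie_algebra \<Rightarrow> 'g uea)"
begin

lemma clinear_eulerian_lie: "clinear (eulerian_lie :: 'g uea \<Rightarrow> 'g)"
proof (rule clinearI)
  fix x y :: "'g uea" and c
  show "eulerian_lie (x + y) = eulerian_lie x + eulerian_lie y"
    by (rule injD[OF inj]) (simp only: embed_eulerian_lie clinear_add[OF clinear_eulerian] clinear_add[OF clinear_uea_embed])
  show "eulerian_lie (c *\<^sub>C x) = c *\<^sub>C eulerian_lie x"
    by (rule injD[OF inj]) (simp only: embed_eulerian_lie clinear_scaleC[OF clinear_eulerian] clinear_scaleC[OF clinear_uea_embed])
qed

lemma map_apply_eulerian_lie_map: "map_apply eulerian_lie_map = (eulerian_lie :: 'g uea \<Rightarrow> 'g)"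
  unfolding eulerian_lie_map_def by (rule map_apply_Abs[OF clinear_eulerian_lie])

lemma eulerian_lie_divided_power: "eulerian_lie (divided_power y n) = (if n = 1 then y else (0::'g))"
  by (rule injD[OF inj])
    (simp add: embed_eulerian_lie eulerian_divided_power clinear_zero[OF clinear_uea_embed])

lemma post_embed_eulerian_lie_map:
  "post_compose uea_embed (eulerian_lie_map :: ('g, 'g) uea_map) = eulerian_map"
  by (rule uea_map_eqI)
    (simp add: map_apply_post_compose[OF clinear_uea_embed] map_apply_eulerian_lie_map map_apply_eulerian_map
      embed_eulerian_lie)

lemma post_embed_inject:
  fixes F G :: "('g, 'g) uea_map"
  assumes "post_compose uea_embed F = post_compose uea_embed G"
  shows "F = G"
proof (rule uea_map_eqI)
  fix y n
  from arg_cong[OF assms, of "\<lambda>F. map_apply F (divided_power y n)"]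
  show "map_apply F (divided_power y n) = map_apply G (divided_power y n)"
    by (simp add: map_apply_post_compose[OF clinear_uea_embed] inj_eq[OF inj])
qed

text \<open>Both sides obey the same recursion from the same start, as \<open>uea_embed\<close>
  turns brackets into commutators.\<close>

lemma post_embed_A_lie_coeff:
  "post_compose uea_embed (A_lie_coeff (g :: 'g) n) = post_compose (tcoeff n) (A_map g)"
proof (induction n)
  case 0
  have "post_compose (tcoeff 0) (A_map g) = A_at 0 g"
    by (rule post_compose_eqI[OF clinear_tcoeff clinear_eval_at]) (rule tcoeff_0)
  then show ?case by (simp add: A_at_0 post_compose_zero[OF clinear_uea_embed])
next
  case (Suc n)
  have "post_compose uea_embed (A_lie_coeff g (Suc n)) = (1 / of_nat (Suc n)) *\<^sub>C
      ((if n = 0 then right_translate g eulerian_map else 0) +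
      (post_compose (tcoeff n) (A_map g) * eulerian_map - eulerian_map * post_compose (tcoeff n) (A_map g)))"
    by (simp add: post_compose_scaleC[OF clinear_uea_embed] post_compose_add[OF clinear_uea_embed]
        post_embed_bracket Suc post_embed_eulerian_lie_map post_compose_right_translate[OF clinear_uea_embed]
        post_compose_zero[OF clinear_uea_embed] del: of_nat_Suc)
  also have "\<dots> = (1 / of_nat (Suc n)) *\<^sub>C (of_nat (Suc n) *\<^sub>C post_compose (tcoeff (Suc n)) (A_map g))"
    unfolding tcoeff_A_map_Suc by (simp only: add_diff_eq)
  also have "\<dots> = post_compose (tcoeff (Suc n)) (A_map g)"
    by (simp add: scaleC_scaleC scaleC_one del: of_nat_Suc)
  finally show ?case .
qed

lemma inj_tensor_embed: "inj (tensor_map uea_embed (\<lambda>p. p) :: ('g, complex poly) tensor \<Rightarrow> _)"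
  by (rule tensor_map_inject[OF clinear_uea_embed inj])

lemmas clinear_tensor_embed = clinear_tensor_map[OF clinear_uea_embed clinear_ident]

text \<open>Justifies the \<open>inv\<close> in \<open>uea_A_lie\<close>: only finitely many
  coefficients occur, and each of them comes from \<gg>.\<close>

lemma tensor_embed_uea_A_lie:
  "tensor_map uea_embed (\<lambda>p. p) (uea_A_lie x (g :: 'g)) = uea_A x g"
proof -
  obtain N where "\<forall>M\<ge>N. uea_A x g = (\<Sum>n<M. tcoeff n (uea_A x g) \<otimes> monom 1 n)"
    using tensor_eq_sum_tcoeff by blast
  then have "uea_A x g = (\<Sum>n<N. tcoeff n (uea_A x g) \<otimes> monom 1 n)" by blast
  also have "\<dots> = (\<Sum>n<N. uea_embed (map_apply (A_lie_coeff g n) x) \<otimes> monom 1 n)"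
    using arg_cong[OF post_embed_A_lie_coeff[of g], of "\<lambda>F. map_apply F x"]
    by (simp add: map_apply_post_compose[OF clinear_uea_embed] map_apply_post_compose[OF clinear_tcoeff] map_apply_A_map)
  also have "\<dots> = tensor_map uea_embed (\<lambda>p. p) (\<Sum>n<N. map_apply (A_lie_coeff g n) x \<otimes> monom 1 n)"
    by (simp add: clinear_sum[OF clinear_tensor_embed] tensor_map_pure[OF clinear_uea_embed clinear_ident])
  finally have "uea_A x g \<in> range (tensor_map uea_embed (\<lambda>p. p))" by blast
  then show ?thesis
    unfolding uea_A_lie_def id_def by (rule f_inv_into_f)
qed

lemma clinear_uea_A_lie: "clinear (\<lambda>x. uea_A_lie x (g :: 'g))"
proof -
  have lin: "uea_A (x + y) g = uea_A x g + uea_A y g" "uea_A (c *\<^sub>C x) g = c *\<^sub>C uea_A x g" for x y c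
    unfolding map_apply_A_map[symmetric]
    by (simp_all add: clinear_add[OF clinear_map_apply] clinear_scaleC[OF clinear_map_apply])
  show ?thesis
    by (rule clinearI; rule injD[OF inj_tensor_embed])
      (simp_all only: tensor_embed_uea_A_lie clinear_add[OF clinear_tensor_embed]
        clinear_scaleC[OF clinear_tensor_embed] lin)
qed

lemma map_apply_A_lie_map: "map_apply (A_lie_map g) x = uea_A_lie x (g :: 'g)"
  unfolding A_lie_map_def by (simp add: map_apply_Abs[OF clinear_uea_A_lie])

lemma clinear_uea_A_lie_right: "clinear (\<lambda>g. uea_A_lie x (g :: 'g))"
proof -
  have R: "right_translate (g + h) F = right_translate g F + right_translate h F"
    "right_translate (c *\<^sub>C g) F = c *\<^sub>C right_translate g F" for g h :: 'g and c and F :: "('g, ('g uea, complex poly) tensor) uea_map"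
    by (rule uea_map_eqI, simp add: right_translate.rep_eq map_apply_simps clinear_add[OF clinear_uea_embed]
        clinear_scaleC[OF clinear_uea_embed] distrib_left mult_scaleC_right clinear_add[OF clinear_map_apply]
        clinear_scaleC[OF clinear_map_apply])+
  have lin: "uea_A x (g + h) = uea_A x g + uea_A x h" "uea_A x (c *\<^sub>C g) = c *\<^sub>C uea_A x g" for g h :: 'g and c
    unfolding map_apply_A_map[symmetric] A_map_def R by (simp_all add: distrib_left mult_scaleC_right map_apply_simps)
  show ?thesis
    by (rule clinearI; rule injD[OF inj_tensor_embed])
      (simp_all only: tensor_embed_uea_A_lie clinear_add[OF clinear_tensor_embed]
        clinear_scaleC[OF clinear_tensor_embed] lin)
qed

lemma embed_poly_functional_A_lie:
  assumes "clinear l"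
  shows "uea_embed (poly_functional l (uea_A_lie x (g :: 'g))) = poly_functional l (uea_A x g)"
  using poly_functional_tensor_map[OF assms clinear_uea_embed, of "uea_A_lie x g"]
  by (simp add: tensor_embed_uea_A_lie)

lemma post_embed_A_lie_at: "post_compose uea_embed (A_lie_at t (g :: 'g)) = A_at t g"
  by (rule uea_map_eqI)
    (simp add: map_apply_post_compose[OF clinear_uea_embed] map_apply_post_compose[OF clinear_eval_at]
      map_apply_A_lie_map map_apply_A_map embed_poly_functional_A_lie[OF clinear_poly])

lemma A_lie_at_maurer_cartan:
  "right_translate g (A_lie_at t h) - right_translate h (A_lie_at t g) - A_lie_at t (bracket g h) =
    - bracket (A_lie_at t g) (A_lie_at t (h :: 'g))"
proof (rule post_embed_inject)
  have neg: "post_compose uea_embed (- F) = - post_compose uea_embed F" for F :: "('g, 'g) uea_map"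
    using post_compose_diff[OF clinear_uea_embed, of 0 F] by (simp add: post_compose_zero[OF clinear_uea_embed])
  show "post_compose uea_embed (right_translate g (A_lie_at t h) - right_translate h (A_lie_at t g) - A_lie_at t (bracket g h))
    = post_compose uea_embed (- bracket (A_lie_at t g) (A_lie_at t h))"
    unfolding neg post_compose_diff[OF clinear_uea_embed] post_compose_right_translate[OF clinear_uea_embed]
      post_embed_bracket post_embed_A_lie_at by (rule A_at_maurer_cartan)
qed

lemma A_lie_at_0: "A_lie_at 0 (g :: 'g) = 0"
  by (rule post_embed_inject) (simp add: post_embed_A_lie_at A_at_0 post_compose_zero[OF clinear_uea_embed])

lemma eval_1_uea_A_lie: "eval_at 1 (uea_A_lie x (g :: 'g)) = uea_counit x *\<^sub>C g"
  using A_at_1[of g x]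
  by (intro injD[OF inj]) (simp add: embed_poly_functional_A_lie[OF clinear_poly] clinear_scaleC[OF clinear_uea_embed]
      map_apply_post_compose[OF clinear_eval_at] map_apply_A_map)

lemma tcoeff_uea_A_lie: "tcoeff n (uea_A_lie x (g :: 'g)) = map_apply (A_lie_coeff g n) x"
  using arg_cong[OF post_embed_A_lie_coeff[of g n], of "\<lambda>F. map_apply F x"]
  by (intro injD[OF inj]) (simp add: embed_poly_functional_A_lie[OF clinear_coeff]
      map_apply_post_compose[OF clinear_uea_embed] map_apply_post_compose[OF clinear_tcoeff] map_apply_A_map)

lemma A_lie_at_tderiv:
  "post_compose (eval_at t) (post_compose tderiv (A_lie_map (g :: 'g))) =
    right_translate g eulerian_lie_map + bracket (A_lie_at t g) eulerian_lie_map"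
proof (rule post_embed_inject)
  have comm: "uea_embed (eval_at t (tderiv S)) = eval_at t (tderiv (tensor_map uea_embed (\<lambda>p. p) S))" for S :: "('g, complex poly) tensor"
    by (rule tensor_linear_eqI[of _ _ S,
          OF clinear_compose[OF clinear_uea_embed clinear_compose[OF clinear_eval_at clinear_tderiv]]
             clinear_compose[OF clinear_eval_at clinear_compose[OF clinear_tderiv clinear_tensor_embed]]])
      (simp add: tderiv_pure tensor_map_pure[OF clinear_uea_embed clinear_ident] eval_at_pure
        clinear_scaleC[OF clinear_uea_embed])
  have "post_compose uea_embed (post_compose (eval_at t) (post_compose tderiv (A_lie_map g))) =
      post_compose (eval_at t) (post_compose tderiv (A_map g))"
    by (rule uea_map_eqI)
      (simp add: map_apply_post_compose[OF clinear_uea_embed] map_apply_post_compose[OF clinear_eval_at]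
        map_apply_post_compose[OF clinear_tderiv] map_apply_A_lie_map map_apply_A_map comm tensor_embed_uea_A_lie)
  also have "post_compose (eval_at t) eulerian_const = (eulerian_map :: ('g, 'g uea) uea_map)"
    by (rule uea_map_eqI)
      (simp add: map_apply_post_compose[OF clinear_eval_at] eulerian_const_def map_apply_post_compose[OF clinear_pure_one]
        eval_at_pure scaleC_one)
  then have "post_compose (eval_at t) (post_compose tderiv (A_map g)) =
      right_translate g eulerian_map + A_at t g * eulerian_map - eulerian_map * A_at t g"
    unfolding tderiv_A_map post_compose_add[OF clinear_eval_at] post_compose_diff[OF clinear_eval_at]
      post_compose_mult[OF clinear_eval_at eval_at_mult] post_compose_right_translate[OF clinear_eval_at] by simp
  finally show "post_compose uea_embed (post_compose (eval_at t) (post_compose tderiv (A_lie_map g))) =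
    post_compose uea_embed (right_translate g eulerian_lie_map + bracket (A_lie_at t g) eulerian_lie_map)"
    unfolding post_compose_add[OF clinear_uea_embed] post_compose_right_translate[OF clinear_uea_embed]
      post_embed_bracket post_embed_A_lie_at post_embed_eulerian_lie_map by (simp add: add_diff_eq)
qed

end

section \<open>Injectivity of the embedding into the enveloping algebra\<close>

text \<open>The Lie algebra part of a word applied to a vector 1, where letters act on 1 by D and on
  the Lie algebra by the adjoint action. The empty word leaves 1 fixed, whose Lie algebra part is
  0.\<close>

fun dynkin :: "('f \<Rightarrow> 'f) \<Rightarrow> 'f::complex_lie_algebra list \<Rightarrow> 'f" where
  "dynkin D [] = 0"
| "dynkin D (x # xs) = (if xs = [] then D x else bracket x (dynkin D xs))"

lemma dynkin_linear:
  assumes "clinear D"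
  shows "dynkin D (w @ (x + y) # v) = dynkin D (w @ x # v) + dynkin D (w @ y # v)"
    and "dynkin D (w @ (c *\<^sub>C x) # v) = c *\<^sub>C dynkin D (w @ x # v)"
  by (induction w) (simp_all add: clinear_add[OF assms] clinear_scaleC[OF assms] bracket_add_left bracket_add_right
      bracket_scaleC_left bracket_scaleC_right)

lemma bracket_zero [simp]: "bracket 0 x = 0" "bracket x 0 = 0"
  using cbilinearD(5,6)[OF cbilinear_bracket] by blast+

lemma bracket_minus_right: "bracket x (- y) = - bracket x y"
  using bracket_add_right[of x y "- y"] by (simp add: eq_neg_iff_add_eq_0 add.commute)

lemma bracket_diff_right: "bracket x (y - z) = bracket x y - bracket x z"
  using bracket_add_right[of x y "- z"] by (simp add: bracket_minus_right)

lemma jacobi_adjoint: "bracket x (bracket y z) - bracket y (bracket x z) = bracket (bracket x y) z"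
  using jacobi[of x y z]
  unfolding bracket_anticommute[of z "bracket x y"] bracket_anticommute[of z x] bracket_minus_right
  by simp

text \<open>If letters follow the exchanged pair this is the Jacobi identity; if the pair is at the
  end it is exactly the Leibniz rule for D. Letters in front only apply further brackets.\<close>

lemma dynkin_bracket:
  assumes "\<And>x y. D (bracket x y) = bracket (D x) y + bracket x (D y)"
  shows "dynkin D (w @ x # y # v) - dynkin D (w @ y # x # v) = dynkin D (w @ bracket x y # v)"
proof (induction w)
  case Nil
  show ?case using bracket_anticommute[of "D x" y] by (simp add: assms jacobi_adjoint)
next
  case (Cons z w)
  show ?case using Cons by (simp flip: bracket_diff_right)
qed

text \<open>The assignment \<open>x\<^sub>1 \<dots> x\<^sub>n \<mapsto> [x\<^sub>1, \<dots> [x\<^sub>n\<^sub>-\<^sub>1, D x\<^sub>n]]\<close> descends to the enveloping algebra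
  (it is the action on a vector \<open>1\<close> with \<open>x \<cdot> 1 = D x\<close>) and restricts to \<open>D\<close> on the Lie algebra.\<close>

lemma inj_uea_embed_of_derivation:
  fixes D :: "'f::complex_lie_algebra \<Rightarrow> 'f"
  assumes lin: "clinear D" and der: "\<And>x y. D (bracket x y) = bracket (D x) y + bracket x (D y)" and "inj D"
  shows "inj (uea_embed :: 'f \<Rightarrow> 'f uea)"
proof -
  define L where "L = free_linear (\<lambda>w. dynkin D (letters w))"
  have linL: "clinear L" unfolding L_def by (rule clinear_free_linear)
  note L_simps = clinear_zero[OF linL] clinear_add[OF linL] clinear_diff[OF linL]
  have L_single: "L (Poly_Mapping.single w c) = c *\<^sub>C dynkin D (letters w)" for w c
    by (simp add: L_def free_linear_single)
  \<comment> \<open>Bilinearity reduces arbitrary outer factors to words; scalars are pulled out as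
    multiples of the empty word.\<close>
  have words: "L (a * r * b) = 0"
    if "\<And>v w. L (Poly_Mapping.single (FWord v) 1 * r * Poly_Mapping.single (FWord w) 1) = 0" for a r b
  proof (induction a rule: poly_mapping_single_induct)
    case (3 v c)
    show ?case
    proof (induction b rule: poly_mapping_single_induct)
      case (3 w d)
      have "Poly_Mapping.single v c * r * Poly_Mapping.single w d =
          (c * d) *\<^sub>C (Poly_Mapping.single (FWord (letters v)) 1 * r * Poly_Mapping.single (FWord (letters w)) 1)"
      proof -
        have 1: "Poly_Mapping.single v c = Poly_Mapping.single 0 c * Poly_Mapping.single v 1" for v :: "'f free_word" and c :: complex
          by (simp add: mult_single)
        have 2: "Poly_Mapping.single v c = Poly_Mapping.single v 1 * Poly_Mapping.single 0 c" for v :: "'f free_word" and c :: complex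
          by (simp add: mult_single)
        have "Poly_Mapping.single v c * r * Poly_Mapping.single w d = Poly_Mapping.single 0 c *
            (Poly_Mapping.single v 1 * r * Poly_Mapping.single w 1) * Poly_Mapping.single 0 d"
          by (subst 1[of v c], subst 2[of w d]) (simp only: mult.assoc)
        also have "\<dots> = d *\<^sub>C c *\<^sub>C (Poly_Mapping.single v 1 * r * Poly_Mapping.single w 1)"
          by (simp only: scaleC_eq_mult_left[symmetric] scaleC_eq_mult_right[symmetric])
        finally show ?thesis by (simp add: scaleC_scaleC mult.commute)
      qed
      then show ?case using that[of "letters v" "letters w"] by (simp add: clinear_scaleC[OF linL])
    qed (simp_all add: L_simps distrib_left)
  qed (simp_all add: L_simps distrib_right)
  \<comment> \<open>The factors a and b are kept arbitrary so that the case \<open>mult\<close> can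
    absorb its own factors into them.\<close>
  have "L (a * p * b) = 0" if "p \<in> uea_ideal" for a b p
    using that
  proof (induction arbitrary: a b)
    case (relator p)
    show ?case
    proof (rule words)
      fix v w
      show "L (Poly_Mapping.single (FWord v) 1 * p * Poly_Mapping.single (FWord w) 1) = 0"
        using relator
      proof cases
        case (add g h)
        show ?thesis
          unfolding add free_gen_def
          by (simp add: left_diff_distrib right_diff_distrib mult_single plus_free_word_def L_simps L_single
              dynkin_linear[OF lin] scaleC_one)
      next
        case (scaleC c g)
        show ?thesis
          unfolding scaleC free_gen_def scaleC_single
          by (simp add: left_diff_distrib right_diff_distrib mult_single plus_free_word_def L_simps L_single
              dynkin_linear[OF lin] scaleC_one)
      next
        case (bracket g h)
        show ?thesis
          unfolding bracket free_gen_def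
          by (simp add: left_diff_distrib right_diff_distrib mult_single plus_free_word_def L_simps L_single
              dynkin_bracket[of D, OF der] scaleC_one)
      qed
    qed
  next
    case zero
    show ?case by (simp add: L_simps)
  next
    case (add p q)
    then show ?case by (simp add: L_simps distrib_left distrib_right)
  next
    case (mult p a' b')
    from mult.IH[of "a * a'" "b' * b"] show ?case by (simp add: mult.assoc)
  qed
  from this[of _ 1 1] have ideal: "p \<in> uea_ideal \<Longrightarrow> L p = 0" for p by simp
  have gen: "L (free_gen x) = D x" for x
    by (simp add: free_gen_def L_single scaleC_one)
  show ?thesis
  proof (rule injI)
    fix x y :: 'f assume "uea_embed x = uea_embed y"
    then have "free_gen x - free_gen y \<in> uea_ideal" by transfer
    from ideal[OF this] have "D x = D y" by (simp add: L_simps gen)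
    with \<open>inj D\<close> show "x = y" by (rule injD)
  qed
qed

text \<open>For an index type \<open>nat\<close>, \<open>Poly_Mapping.single i x\<close> stands for \<open>s\<^sup>i\<^sup>+\<^sup>1 x\<close>, so that this is the Lie
  algebra \<open>s \<gg>[s]\<close>. Its Euler derivation \<open>s d/ds\<close> is injective, and it surjects onto \<open>\<gg>\<close> by \<open>s = 1\<close>.\<close>

lemma scaleC_single_vector: "c *\<^sub>C Poly_Mapping.single k x = Poly_Mapping.single k (c *\<^sub>C x :: 'a::complex_vector)"
  by (rule poly_mapping_eqI) (simp add: scaleC_poly_mapping.rep_eq lookup_single when_def)

instantiation poly_mapping :: (comm_semiring_1, complex_lie_algebra) complex_lie_algebra
begin

text \<open>Indices are shifted by one: s^(i+1) x and s^(j+1) y have bracket s^(i+j+2) [x, y], which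
  is stored at i + j + 1.\<close>

definition bracket_poly_mapping :: "('a \<Rightarrow>\<^sub>0 'b) \<Rightarrow> ('a \<Rightarrow>\<^sub>0 'b) \<Rightarrow> 'a \<Rightarrow>\<^sub>0 'b"
  where "bracket_poly_mapping p q = (\<Sum>i\<in>Poly_Mapping.keys p. \<Sum>j\<in>Poly_Mapping.keys q.
    Poly_Mapping.single (i + j + 1) (bracket (Poly_Mapping.lookup p i) (Poly_Mapping.lookup q j)))"

lemma bracket_poly_mapping_superset:
  assumes "finite A" "finite B" "Poly_Mapping.keys p \<subseteq> A" "Poly_Mapping.keys q \<subseteq> B"
  shows "bracket p q = (\<Sum>i\<in>A. \<Sum>j\<in>B.
    Poly_Mapping.single (i + j + 1) (bracket (Poly_Mapping.lookup p i) (Poly_Mapping.lookup q j)))"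
proof -
  have "bracket p q = (\<Sum>i\<in>Poly_Mapping.keys p. \<Sum>j\<in>B.
    Poly_Mapping.single (i + j + 1) (bracket (Poly_Mapping.lookup p i) (Poly_Mapping.lookup q j)))"
    unfolding bracket_poly_mapping_def using assms
    by (intro sum.cong refl sum.mono_neutral_left) (auto simp: in_keys_iff)
  also have "\<dots> = (\<Sum>i\<in>A. \<Sum>j\<in>B.
    Poly_Mapping.single (i + j + 1) (bracket (Poly_Mapping.lookup p i) (Poly_Mapping.lookup q j)))"
    using assms by (intro sum.mono_neutral_left) (auto simp: in_keys_iff)
  finally show ?thesis .
qed

lemma bracket_single:
  "bracket (Poly_Mapping.single i x) (Poly_Mapping.single j y) = Poly_Mapping.single (i + j + 1) (bracket x y)"
  by (subst bracket_poly_mapping_superset[of "{i}" "{j}"]) auto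

lemma
  fixes p q r :: "'a \<Rightarrow>\<^sub>0 'b"
  shows bracket_poly_mapping_add_left: "bracket (p + q) r = bracket p r + bracket q r"
    and bracket_poly_mapping_add_right: "bracket p (q + r) = bracket p q + bracket p r"
    and bracket_poly_mapping_zero: "bracket 0 p = 0" "bracket p 0 = 0"
proof -
  let ?K = "Poly_Mapping.keys p \<union> Poly_Mapping.keys q \<union> Poly_Mapping.keys r"
  have fin: "finite ?K" by simp
  have sub: "Poly_Mapping.keys p \<subseteq> ?K" "Poly_Mapping.keys q \<subseteq> ?K" "Poly_Mapping.keys r \<subseteq> ?K"
    "Poly_Mapping.keys (p + q) \<subseteq> ?K" "Poly_Mapping.keys (q + r) \<subseteq> ?K"
    using Poly_Mapping.keys_add[of p q] Poly_Mapping.keys_add[of q r] by auto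
  note br = bracket_poly_mapping_superset[OF fin fin]
  show "bracket (p + q) r = bracket p r + bracket q r"
    unfolding br[OF sub(4,3)] br[OF sub(1,3)] br[OF sub(2,3)]
    by (simp add: lookup_add bracket_add_left single_add sum.distrib)
  show "bracket p (q + r) = bracket p q + bracket p r"
    unfolding br[OF sub(1,5)] br[OF sub(1,2)] br[OF sub(1,3)]
    by (simp add: lookup_add bracket_add_right single_add sum.distrib)
  show "bracket 0 p = 0" "bracket p 0 = 0"
    by (simp_all add: bracket_poly_mapping_def)
qed

lemmas bracket_poly_mapping_simps = bracket_poly_mapping_add_left bracket_poly_mapping_add_right
  bracket_poly_mapping_zero

instance
proof
  fix p q r :: "'a \<Rightarrow>\<^sub>0 'b" and c :: complex
  let ?K = "Poly_Mapping.keys p \<union> Poly_Mapping.keys q"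
  have fin: "finite ?K" by simp
  have sub: "Poly_Mapping.keys p \<subseteq> ?K" "Poly_Mapping.keys q \<subseteq> ?K"
    "Poly_Mapping.keys (c *\<^sub>C p) \<subseteq> ?K" "Poly_Mapping.keys (c *\<^sub>C q) \<subseteq> ?K"
    by (auto simp: in_keys_iff scaleC_poly_mapping.rep_eq)
  note br = bracket_poly_mapping_superset[OF fin fin]
  show "bracket (p + q) r = bracket p r + bracket q r" "bracket p (q + r) = bracket p q + bracket p r"
    by (rule bracket_poly_mapping_simps)+
  show "bracket (c *\<^sub>C p) q = c *\<^sub>C bracket p q"
    unfolding br[OF sub(3,2)] br[OF sub(1,2)]
    by (simp add: scaleC_poly_mapping.rep_eq bracket_scaleC_left complex_vector.scale_sum_right scaleC_single_vector)
  show "bracket p (c *\<^sub>C q) = c *\<^sub>C bracket p q"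
    unfolding br[OF sub(1,4)] br[OF sub(1,2)]
    by (simp add: scaleC_poly_mapping.rep_eq bracket_scaleC_right complex_vector.scale_sum_right scaleC_single_vector)
next
  fix p :: "'a \<Rightarrow>\<^sub>0 'b"
  have "bracket p p = (\<Sum>j\<in>Poly_Mapping.keys p. \<Sum>i\<in>Poly_Mapping.keys p.
      Poly_Mapping.single (i + j + 1) (bracket (Poly_Mapping.lookup p i) (Poly_Mapping.lookup p j)))"
    unfolding bracket_poly_mapping_def by (rule sum.swap)
  also have "\<dots> = - bracket p p"
    unfolding bracket_poly_mapping_def sum_negf[symmetric] single_uminus[symmetric]
    by (intro sum.cong refl arg_cong2[of _ _ _ _ Poly_Mapping.single] bracket_anticommute) (simp add: add_ac)
  finally show "bracket p p = 0" by (rule eq_minus_self_zero)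
next
  fix p q r :: "'a \<Rightarrow>\<^sub>0 'b"
  show "bracket p (bracket q r) + bracket q (bracket r p) + bracket r (bracket p q) = 0" (is "?J p q r = 0")
  proof (induction p rule: poly_mapping_single_induct)
    case 1
    show ?case by (simp add: bracket_poly_mapping_simps)
  next
    case (2 p p')
    have "?J (p + p') q r = ?J p q r + ?J p' q r" by (simp add: bracket_poly_mapping_simps add_ac)
    with 2 show ?case by simp
  next
    case (3 i x)
    let ?p = "Poly_Mapping.single i x"
    show ?case
    proof (induction q rule: poly_mapping_single_induct)
      case 1
      show ?case by (simp add: bracket_poly_mapping_simps)
    next
      case (2 q q')
      have "?J ?p (q + q') r = ?J ?p q r + ?J ?p q' r" by (simp add: bracket_poly_mapping_simps add_ac)
      with 2 show ?case by simp
    next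
      case (3 j y)
      let ?q = "Poly_Mapping.single j y"
      show ?case
      proof (induction r rule: poly_mapping_single_induct)
        case 1
        show ?case by (simp add: bracket_poly_mapping_simps)
      next
        case (2 r r')
        have "?J ?p ?q (r + r') = ?J ?p ?q r + ?J ?p ?q r'" by (simp add: bracket_poly_mapping_simps add_ac)
        with 2 show ?case by simp
      next
        case (3 k z)
        have idx: "j + (k + i + 1) + 1 = i + (j + k + 1) + 1" "k + (i + j + 1) + 1 = i + (j + k + 1) + 1"
          by (simp_all add: add_ac)
        show ?case
          unfolding bracket_single idx single_add[symmetric] jacobi by simp
      qed
    qed
  qed
qed

end

text \<open>The eigenvalue on s^(i+1) is i + 1 and never 0; this is why powers start at s rather
  than at 1.\<close>

lift_definition euler_derivation :: "(nat \<Rightarrow>\<^sub>0 'a::complex_vector) \<Rightarrow> (nat \<Rightarrow>\<^sub>0 'a)"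
  is "\<lambda>p i. of_nat (Suc i) *\<^sub>C p i"
  by (erule finite_subset[rotated]) auto

lemma clinear_euler_derivation: "clinear euler_derivation"
  by (rule clinearI; transfer) (simp_all add: fun_eq_iff scaleC_add_right scaleC_scaleC mult.commute)

lemma inj_euler_derivation: "inj euler_derivation"
  by (rule injI, transfer) (simp add: fun_eq_iff del: of_nat_Suc)

lemma euler_derivation_single:
  "euler_derivation (Poly_Mapping.single i x) = of_nat (Suc i) *\<^sub>C Poly_Mapping.single i x"
  by (rule poly_mapping_eqI)
    (simp add: euler_derivation.rep_eq scaleC_poly_mapping.rep_eq lookup_single when_def del: of_nat_Suc)

lemma euler_derivation_bracket:
  "euler_derivation (bracket p q) = bracket (euler_derivation p) q + bracket p (euler_derivation q)"
proof (induction p rule: poly_mapping_single_induct)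
  case (3 i x)
  show ?case
  proof (induction q rule: poly_mapping_single_induct)
    case (3 j y)
    show ?case
      by (simp add: bracket_single euler_derivation_single bracket_scaleC_left bracket_scaleC_right
          flip: scaleC_add_left)
  qed (simp_all add: clinear_zero[OF clinear_euler_derivation] clinear_add[OF clinear_euler_derivation]
      bracket_add_right)
qed (simp_all add: clinear_zero[OF clinear_euler_derivation] clinear_add[OF clinear_euler_derivation]
    bracket_add_left)

lemma inj_uea_embed_poly_mapping: "inj (uea_embed :: (nat \<Rightarrow>\<^sub>0 'a::complex_lie_algebra) \<Rightarrow> _)"
  by (rule inj_uea_embed_of_derivation[OF clinear_euler_derivation euler_derivation_bracket inj_euler_derivation])

text \<open>Evaluation at s = 1.\<close>

definition total :: "('i \<Rightarrow>\<^sub>0 'a::complex_vector) \<Rightarrow> 'a"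
  where "total p = (\<Sum>i\<in>Poly_Mapping.keys p. Poly_Mapping.lookup p i)"

lemma total_superset:
  assumes "finite A" "Poly_Mapping.keys p \<subseteq> A"
  shows "total p = (\<Sum>i\<in>A. Poly_Mapping.lookup p i)"
  unfolding total_def using assms by (intro sum.mono_neutral_left) (auto simp: in_keys_iff)

lemma clinear_total: "clinear total"
proof (rule clinearI)
  fix p q :: "'a \<Rightarrow>\<^sub>0 'b" and c
  let ?K = "Poly_Mapping.keys p \<union> Poly_Mapping.keys q"
  have sub: "finite ?K" "Poly_Mapping.keys (p + q) \<subseteq> ?K" "Poly_Mapping.keys (c *\<^sub>C p) \<subseteq> ?K"
    "Poly_Mapping.keys p \<subseteq> ?K" "Poly_Mapping.keys q \<subseteq> ?K"
    using Poly_Mapping.keys_add[of p q] by (auto simp: in_keys_iff scaleC_poly_mapping.rep_eq)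
  show "total (p + q) = total p + total q" "total (c *\<^sub>C p) = c *\<^sub>C total p"
    unfolding sub(2-)[THEN total_superset[OF sub(1)]]
    by (simp_all add: lookup_add sum.distrib scaleC_poly_mapping.rep_eq complex_vector.scale_sum_right)
qed

lemma total_single: "total (Poly_Mapping.single i x) = x"
  by (simp add: total_superset[of "{i}"])

lemma total_bracket: "total (bracket p q) = bracket (total p) (total q)"
proof (induction p rule: poly_mapping_single_induct)
  case (3 i x)
  show ?case
    by (induction q rule: poly_mapping_single_induct)
      (simp_all add: bracket_single total_single clinear_zero[OF clinear_total] clinear_add[OF clinear_total]
        bracket_add_right)
qed (simp_all add: clinear_zero[OF clinear_total] clinear_add[OF clinear_total] bracket_add_left)

text \<open>The coefficients of \<open>A\<close> determine \<open>eulerian_lie (y\<^sup>m i / m!)\<close> recursively through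
  \<open>\<Sum>\<^sub>n A_lie_coeff i n = \<epsilon> i\<close>, and the recursion never leaves the ideal.\<close>

lemma eulerian_lie_ideal:
  fixes I :: "'f::complex_lie_algebra set"
  assumes inj: "inj (uea_embed :: 'f \<Rightarrow> 'f uea)" and I: "complex_vector.subspace I"
    and ideal: "\<And>i y. i \<in> I \<Longrightarrow> bracket i y \<in> I" and "i \<in> I"
  shows "eulerian_lie (x * uea_embed i) \<in> I"
proof -
  \<comment> \<open>Induction on m over all n: pr vanishes on powers other than the first, so a
    bracket with pr in degree m only uses coefficients in degree m - 1.\<close>
  have coeff: "map_apply (A_lie_coeff i n) (divided_power y m) \<in> I" for n y m
  proof (induction m arbitrary: n rule: less_induct)
    case (less m)
    let ?c = "\<lambda>n. map_apply (A_lie_coeff i n) (divided_power y m)"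
    have bracket: "map_apply (bracket (A_lie_coeff i n) eulerian_lie_map) (divided_power y m) \<in> I" for n
      unfolding bracket_uea_map_def convolve_divided_power[OF cbilinear_bracket]
        map_apply_eulerian_lie_map[OF inj] eulerian_lie_divided_power[OF inj]
    proof (rule complex_vector.subspace_sum[OF I])
      fix k assume "k \<in> {..m}"
      show "bracket (map_apply (A_lie_coeff i n) (divided_power y k)) (if m - k = 1 then y else 0) \<in> I"
        using less.IH[of k n] ideal complex_vector.subspace_0[OF I] by auto
    qed
    \<comment> \<open>For n > 1 the recursion consists of a bracket alone; n = 1 also contains R_i
      pr and is reached through the sum of all coefficients instead.\<close>
    have other: "?c n \<in> I" if "n \<noteq> 1" for n
    proof (cases n)
      case 0
      then show ?thesis by (simp add: map_apply_simps complex_vector.subspace_0[OF I])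
    next
      case (Suc k)
      then show ?thesis
        using that complex_vector.subspace_scale[OF I bracket[of k]]
        by (simp add: map_apply_simps del: of_nat_Suc)
    qed
    obtain N where N: "\<forall>M\<ge>N. uea_A_lie (divided_power y m) i =
        (\<Sum>n<M. tcoeff n (uea_A_lie (divided_power y m) i) \<otimes> monom 1 n)"
      using tensor_eq_sum_tcoeff by blast
    \<comment> \<open>Evaluating at t = 1 adds up all coefficients. The maximum with 2 ensures that
      index 1 is among them.\<close>
    have "uea_counit (divided_power y m) *\<^sub>C i = (\<Sum>n<max N 2. ?c n)"
      using eval_at_eq_sum_tcoeff[OF N[rule_format, OF max.cobounded1], of 1]
      by (simp add: eval_1_uea_A_lie[OF inj] tcoeff_uea_A_lie[OF inj] scaleC_one)
    also have "\<dots> = ?c 1 + (\<Sum>n\<in>{..<max N 2} - {1}. ?c n)"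
      by (rule sum.remove) auto
    finally have "?c 1 = uea_counit (divided_power y m) *\<^sub>C i - (\<Sum>n\<in>{..<max N 2} - {1}. ?c n)"
      by (simp add: eq_diff_eq)
    moreover have "\<dots> \<in> I"
      using other \<open>i \<in> I\<close>
      by (intro complex_vector.subspace_diff[OF I] complex_vector.subspace_scale[OF I] complex_vector.subspace_sum[OF I]) auto
    ultimately show ?case using other[of n] by (cases "n = 1") auto
  qed
  show ?thesis
  proof (induction x rule: divided_power_induct)
    case (power y n)
    \<comment> \<open>The coefficient with index 1 is R_i pr alone, as the one with index 0
      vanishes.\<close>
    from coeff[of 1 y n] show ?case
      by (simp add: map_apply_simps right_translate.rep_eq map_apply_eulerian_lie_map[OF inj] scaleC_one
          bracket_uea_map_def convolve_divided_power[OF cbilinear_bracket])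
  qed (simp_all add: distrib_right mult_scaleC_left clinear_zero[OF clinear_eulerian_lie[OF inj]]
      clinear_add[OF clinear_eulerian_lie[OF inj]] clinear_scaleC[OF clinear_eulerian_lie[OF inj]]
      complex_vector.subspace_0[OF I] complex_vector.subspace_add[OF I] complex_vector.subspace_scale[OF I])
qed

text \<open>The composite \<open>U(s \<gg>[s]) \<rightarrow> s \<gg>[s] \<rightarrow> \<gg>\<close> of the Eulerian idempotent with \<open>s = 1\<close> kills the ideal generated
  by the kernel of \<open>s = 1\<close>, hence induces a retraction of the embedding of \<open>\<gg>\<close>.\<close>

lemma inj_uea_embed: "inj (uea_embed :: 'g::complex_lie_algebra \<Rightarrow> 'g uea)"
proof -
  note injF = inj_uea_embed_poly_mapping[where ?'a = 'g]
  define I where "I = {p :: nat \<Rightarrow>\<^sub>0 'g. total p = 0}"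
  have I: "complex_vector.subspace I"
    by (simp add: complex_vector.subspace_def I_def clinear_zero[OF clinear_total] clinear_add[OF clinear_total]
        clinear_scaleC[OF clinear_total])
  have ideal: "bracket i y \<in> I" if "i \<in> I" for i y
    using that by (simp add: I_def total_bracket)
  define L where "L u = total (eulerian_lie u)" for u :: "(nat \<Rightarrow>\<^sub>0 'g) uea"
  have linL: "clinear L"
    unfolding L_def by (rule clinear_compose[OF clinear_total clinear_eulerian_lie[OF injF]])
  note L_simps = clinear_zero[OF linL] clinear_add[OF linL] clinear_scaleC[OF linL] clinear_diff[OF linL]
  \<comment> \<open>Induction on the right factor: i y = y i + [i, y] moves i past a letter, and
    [i, y] is again in the ideal. The case b = 1 is \<open>eulerian_lie_ideal\<close>.\<close>
  have kill: "L (a * uea_embed i * b) = 0" if "i \<in> I" for a i b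
    using that
  proof (induction b arbitrary: a i rule: uea_induct)
    case one
    from eulerian_lie_ideal[OF injF I ideal one, of a] show ?case by (simp add: L_def I_def)
  next
    case (add u v)
    then show ?case by (simp add: distrib_left L_simps)
  next
    case (scale c u)
    then show ?case by (simp add: mult_scaleC_right L_simps)
  next
    case (mult y u)
    have "a * uea_embed i * (uea_embed y * u) = (a * uea_embed y) * uea_embed i * u + a * uea_embed (bracket i y) * u"
      by (simp add: uea_embed_bracket left_diff_distrib right_diff_distrib mult.assoc)
    with mult.IH[OF mult.prems, of "a * uea_embed y"] mult.IH[OF ideal[OF mult.prems], of a y]
    show ?case by (simp add: L_simps)
  qed
  \<comment> \<open>The algebra map on the free algebra that sends a letter x to s x; it respects
    the bracket relators only modulo the kernel of s = 1.\<close>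
  define h where "h = free_eval (\<lambda>x. uea_embed (Poly_Mapping.single (0::nat) (x :: 'g)))"
  have linh: "clinear h" unfolding h_def by (rule clinear_free_eval)
  have h_gen: "h (free_gen x) = uea_embed (Poly_Mapping.single 0 x)" for x
    unfolding h_def by (rule free_eval_gen)
  have h_mult: "h (p * q) = h p * h q" for p q
    unfolding h_def by (rule free_eval_mult)
  have emb0: "uea_embed (0 :: nat \<Rightarrow>\<^sub>0 'g) = 0" by (rule clinear_zero[OF clinear_uea_embed])
  have "L (a * h p * b) = 0" if "p \<in> uea_ideal" for a b p
    using that
  proof (induction arbitrary: a b)
    case (relator p)
    then show ?case
    proof cases
      case (add x y)
      have "h p = 0"
        unfolding add by (simp add: clinear_diff[OF linh] h_gen single_add clinear_add[OF clinear_uea_embed])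
      then show ?thesis by (simp add: L_simps)
    next
      case (scaleC c x)
      have "h p = 0"
        unfolding scaleC
        by (simp add: clinear_diff[OF linh] clinear_scaleC[OF linh] h_gen flip: scaleC_single_vector clinear_scaleC[OF clinear_uea_embed])
      then show ?thesis by (simp add: L_simps)
    next
      case (bracket x y)
      \<comment> \<open>This is s^2 [x, y] - s [x, y], which vanishes at s = 1.\<close>
      let ?i = "Poly_Mapping.single 1 (bracket x y) - Poly_Mapping.single 0 (bracket x y) :: nat \<Rightarrow>\<^sub>0 'g"
      have "h p = uea_embed ?i"
        unfolding bracket clinear_diff[OF linh] h_mult h_gen clinear_diff[OF clinear_uea_embed]
          uea_embed_bracket[symmetric] bracket_single by simp
      moreover have "?i \<in> I"
        by (simp add: I_def clinear_diff[OF clinear_total] total_single)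
      ultimately show ?thesis using kill by simp
    qed
  next
    case zero
    show ?case by (simp add: clinear_zero[OF linh] L_simps)
  next
    case (add p q)
    then show ?case by (simp add: clinear_add[OF linh] distrib_left distrib_right L_simps)
  next
    case (mult p c d)
    from mult.IH[of "a * h c" "h d * b"] show ?case by (simp add: h_mult mult.assoc)
  qed
  from this[of _ 1 1] have Lh: "p \<in> uea_ideal \<Longrightarrow> L (h p) = 0" for p by simp
  \<comment> \<open>Since pr fixes s x, whose value at s = 1 is x, the induced map is a
    retraction.\<close>
  have L_gen: "L (h (free_gen x)) = x" for x
    using eulerian_lie_divided_power[OF injF, of "Poly_Mapping.single 0 x" 1]
    by (simp add: L_def h_gen total_single divided_power_def scaleC_one)
  show ?thesis
  proof (rule injI)
    fix x y :: 'g assume "uea_embed x = uea_embed y"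
    then have "free_gen x - free_gen y \<in> uea_ideal" by transfer
    from Lh[OF this] show "x = y" by (simp add: clinear_diff[OF linh] L_simps L_gen)
  qed
qed

section \<open>Chevalley--Eilenberg cochains\<close>

lemma ce_cochainsD:
  assumes "c \<in> ce_cochains p"
  shows "length gs \<noteq> p \<Longrightarrow> c gs = 0"
    and "length gs = p \<Longrightarrow> i < p \<Longrightarrow> clinear (\<lambda>g. c (gs[i := g]))"
    and "length gs = p \<Longrightarrow> i < j \<Longrightarrow> j < p \<Longrightarrow> gs ! i = gs ! j \<Longrightarrow> c gs = 0"
  using assms unfolding ce_cochains_def by blast+

lemma ce_cochains_diff:
  assumes "c \<in> ce_cochains p" "d \<in> ce_cochains p"
  shows "(\<lambda>gs. c gs - d gs) \<in> ce_cochains p"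
  unfolding ce_cochains_def
proof (intro CollectI conjI allI impI)
  fix gs :: "'a list" and i assume "length gs = p" "i < p"
  note l = ce_cochainsD(2)[OF assms(1) this] ce_cochainsD(2)[OF assms(2) this]
  show "clinear (\<lambda>g. c (gs[i := g]) - d (gs[i := g]))"
    by (rule clinearI) (simp_all add: l[THEN clinear_add] l[THEN clinear_scaleC]
        complex_vector.scale_right_diff_distrib)
qed (simp_all add: ce_cochainsD[OF assms(1)] ce_cochainsD[OF assms(2)])

lemma ce_cochains_zero: "(\<lambda>_. 0) \<in> ce_cochains p"
  by (simp add: ce_cochains_def clinear_iff)

lemma ce_cochains_post:
  assumes "c \<in> ce_cochains p" "clinear \<phi>"
  shows "(\<lambda>gs. \<phi> (c gs)) \<in> ce_cochains p"
  unfolding ce_cochains_def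
proof (intro CollectI conjI allI impI)
  fix gs :: "'a list" and i assume "length gs = p" "i < p"
  from clinear_compose[OF assms(2) ce_cochainsD(2)[OF assms(1) this]]
  show "clinear (\<lambda>g. \<phi> (c (gs[i := g])))" .
qed (simp_all add: ce_cochainsD[OF assms(1)] clinear_zero[OF assms(2)])

lemma ce_cochains_reflect:
  assumes "(\<lambda>gs. \<phi> (c gs)) \<in> ce_cochains p" "clinear \<phi>" "inj \<phi>"
  shows "c \<in> ce_cochains p"
proof -
  have z: "\<phi> x = 0 \<longleftrightarrow> x = 0" for x
    using injD[OF assms(3), of x 0] by (auto simp: clinear_zero[OF assms(2)])
  note D = ce_cochainsD[OF assms(1)]
  show ?thesis
    unfolding ce_cochains_def
  proof (intro CollectI conjI allI impI)
    fix gs :: "'a list" and i assume "length gs = p" "i < p"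
    note l = D(2)[OF this]
    show "clinear (\<lambda>g. c (gs[i := g]))"
      by (rule clinearI; rule injD[OF assms(3)])
        (simp_all add: clinear_add[OF l] clinear_scaleC[OF l] clinear_add[OF assms(2)] clinear_scaleC[OF assms(2)])
  next
    fix gs :: "'a list" assume "length gs \<noteq> p"
    from D(1)[OF this] show "c gs = 0" by (simp add: z)
  next
    fix gs :: "'a list" and i j assume "length gs = p" "i < j" "j < p" "gs ! i = gs ! j"
    from D(3)[OF this] show "c gs = 0" by (simp add: z)
  qed
qed

lemma ce_d_post:
  assumes "clinear \<phi>" "\<And>g m. \<phi> (act g m) = act' g (\<phi> m)"
  shows "ce_d act' (\<lambda>gs. \<phi> (c gs)) gs = \<phi> (ce_d act c gs)"
  by (simp add: ce_d_def clinear_add[OF assms(1)] clinear_sum[OF assms(1)] clinear_scaleC[OF assms(1)] assms(2))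

lemma ce_d_diff:
  assumes "lie_module act"
  shows "ce_d act (\<lambda>gs. c gs - d gs) gs = ce_d act c gs - ce_d act d gs"
proof -
  have "act g (m - n) = act g m - act g n" for g m n
    using assms clinear_diff[of "act g"] unfolding lie_module_def cbilinear_def by blast
  then show ?thesis
    by (simp add: ce_d_def complex_vector.scale_right_diff_distrib sum_subtractf)
qed

lemma lie_module_zero: "lie_module act \<Longrightarrow> act g 0 = 0"
  unfolding lie_module_def using cbilinearD(6) by blast

lemma ce_d_other_length:
  assumes "c \<in> ce_cochains p" "\<And>g. act g 0 = 0" "length gs \<noteq> Suc p"
  shows "ce_d act c gs = 0"
proof -
  have "c (drop_nth i gs) = 0" if "i < length gs" for i
    by (rule ce_cochainsD(1)[OF assms(1)]) (use that assms(3) in \<open>simp add: drop_nth_def\<close>)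
  moreover have "c (bracket (gs ! i) (gs ! j) # drop_nth i (drop_nth j gs)) = 0" if "i < j" "j < length gs" for i j
    by (rule ce_cochainsD(1)[OF assms(1)]) (use that assms(3) in \<open>simp add: drop_nth_def\<close>)
  ultimately show ?thesis
    unfolding ce_d_def by (simp add: assms(2))
qed

lemma ce_d_1: "ce_d act c [g, h] = act g (c [h]) - act h (c [g]) - c [bracket g h]"
  by (simp add: ce_d_def drop_nth_def numeral_2_eq_2 scaleC_one)

lemma length_2E:
  assumes "length gs = 2" obtains a b where "gs = [a, b]"
  using assms by (auto simp: numeral_2_eq_2 length_Suc_conv)

lemma length_3E:
  assumes "length gs = 3" obtains a b c where "gs = [a, b, c]"
  using assms by (auto simp: numeral_3_eq_3 length_Suc_conv)

lemma ce_cochains_2I: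
  assumes "\<And>gs. length gs \<noteq> 2 \<Longrightarrow> c gs = 0"
    and "\<And>b. clinear (\<lambda>a. c [a, b])" "\<And>a. clinear (\<lambda>b. c [a, b])" "\<And>a. c [a, a] = 0"
  shows "c \<in> ce_cochains 2"
  unfolding ce_cochains_def
proof (intro CollectI conjI allI impI)
  fix gs :: "'a list" and i :: nat assume len: "length gs = 2" and "i < 2"
  obtain a b where "gs = [a, b]" by (rule length_2E[OF len])
  moreover from \<open>i < 2\<close> have "i = 0 \<or> i = 1" by auto
  ultimately show "clinear (\<lambda>g. c (gs[i := g]))" using assms(2,3) by auto
next
  fix gs :: "'a list" and i j :: nat assume len: "length gs = 2" and "i < j" "j < 2" "gs ! i = gs ! j"
  obtain a b where gs: "gs = [a, b]" by (rule length_2E[OF len])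
  from \<open>i < j\<close> \<open>j < 2\<close> have "i = 0" "j = 1" by auto
  with gs \<open>gs ! i = gs ! j\<close> show "c gs = 0" using assms(4) by simp
qed (rule assms(1))

lemma ce_cochain_1_linear:
  assumes "c \<in> ce_cochains 1"
  shows "clinear (\<lambda>g. c [g])"
  using ce_cochainsD(2)[OF assms, of "[undefined]" 0] by simp

lemma ce_d_cochain_1:
  assumes "c \<in> ce_cochains 1" and act: "lie_module act"
  shows "ce_d act c \<in> ce_cochains 2"
proof (rule ce_cochains_2I)
  fix gs :: "'a list" assume "length gs \<noteq> 2"
  then show "ce_d act c gs = 0"
    by (intro ce_d_other_length[OF assms(1)] lie_module_zero[OF act]) simp
next
  note c = ce_cochain_1_linear[OF assms(1)]
  have bil: "cbilinear act" using act by (simp add: lie_module_def)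
  note simps = ce_d_1 cbilinearD[OF bil] clinear_add[OF c] clinear_scaleC[OF c] bracket_add_left bracket_add_right
    bracket_scaleC_left bracket_scaleC_right complex_vector.scale_right_diff_distrib
  show "clinear (\<lambda>a. ce_d act c [a, b])" "clinear (\<lambda>b. ce_d act c [a, b])" for a b
    by (rule clinearI; simp add: simps)+
  show "ce_d act c [a, a] = 0" for a
    by (simp add: ce_d_1 bracket_self clinear_zero[OF c])
qed

text \<open>The one instance of d d = 0 that the comparison of two lifts of a 2-cocycle
  needs.\<close>

lemma ce_d_ce_d_1:
  assumes "c \<in> ce_cochains 1" and act: "lie_module act"
  shows "ce_d act (ce_d act c) gs = 0"
proof (cases "length gs = 3")
  case False
  then show ?thesis
    by (intro ce_d_other_length[OF ce_d_cochain_1[OF assms]] lie_module_zero[OF act]) simp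
next
  case True
  then obtain x y z where gs: "gs = [x, y, z]" by (rule length_3E)
  note c = ce_cochain_1_linear[OF assms(1)]
  have bil: "cbilinear act" and br: "\<And>g h m. act (bracket g h) m = act g (act h m) - act h (act g m)"
    using act by (auto simp: lie_module_def)
  have diff: "act g (m - n) = act g m - act g n" for g m n
    using clinear_diff[of "act g"] bil by (auto simp: cbilinear_def)
  have "bracket (bracket x y) z - bracket (bracket x z) y - bracket x (bracket y z) = 0"
    using jacobi_adjoint[of x y z] bracket_anticommute[of "bracket x z" y] by (simp add: diff_eq_eq)
  then have "c [bracket (bracket x y) z - bracket (bracket x z) y - bracket x (bracket y z)] = 0"
    by (simp add: clinear_zero[OF c])
  then have jac: "c [bracket (bracket x y) z] = c [bracket (bracket x z) y] + c [bracket x (bracket y z)]"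
    by (simp add: clinear_diff[OF c] diff_eq_eq)
  show ?thesis
    unfolding gs ce_d_2[OF ce_d_cochain_1[OF assms]] ce_d_1 br diff jac by simp
qed

section \<open>Cohomology classes and the connecting homomorphism\<close>

lemma ce_coboundaries_Suc_diff:
  assumes "u \<in> ce_coboundaries act (Suc p)" "v \<in> ce_coboundaries act (Suc p)" "lie_module act"
  shows "(\<lambda>gs. u gs - v gs) \<in> ce_coboundaries act (Suc p)"
proof -
  from assms(1,2) obtain c d where "c \<in> ce_cochains p" "d \<in> ce_cochains p" "u = ce_d act c" "v = ce_d act d"
    by (auto simp: ce_coboundaries_def)
  then have "(\<lambda>gs. u gs - v gs) = ce_d act (\<lambda>gs. c gs - d gs)"
    by (simp add: ce_d_diff[OF assms(3)] fun_eq_iff)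
  then show ?thesis
    using ce_cochains_diff[OF \<open>c \<in> _\<close> \<open>d \<in> _\<close>] by (auto simp: ce_coboundaries_def)
qed

lemma zero_in_ce_coboundaries:
  assumes "lie_module act"
  shows "(\<lambda>_. 0) \<in> ce_coboundaries act (Suc p)"
proof -
  have "ce_d act (\<lambda>_. 0) = (\<lambda>_. 0)"
    by (simp add: fun_eq_iff ce_d_def lie_module_zero[OF assms])
  then show ?thesis
    using ce_cochains_zero[of p] by (force simp: ce_coboundaries_def)
qed

lemma ce_class_eqI:
  assumes "(\<lambda>gs. b gs - b' gs) \<in> ce_coboundaries act (Suc p)" "lie_module act"
  shows "ce_class act (Suc p) b = ce_class act (Suc p) b'"
proof -
  have *: "(\<lambda>gs. c gs - u gs) \<in> ce_coboundaries act (Suc p)"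
    if "(\<lambda>gs. c gs - v gs) \<in> ce_coboundaries act (Suc p)" "(\<lambda>gs. u gs - v gs) \<in> ce_coboundaries act (Suc p)" for c u v
    using ce_coboundaries_Suc_diff[OF that assms(2)] by simp
  have sym: "(\<lambda>gs. b' gs - b gs) \<in> ce_coboundaries act (Suc p)"
    using ce_coboundaries_Suc_diff[OF zero_in_ce_coboundaries[OF assms(2)] assms(1,2)] by simp
  show ?thesis
    unfolding ce_class_def using *[OF _ sym] *[OF _ assms(1)] by blast
qed

text \<open>A section of vector spaces, not of modules: it serves to lift cochains, on which no
  equivariance is imposed.\<close>

lemma clinear_surj_section:
  assumes "clinear q" "surj q"
  obtains s where "clinear s" "\<And>x. q (s x) = x"
proof -
  interpret pair: vector_space_pair "scaleC :: complex \<Rightarrow> 'a \<Rightarrow> 'a" "scaleC :: complex \<Rightarrow> 'b \<Rightarrow> 'b"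
    by unfold_locales
  from pair.linear_surjective_right_inverse[OF assms] obtain s where "clinear s" "q \<circ> s = id" by blast
  then show ?thesis by (intro that[of s]) (auto simp: fun_eq_iff)
qed

text \<open>Since \<open>ce_connecting\<close> selects its cocycle by choice, independence of the
  choices is proved along the way: the selected cocycle differs from b by an explicit
  coboundary.\<close>

lemma ce_connecting_2:
  assumes ex: "short_exact_lie_modules actA actB actC i q"
    and c: "c \<in> ce_cochains 2" and b: "b \<in> ce_cocycles actA 3"
    and dc: "ce_d actB c = (\<lambda>gs. i (b gs))" and qc: "(\<lambda>gs. q (c gs)) \<in> ce_cocycles actC 2"
  shows "ce_connecting actA actB i q 2 (ce_class actC 2 (\<lambda>gs. q (c gs))) = ce_class actA 3 b"
proof -
  have A: "lie_module actA" and B: "lie_module actB" and C: "lie_module actC"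
    and i: "clinear i" "inj i" "\<And>g a. i (actA g a) = actB g (i a)"
    and q: "clinear q" "surj q" "\<And>g m. q (actB g m) = actC g (q m)"
    and exact: "range i = {m. q m = 0}"
    using ex by (auto simp: short_exact_lie_modules_def)
  let ?P = "\<lambda>b. b \<in> ce_cocycles actA (Suc 2) \<and> (\<exists>c' \<in> ce_cochains 2.
    (\<lambda>gs. q (c' gs)) \<in> ce_class actC 2 (\<lambda>gs. q (c gs)) \<and> ce_d actB c' = (\<lambda>gs. i (b gs)))"
  define b' where "b' = (SOME b. ?P b)"
  have "(\<lambda>gs. q (c gs)) \<in> ce_class actC 2 (\<lambda>gs. q (c gs))"
    using qc zero_in_ce_coboundaries[OF C, of 1] by (simp add: ce_class_def numeral_2_eq_2)
  then have "?P b" using b c dc by (auto simp: numeral_2_eq_2 numeral_3_eq_3)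
  then have "?P b'" unfolding b'_def by (rule someI[of ?P])
  then obtain c' where c': "c' \<in> ce_cochains 2" "(\<lambda>gs. q (c' gs)) \<in> ce_class actC 2 (\<lambda>gs. q (c gs))"
    "ce_d actB c' = (\<lambda>gs. i (b' gs))" by blast
  from c'(2) obtain e where e: "e \<in> ce_cochains 1" "(\<lambda>gs. q (c' gs) - q (c gs)) = ce_d actC e"
    by (auto simp: ce_class_def ce_coboundaries_def numeral_2_eq_2)
  obtain s where s: "clinear s" "\<And>x. q (s x) = x" using clinear_surj_section[OF q(1,2)] by blast
  define e' where "e' gs = s (e gs)" for gs
  have e': "e' \<in> ce_cochains 1" unfolding e'_def by (rule ce_cochains_post[OF e(1) s(1)])
  have qe': "q (ce_d actB e' gs) = ce_d actC e gs" for gs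
  proof -
    have "ce_d actC (\<lambda>gs. q (e' gs)) gs = q (ce_d actB e' gs)"
      by (rule ce_d_post[OF q(1)]) (rule q(3))
    then show ?thesis by (simp only: e'_def s(2))
  qed
  \<comment> \<open>Under q the difference c' - c becomes d e, so removing d e' lands in the kernel
    of q, the image of i; the coboundary is unchanged because d d e' = 0.\<close>
  define k' where "k' gs = (c' gs - c gs) - ce_d actB e' gs" for gs
  have k': "k' \<in> ce_cochains 2"
    unfolding k'_def by (rule ce_cochains_diff[OF ce_cochains_diff[OF c'(1) c] ce_d_cochain_1[OF e' B]])
  have "q (k' gs) = 0" for gs
    using fun_cong[OF e(2), of gs] by (simp add: k'_def clinear_diff[OF q(1)] qe')
  then have "k' gs \<in> range i" for gs unfolding exact by simp
  then have ik: "i (inv i (k' gs)) = k' gs" for gs by (rule f_inv_into_f)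
  define k where "k gs = inv i (k' gs)" for gs
  have k: "k \<in> ce_cochains 2"
    by (rule ce_cochains_reflect[OF _ i(1,2)]) (simp add: k_def ik k')
  have "b' gs - b gs = ce_d actA k gs" for gs
  proof (rule injD[OF i(2)])
    have "i (ce_d actA k gs) = ce_d actB k' gs"
    proof -
      have "ce_d actB (\<lambda>gs. i (k gs)) gs = i (ce_d actA k gs)"
        by (rule ce_d_post[OF i(1)]) (rule i(3))
      then show ?thesis by (simp only: k_def ik)
    qed
    also have "\<dots> = i (b' gs) - i (b gs)"
      unfolding k'_def ce_d_diff[OF B] ce_d_ce_d_1[OF e' B] c'(3) dc by simp
    finally show "i (b' gs - b gs) = i (ce_d actA k gs)" by (simp add: clinear_diff[OF i(1)])
  qed
  then have "(\<lambda>gs. b' gs - b gs) = ce_d actA k" by (simp add: fun_eq_iff)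
  then have "(\<lambda>gs. b' gs - b gs) \<in> ce_coboundaries actA (Suc 2)"
    using k by (simp add: ce_coboundaries_def)
  from ce_class_eqI[OF this A] show ?thesis
    by (simp add: ce_connecting_def b'_def numeral_2_eq_2 numeral_3_eq_3)
qed

section \<open>The homotopy formula\<close>

text \<open>Contracting the closed form \<open>T\<close> along the flow: \<open>a\<^sub>i\<close> stands for \<open>A\<^sub>t(g\<^sub>i)\<close>, \<open>a\<^sub>i\<^sub>j\<close> for
  \<open>A\<^sub>t([g\<^sub>i, g\<^sub>j])\<close>, \<open>r\<^sub>i\<^sub>j\<close> for the translate of \<open>a\<^sub>j\<close> by \<open>g\<^sub>i\<close>, and \<open>r\<^sub>i\<close> for the translate of \<open>p\<close>.\<close>

lemma homotopy_identity:
  fixes T :: "'l::complex_lie_algebra \<Rightarrow> 'l \<Rightarrow> 'l \<Rightarrow> 'w::complex_vector"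
  assumes T: "ctrilinear T" and swap12: "\<And>a b c. T a b c = - T b a c" and swap23: "\<And>a b c. T a b c = - T a c b"
    and coc: "\<And>a b c d. T (bracket a b) c d - T (bracket a c) b d + T (bracket a d) b c
      + T (bracket b c) a d - T (bracket b d) a c + T (bracket c d) a b = 0"
    and mc: "r12 - r21 - a12 = - bracket a1 a2" "r13 - r31 - a13 = - bracket a1 a3"
      "r23 - r32 - a23 = - bracket a2 a3"
  shows "(T r1 a2 a3 + T p r12 a3 + T p a2 r13) - (T r2 a1 a3 + T p r21 a3 + T p a1 r23)
      + (T r3 a1 a2 + T p r31 a2 + T p a1 r32) - T p a12 a3 + T p a13 a2 + T p a1 a23 =
    T (r1 + bracket a1 p) a2 a3 + T a1 (r2 + bracket a2 p) a3 + T a1 a2 (r3 + bracket a3 p)"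
proof -
  note add = ctrilinearD(1,3,5)[OF T]
  note diff = clinear_diff[OF ctrilinear_clinear(1)[OF T]] clinear_diff[OF ctrilinear_clinear(2)[OF T]]
    clinear_diff[OF ctrilinear_clinear(3)[OF T]]
  have r: "r12 = r21 + a12 - bracket a1 a2" "r13 = r31 + a13 - bracket a1 a3" "r23 = r32 + a23 - bracket a2 a3"
    using mc by (simp_all add: algebra_simps)
  have neg: "T (- x) b c = - T x b c" for x b c
    using diff(1)[of 0 x b c] clinear_zero[OF ctrilinear_clinear(1)[OF T]] by simp
  have b: "bracket a p = - bracket p a" for a by (rule bracket_anticommute)
  have rot: "T a b c = T c a b" for a b c
    using swap23[of a b c] swap12[of a c b] by simp
  \<comment> \<open>A common normal form, so that equal terms become syntactically equal: brackets
    and the \<open>r1\<close>, \<open>r2\<close>, \<open>r3\<close> move to the first slot, and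
    brackets with p are written with p in front.\<close>
  have s: "T p r31 a2 = - T p a2 r31" "T p a13 a2 = - T p a2 a13"
    "T a1 r2 a3 = - T r2 a1 a3" "T a1 a2 r3 = T r3 a1 a2"
    "T (bracket a1 p) a2 a3 = - T (bracket p a1) a2 a3"
    "T a1 (bracket a2 p) a3 = T (bracket p a2) a1 a3"
    "T a1 a2 (bracket a3 p) = - T (bracket p a3) a1 a2"
    "T p (bracket a1 a2) a3 = - T (bracket a1 a2) p a3"
    "T p a2 (bracket a1 a3) = T (bracket a1 a3) p a2"
    "T p a1 (bracket a2 a3) = T (bracket a2 a3) p a1"
    using swap23[of p r31 a2] swap23[of p a13 a2] swap12[of a1 r2 a3] rot[of a1 a2 r3]
      swap12[of a1 "bracket a2 p" a3] rot[of a1 a2 "bracket a3 p"] swap12[of p "bracket a1 a2" a3]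
      rot[of p a2 "bracket a1 a3"] rot[of p a1 "bracket a2 a3"]
    by (simp_all add: b[of a1] b[of a2] b[of a3] neg)
  \<comment> \<open>The cocycle identity at p, a1, a2, a3, solved for one term: it trades the
    brackets with p on the right-hand side for the brackets of two a's that \<open>mc\<close>
    produces on the left.\<close>
  have c: "T (bracket p a1) a2 a3 = T (bracket p a2) a1 a3 - T (bracket p a3) a1 a2
      - T (bracket a1 a2) p a3 + T (bracket a1 a3) p a2 - T (bracket a2 a3) p a1"
    using coc[of p a1 a2 a3] by (simp add: algebra_simps eq_neg_iff_add_eq_0 add_eq_0_iff)
  show ?thesis
    unfolding r add diff s c by (simp add: algebra_simps)
qed

lemma clinear_tensor_lift_parameter:
  assumes "\<And>x. cbilinear (m x)" "\<And>a b. clinear (\<lambda>x. m x a b)"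
  shows "clinear (\<lambda>x. tensor_lift (m x) T)"
proof (induction T rule: tensor_induct)
  case zero
  show ?case by (simp add: clinear_zero[OF clinear_tensor_lift[OF assms(1)]] clinear_iff)
next
  case (add S T)
  show ?case
    by (rule clinearI)
      (simp_all add: clinear_add[OF clinear_tensor_lift[OF assms(1)]] clinear_add[OF add.IH(1)] clinear_add[OF add.IH(2)]
        clinear_scaleC[OF add.IH(1)] clinear_scaleC[OF add.IH(2)] scaleC_add_right add_ac)
next
  case (pure a b)
  show ?case by (simp add: tensor_lift_pure[OF assms(1)] assms(2))
qed

lemma ctrilinear_eqI:
  fixes M N :: "('a::complex_vector, 'p::complex_vector) tensor \<Rightarrow> ('b::complex_vector, 'q::complex_vector) tensor
    \<Rightarrow> ('c::complex_vector, 'r::complex_vector) tensor \<Rightarrow> 'd::complex_vector"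
  assumes "ctrilinear M" "ctrilinear N"
    and "\<And>a p b q c r. M (a \<otimes> p) (b \<otimes> q) (c \<otimes> r) = N (a \<otimes> p) (b \<otimes> q) (c \<otimes> r)"
  shows "M R S T = N R S T"
proof -
  have 1: "M (a \<otimes> p) (b \<otimes> q) T = N (a \<otimes> p) (b \<otimes> q) T" for a p b q
    by (rule tensor_linear_eqI[OF ctrilinear_clinear(3)[OF assms(1)] ctrilinear_clinear(3)[OF assms(2)]]) (rule assms(3))
  have 2: "M (a \<otimes> p) S T = N (a \<otimes> p) S T" for a p
    by (rule tensor_linear_eqI[OF ctrilinear_clinear(2)[OF assms(1)] ctrilinear_clinear(2)[OF assms(2)]]) (rule 1)
  show ?thesis
    by (rule tensor_linear_eqI[OF ctrilinear_clinear(1)[OF assms(1)] ctrilinear_clinear(1)[OF assms(2)]]) (rule 2)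
qed

lemma ctrilinear_compose:
  assumes "ctrilinear m" "clinear F" "clinear G" "clinear H"
  shows "ctrilinear (\<lambda>a b c. m (F a) (G b) (H c))"
  by (rule ctrilinearI) (simp_all add: ctrilinearD[OF assms(1)] assms(2-)[THEN clinear_add] assms(2-)[THEN clinear_scaleC])

lemma clinear_compose_ctrilinear:
  assumes "ctrilinear m" "clinear h"
  shows "ctrilinear (\<lambda>a b c. h (m a b c))"
  by (rule ctrilinearI) (simp_all add: ctrilinearD[OF assms(1)] clinear_add[OF assms(2)] clinear_scaleC[OF assms(2)])

lemma ctrilinear_add:
  assumes "ctrilinear m" "ctrilinear n"
  shows "ctrilinear (\<lambda>a b c. m a b c + n a b c)"
  by (rule ctrilinearI) (simp_all add: ctrilinearD[OF assms(1)] ctrilinearD[OF assms(2)] scaleC_add_right)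

lemma convolve3_post:
  assumes "ctrilinear m" "clinear F" "clinear G" "clinear H"
  shows "convolve3 (\<lambda>a b c. m (F a) (G b) (H c)) X Y Z =
    convolve3 m (post_compose F X) (post_compose G Y) (post_compose H Z)"
  by (rule uea_map_eqI)
    (simp add: convolve3_divided_power[OF assms(1)] convolve3_divided_power[OF ctrilinear_compose[OF assms]]
      assms(2-)[THEN map_apply_post_compose])

definition integral_01 :: "complex poly \<Rightarrow> complex"
  where "integral_01 p = integral {0..1} (\<lambda>t :: real. poly p (complex_of_real t))"

lemma poly_integrable: "(\<lambda>t :: real. poly p (complex_of_real t)) integrable_on {0..1}"
  by (intro integrable_continuous_interval continuous_intros)

lemma clinear_integral_01: "clinear integral_01"
proof (rule clinearI)
  show "integral_01 (p + q) = integral_01 p + integral_01 q" for p q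
    by (simp add: integral_01_def integral_add[OF poly_integrable poly_integrable])
  show "integral_01 (c *\<^sub>C p) = c *\<^sub>C integral_01 p" for c p
    by (simp add: integral_01_def scaleC_poly_eq_smult scaleC_complex_def)
qed

lemma integral_01_pderiv: "integral_01 (pderiv p) = poly p 1 - poly p 0"
proof -
  have "((\<lambda>t. poly (pderiv p) (complex_of_real t)) has_integral
      poly p (complex_of_real 1) - poly p (complex_of_real 0)) {0..1}"
    by (rule fundamental_theorem_of_calculus) (auto intro: has_vector_derivative_real_field poly_DERIV)
  then show ?thesis unfolding integral_01_def by (simp add: integral_unique)
qed

section \<open>The cochain attached to a fixed 3-cocycle\<close>

context
  fixes f :: "'g::complex_lie_algebra list \<Rightarrow> complex"
  assumes f: "f \<in> ce_cocycles trivial_act 3"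
begin

lemma f_cochain: "f \<in> ce_cochains 3"
  using f by (simp add: ce_cocycles_def)

lemma ctrilinear_f: "ctrilinear (\<lambda>a b c. f [a, b, c])"
proof -
  have "clinear (\<lambda>g. f ([a, b, c][i := g]))" if "i < 3" for a b c and i :: nat
    by (rule ce_cochainsD(2)[OF f_cochain _ that]) simp
  from this[of 0] this[of 1] this[of 2]
  have lin: "clinear (\<lambda>a. f [a, b, c])" "clinear (\<lambda>b. f [a, b, c])" "clinear (\<lambda>c. f [a, b, c])" for a b c
    by (simp_all add: numeral_2_eq_2)
  show ?thesis
    by (rule ctrilinearI) (simp_all add: lin[THEN clinear_add] lin[THEN clinear_scaleC])
qed

lemma f_swap12: "f [a, b, c] = - f [b, a, c]"
proof -
  have z: "f [x, x, c] = 0" for x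
    by (rule ce_cochainsD(3)[OF f_cochain, of _ 0 1]) simp_all
  have "f [a + b, a + b, c] = f [a, b, c] + f [b, a, c]"
    unfolding ctrilinearD[OF ctrilinear_f] by (simp add: z)
  then show ?thesis by (simp add: z eq_neg_iff_add_eq_0)
qed

lemma f_swap23: "f [a, b, c] = - f [a, c, b]"
proof -
  have z: "f [a, x, x] = 0" for x
    by (rule ce_cochainsD(3)[OF f_cochain, of _ 1 2]) simp_all
  have "f [a, b + c, b + c] = f [a, b, c] + f [a, c, b]"
    unfolding ctrilinearD[OF ctrilinear_f] by (simp add: z)
  then show ?thesis by (simp add: z eq_neg_iff_add_eq_0)
qed

lemma f_cocycle:
  "f [bracket a b, c, d] - f [bracket a c, b, d] + f [bracket a d, b, c]
    + f [bracket b c, a, d] - f [bracket b d, a, c] + f [bracket c d, a, b] = 0"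
proof -
  have "ce_d trivial_act f [a, b, c, d] = 0" using f by (simp add: ce_cocycles_def)
  then show ?thesis
    by (simp add: ce_d_def trivial_act_def drop_nth_def lessThan_Suc numeral_2_eq_2 numeral_3_eq_3 scaleC_complex_def
        algebra_simps eq_neg_iff_add_eq_0 add_eq_0_iff)
qed

text \<open>As \<open>tensor_lift\<close> is meaningful only for bilinear arguments, bilinearity is
  checked from the innermost lift outwards, each lift being linear in the outer variables as
  parameters.\<close>

lemma
  shows trilinear_poly_ext_pure: "trilinear_poly_ext f (a \<otimes> p) (b \<otimes> q) (c \<otimes> r) = smult (f [a, b, c]) (p * q * r)"
    and ctrilinear_trilinear_poly_ext: "ctrilinear (trilinear_poly_ext f)"
proof -
  note lin = ctrilinearD[OF ctrilinear_f]
  define m1 where "m1 a p b q c r = smult (f [a, b, c]) (p * q * r)" for a b c and p q r :: "complex poly"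
  note m1_simps = m1_def lin smult_add_left smult_add_right distrib_left distrib_right scaleC_poly_eq_smult
    scaleC_complex_def mult_ac
  have b1: "cbilinear (m1 a p b q)" for a p b q
    by (rule cbilinearI) (simp_all add: m1_simps)
  define m2 where "m2 a p T b q = tensor_lift (m1 a p b q) T" for a p T b q
  have b2: "cbilinear (m2 a p T)" for a p T
    unfolding cbilinear_def m2_def
    by (intro conjI allI clinear_tensor_lift_parameter b1; rule clinearI)
      (simp_all add: m1_simps)
  define m3 where "m3 S T a p = tensor_lift (m2 a p T) S" for S T a p
  have b3: "cbilinear (m3 S T)" for S T
    unfolding cbilinear_def m3_def
  proof (intro conjI allI clinear_tensor_lift_parameter b2)
    show "clinear (\<lambda>x. m2 x p T b q)" for p b q
      unfolding m2_def
      by (intro clinear_tensor_lift_parameter b1; rule clinearI)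
        (simp_all add: m1_simps)
    show "clinear (\<lambda>x. m2 a x T b q)" for a b q
      unfolding m2_def
      by (intro clinear_tensor_lift_parameter b1; rule clinearI)
        (simp_all add: m1_simps)
  qed
  have ext: "trilinear_poly_ext f R S T = tensor_lift (m3 S T) R" for R S T
    unfolding trilinear_poly_ext_def m3_def m2_def m1_def ..
  show "trilinear_poly_ext f (a \<otimes> p) (b \<otimes> q) (c \<otimes> r) = smult (f [a, b, c]) (p * q * r)"
    unfolding ext tensor_lift_pure[OF b3] m3_def tensor_lift_pure[OF b2] m2_def tensor_lift_pure[OF b1]
    by (rule m1_def)
  have l1: "clinear (\<lambda>R. trilinear_poly_ext f R S T)" for S T
    unfolding ext by (rule clinear_tensor_lift[OF b3])
  have l2: "clinear (\<lambda>S. trilinear_poly_ext f R S T)" for R T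
    unfolding ext by (intro clinear_tensor_lift_parameter b3) (simp add: m3_def clinear_tensor_lift[OF b2])
  have l3: "clinear (\<lambda>T. trilinear_poly_ext f R S T)" for R S
    unfolding ext
  proof (intro clinear_tensor_lift_parameter b3)
    show "clinear (\<lambda>T. m3 S T a p)" for a p
      unfolding m3_def
      by (intro clinear_tensor_lift_parameter b2) (simp add: m2_def clinear_tensor_lift[OF b1])
  qed
  show "ctrilinear (trilinear_poly_ext f)"
    unfolding ctrilinear_def cbilinear_def using l1 l2 l3 by blast
qed

lemma poly_trilinear_poly_ext:
  "poly (trilinear_poly_ext f R S T) t = f [eval_at t R, eval_at t S, eval_at t T]"
  by (rule ctrilinear_eqI[OF clinear_compose_ctrilinear[OF ctrilinear_trilinear_poly_ext clinear_poly]
        ctrilinear_compose[OF ctrilinear_f clinear_eval_at clinear_eval_at clinear_eval_at]])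
    (simp add: trilinear_poly_ext_pure eval_at_pure ctrilinearD[OF ctrilinear_f] scaleC_complex_def)

lemma pderiv_trilinear_poly_ext:
  "pderiv (trilinear_poly_ext f R S T) =
    trilinear_poly_ext f (tderiv R) S T + trilinear_poly_ext f R (tderiv S) T + trilinear_poly_ext f R S (tderiv T)"
  by (rule ctrilinear_eqI[OF clinear_compose_ctrilinear[OF ctrilinear_trilinear_poly_ext clinear_pderiv]
        ctrilinear_add[OF ctrilinear_add[OF
          ctrilinear_compose[OF ctrilinear_trilinear_poly_ext clinear_tderiv clinear_ident clinear_ident]
          ctrilinear_compose[OF ctrilinear_trilinear_poly_ext clinear_ident clinear_tderiv clinear_ident]]
          ctrilinear_compose[OF ctrilinear_trilinear_poly_ext clinear_ident clinear_ident clinear_tderiv]]])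
    (simp add: trilinear_poly_ext_pure tderiv_pure pderiv_smult pderiv_mult smult_add_right[symmetric] algebra_simps)

lemma trilinear_poly_ext_swap23: "trilinear_poly_ext f R S T = - trilinear_poly_ext f R T S"
  by (rule poly_eq_poly_eq_iff[THEN iffD1]) (simp add: fun_eq_iff poly_trilinear_poly_ext f_swap23[of _ "poly_functional _ S"])

abbreviation "form \<equiv> convolve3 (\<lambda>a b c. f [a, b, c])"
abbreviation "poly_form \<equiv> convolve3 (trilinear_poly_ext f)"

definition eulerian_lie_const :: "('g, ('g, complex poly) tensor) uea_map"
  where "eulerian_lie_const = post_compose (\<lambda>a. a \<otimes> 1) eulerian_lie_map"

lemma eval_at_eulerian_lie_const: "post_compose (eval_at t) eulerian_lie_const = eulerian_lie_map"
  unfolding eulerian_lie_const_def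
  by (rule uea_map_eqI)
    (simp add: map_apply_post_compose[OF clinear_eval_at] map_apply_post_compose[OF clinear_pure_one] eval_at_pure scaleC_one)

text \<open>The definition integrates inside the Sweedler sums; integration is a linear functional
  on polynomials and can be taken outside, which leaves a single polynomial in t for each x.\<close>

lemma alpha_tilde_form_eq:
  "alpha_tilde_form f x g h = integral_01 (map_apply (poly_form eulerian_lie_const (A_lie_map g) (A_lie_map h)) x)"
proof -
  note tri = clinear_compose_ctrilinear[OF ctrilinear_trilinear_poly_ext clinear_integral_01]
  have P: "map_apply eulerian_lie_const u = eulerian_lie u \<otimes> 1" for u
    unfolding eulerian_lie_const_def
    by (simp add: map_apply_post_compose[OF clinear_pure_one] map_apply_eulerian_lie_map[OF inj_uea_embed])
  show ?thesis
    unfolding convolve3_linear[OF ctrilinear_trilinear_poly_ext clinear_integral_01] map_apply_convolve3[OF tri]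
    unfolding sweedler_def alpha_tilde_form_def P map_apply_A_lie_map[OF inj_uea_embed] integral_01_def ..
qed

lemma poly_poly_form:
  "poly (map_apply (poly_form X Y Z) x) t =
    map_apply (form (post_compose (eval_at t) X) (post_compose (eval_at t) Y) (post_compose (eval_at t) Z)) x"
  unfolding convolve3_linear[OF ctrilinear_trilinear_poly_ext clinear_poly] poly_trilinear_poly_ext
    convolve3_post[OF ctrilinear_f clinear_eval_at clinear_eval_at clinear_eval_at] ..

lemma pderiv_poly_form:
  "pderiv (map_apply (poly_form X Y Z) x) =
    map_apply (poly_form (post_compose tderiv X) Y Z + poly_form X (post_compose tderiv Y) Z
      + poly_form X Y (post_compose tderiv Z)) x"
proof (rule clinear_eq_on_divided_powers[OF clinear_compose[OF clinear_pderiv clinear_map_apply] clinear_map_apply])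
  fix y n
  note [simp] = map_apply_post_compose[OF clinear_tderiv] clinear_sum[OF clinear_pderiv]
  show "pderiv (map_apply (poly_form X Y Z) (divided_power y n)) =
    map_apply (poly_form (post_compose tderiv X) Y Z + poly_form X (post_compose tderiv Y) Z
      + poly_form X Y (post_compose tderiv Z)) (divided_power y n)"
    unfolding map_apply_simps convolve3_divided_power[OF ctrilinear_trilinear_poly_ext]
    by (simp add: pderiv_trilinear_poly_ext sum.distrib)
qed

lemma form_A_lie_at_1:
  "map_apply (form (A_lie_at 1 g1) (A_lie_at 1 g2) (A_lie_at 1 g3)) x = uea_counit x * f [g1, g2, g3]"
proof (rule clinear_eq_on_divided_powers[OF clinear_map_apply])
  show "clinear (\<lambda>x. uea_counit x * f [g1, g2, g3])"
    by (rule clinearI) (simp_all add: clinear_add[OF clinear_uea_counit] clinear_scaleC[OF clinear_uea_counit]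
        scaleC_complex_def distrib_right)
  fix y :: 'g and n
  have A: "map_apply (A_lie_at 1 g) (divided_power y k) = (if k = 0 then g else 0)" for g k
    by (simp add: map_apply_post_compose[OF clinear_eval_at] map_apply_A_lie_map[OF inj_uea_embed]
        eval_1_uea_A_lie[OF inj_uea_embed] counit_divided_power scaleC_one)
  note z = clinear_zero[OF ctrilinear_clinear(1)[OF ctrilinear_f]] clinear_zero[OF ctrilinear_clinear(2)[OF ctrilinear_f]]
    clinear_zero[OF ctrilinear_clinear(3)[OF ctrilinear_f]]
  show "map_apply (form (A_lie_at 1 g1) (A_lie_at 1 g2) (A_lie_at 1 g3)) (divided_power y n) =
      uea_counit (divided_power y n) * f [g1, g2, g3]"
  proof (cases "n = 0")
    case True
    show ?thesis unfolding convolve3_divided_power[OF ctrilinear_f] A counit_divided_power True by simp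
  next
    case False
    have "(\<Sum>i\<le>n. \<Sum>j\<le>n - i. f [if i = 0 then g1 else 0, if j = 0 then g2 else 0, if n - i - j = 0 then g3 else 0]) = 0"
      using False by (intro sum.neutral ballI) (auto simp: z)
    then show ?thesis unfolding convolve3_divided_power[OF ctrilinear_f] A counit_divided_power using False by simp
  qed
qed

lemma form_A_lie_at_0: "map_apply (form (A_lie_at 0 g1) (A_lie_at 0 g2) (A_lie_at 0 g3)) x = 0"
  unfolding A_lie_at_0[OF inj_uea_embed] clinear_zero[OF ctrilinear_clinear(1)[OF ctrilinear_convolve3[OF ctrilinear_f]]]
  by (simp add: map_apply_simps)

text \<open>The Lie algebra in \<open>homotopy_identity\<close> is here the convolution Lie algebra
  of \<gg>-valued maps, so x only enters by evaluation at the end. Once recognised as a derivative,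
  the integrand contributes only its boundary values.\<close>

lemma alpha_tilde_form_coboundary:
  "alpha_tilde_form f (x * uea_embed g1) g2 g3 - alpha_tilde_form f (x * uea_embed g2) g1 g3
    + alpha_tilde_form f (x * uea_embed g3) g1 g2 - alpha_tilde_form f x (bracket g1 g2) g3
    + alpha_tilde_form f x (bracket g1 g3) g2 + alpha_tilde_form f x g1 (bracket g2 g3)
   = uea_counit x * f [g1, g2, g3]"
proof -
  let ?P = eulerian_lie_const and ?p = "eulerian_lie_map :: ('g, 'g) uea_map"
  define B where "B g h = poly_form ?P (A_lie_map g) (A_lie_map h)" for g h
  define Q where "Q = map_apply (poly_form (A_lie_map g1) (A_lie_map g2) (A_lie_map g3)) x"
  define W where "W = map_apply (B g2 g3) (x * uea_embed g1) - map_apply (B g1 g3) (x * uea_embed g2)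
    + map_apply (B g1 g2) (x * uea_embed g3) - map_apply (B (bracket g1 g2) g3) x
    + map_apply (B (bracket g1 g3) g2) x + map_apply (B g1 (bracket g2 g3)) x"
  note T = ctrilinear_convolve3[OF ctrilinear_f]
  \<comment> \<open>Checked number by number, because the bracket is available for maps into \<gg>,
    that is, after evaluation at t.\<close>
  have "poly W t = poly (pderiv Q) t" for t
  proof -
    let ?a = "A_lie_at t" and ?R = right_translate
    have B: "poly (map_apply (B g h) u) t = map_apply (form ?p (?a g) (?a h)) u" for g h u
      unfolding B_def poly_poly_form eval_at_eulerian_lie_const ..
    have shift: "map_apply F (x * uea_embed g) = map_apply (?R g F) x" for F :: "('g, complex) uea_map" and g
      by (simp add: right_translate.rep_eq)
    have "poly W t = map_apply (
      (form (?R g1 ?p) (?a g2) (?a g3) + form ?p (?R g1 (?a g2)) (?a g3) + form ?p (?a g2) (?R g1 (?a g3)))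
      - (form (?R g2 ?p) (?a g1) (?a g3) + form ?p (?R g2 (?a g1)) (?a g3) + form ?p (?a g1) (?R g2 (?a g3)))
      + (form (?R g3 ?p) (?a g1) (?a g2) + form ?p (?R g3 (?a g1)) (?a g2) + form ?p (?a g1) (?R g3 (?a g2)))
      - form ?p (?a (bracket g1 g2)) (?a g3) + form ?p (?a (bracket g1 g3)) (?a g2)
      + form ?p (?a g1) (?a (bracket g2 g3))) x"
      unfolding W_def poly_add poly_diff B shift right_translate_convolve3[OF ctrilinear_f] map_apply_simps ..
    also have "\<dots> = map_apply (form (?R g1 ?p + bracket (?a g1) ?p) (?a g2) (?a g3)
      + form (?a g1) (?R g2 ?p + bracket (?a g2) ?p) (?a g3)
      + form (?a g1) (?a g2) (?R g3 ?p + bracket (?a g3) ?p)) x"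
      by (subst homotopy_identity[OF T convolve3_swap12[OF ctrilinear_f f_swap12] convolve3_swap23[OF ctrilinear_f f_swap23]
            convolve3_cocycle[OF ctrilinear_f f_cocycle]
            A_lie_at_maurer_cartan[OF inj_uea_embed] A_lie_at_maurer_cartan[OF inj_uea_embed]
            A_lie_at_maurer_cartan[OF inj_uea_embed]]) (rule refl)
    also have "\<dots> = poly (pderiv Q) t"
      unfolding Q_def pderiv_poly_form map_apply_simps poly_add poly_poly_form A_lie_at_tderiv[OF inj_uea_embed] ..
    finally show ?thesis .
  qed
  then have W: "W = pderiv Q" by (intro poly_eq_poly_eq_iff[THEN iffD1]) (simp add: fun_eq_iff)
  have "integral_01 W = uea_counit x * f [g1, g2, g3]"
    unfolding W integral_01_pderiv unfolding Q_def poly_poly_form form_A_lie_at_1 form_A_lie_at_0 by simp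
  then show ?thesis
    unfolding W_def B_def alpha_tilde_form_eq clinear_add[OF clinear_integral_01] clinear_diff[OF clinear_integral_01] .
qed

lemma clinear_alpha_tilde_form: "clinear (\<lambda>x. alpha_tilde_form f x g h)"
  unfolding alpha_tilde_form_eq by (rule clinear_compose[OF clinear_integral_01 clinear_map_apply])

lemma dual_apply_alpha_tilde: "dual_apply (alpha_tilde f [g, h]) x = alpha_tilde_form f x g h"
  by (simp add: alpha_tilde_def Abs_dual_inverse clinear_alpha_tilde_form)

lemma alpha_tilde_cochain: "alpha_tilde f \<in> ce_cochains 2"
proof (rule ce_cochains_2I)
  show "alpha_tilde f gs = 0" if "length gs \<noteq> 2" for gs
    using that by (auto simp: alpha_tilde_def split: list.splits)
next
  note T = ctrilinear_convolve3[OF ctrilinear_trilinear_poly_ext]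
  note lin = clinear_uea_A_lie_right[OF inj_uea_embed]
  have A: "A_lie_map (g + h) = A_lie_map g + A_lie_map h" "A_lie_map (c *\<^sub>C g) = c *\<^sub>C A_lie_map g" for g h :: 'g and c
    by (rule uea_map_eqI, simp add: map_apply_A_lie_map[OF inj_uea_embed] map_apply_simps
        clinear_add[OF lin] clinear_scaleC[OF lin])+
  note simps = dual_apply_alpha_tilde alpha_tilde_form_eq A ctrilinearD[OF T] map_apply_simps
    clinear_add[OF clinear_integral_01] clinear_scaleC[OF clinear_integral_01] plus_dual.rep_eq scaleC_dual.rep_eq
  show "clinear (\<lambda>a. alpha_tilde f [a, b])" "clinear (\<lambda>b. alpha_tilde f [a, b])" for a b
    by (rule clinearI; rule dual_eqI; simp add: simps)+
  show "alpha_tilde f [a, a] = 0" for a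
  proof (rule dual_eqI)
    fix x
    have "poly_form eulerian_lie_const (A_lie_map a) (A_lie_map a) = 0"
      by (rule eq_minus_self_zero) (rule convolve3_swap23[OF ctrilinear_trilinear_poly_ext trilinear_poly_ext_swap23])
    then show "dual_apply (alpha_tilde f [a, a]) x = dual_apply 0 x"
      by (simp add: dual_apply_alpha_tilde alpha_tilde_form_eq map_apply_simps zero_dual.rep_eq
          clinear_zero[OF clinear_integral_01])
  qed
qed

text \<open>The formula holds on all of U\<gg>, not only on constants: the coboundary comes from the
  trivial module, so it dies on the augmentation ideal, and f is exactly the cocycle that the
  connecting construction asks for.\<close>

lemma ce_d_alpha_tilde: "ce_d uea_dual_act (alpha_tilde f) = (\<lambda>gs. uea_dual_counit (f gs))"
proof
  fix gs :: "'g list"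
  have mod: "lie_module (uea_dual_act :: 'g \<Rightarrow> _)" and i: "clinear (uea_dual_counit :: _ \<Rightarrow> 'g uea dual)"
    using short_exact_uea_dual[where ?'g = 'g] by (auto simp: short_exact_lie_modules_def)
  show "ce_d uea_dual_act (alpha_tilde f) gs = uea_dual_counit (f gs)"
  proof (cases "length gs = 3")
    case False
    then have "ce_d uea_dual_act (alpha_tilde f) gs = 0"
      by (intro ce_d_other_length[OF alpha_tilde_cochain] lie_module_zero[OF mod]) simp
    then show ?thesis using ce_cochainsD(1)[OF f_cochain False] by (simp add: clinear_zero[OF i])
  next
    case True
    then obtain g1 g2 g3 where gs: "gs = [g1, g2, g3]" by (rule length_3E)
    show ?thesis
    proof (rule dual_eqI)
      fix x
      show "dual_apply (ce_d uea_dual_act (alpha_tilde f) gs) x = dual_apply (uea_dual_counit (f gs)) x"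
        using alpha_tilde_form_coboundary[of x g1 g2 g3]
        by (simp add: gs ce_d_2[OF alpha_tilde_cochain] plus_dual.rep_eq minus_dual.rep_eq uea_dual_act.rep_eq
            dual_apply_alpha_tilde uea_dual_counit.rep_eq mult.commute)
    qed
  qed
qed

lemma alpha_cocycle: "alpha f \<in> ce_cocycles uea_aug_dual_act 2"
proof -
  have q: "clinear (uea_dual_restrict :: 'g uea dual \<Rightarrow> _)"
    and equi: "\<And>g m. uea_dual_restrict (uea_dual_act g m) = uea_aug_dual_act g (uea_dual_restrict m :: 'g uea_aug dual)"
    and qi: "uea_dual_restrict (uea_dual_counit z :: 'g uea dual) = 0" for z
    using short_exact_uea_dual[where ?'g = 'g] by (auto simp: short_exact_lie_modules_def)
  have "alpha f \<in> ce_cochains 2"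
    unfolding alpha_def[abs_def] by (rule ce_cochains_post[OF alpha_tilde_cochain q])
  moreover have "ce_d uea_aug_dual_act (alpha f) gs = 0" for gs
  proof -
    have "ce_d uea_aug_dual_act (alpha f) gs = uea_dual_restrict (ce_d uea_dual_act (alpha_tilde f) gs)"
      unfolding alpha_def[abs_def] by (rule ce_d_post[OF q]) (rule equi)
    then show ?thesis by (simp add: ce_d_alpha_tilde qi)
  qed
  ultimately show ?thesis by (simp add: ce_cocycles_def)
qed

end

theorem proposition4:
  fixes f :: "'g::complex_lie_algebra list \<Rightarrow> complex"
  assumes "f \<in> ce_cocycles trivial_act 3"
  shows
    "alpha_tilde f \<in> ce_cochains 2 \<and>
     (\<forall>x g1 g2. dual_apply (alpha_tilde f [g1, g2]) x = alpha_tilde_form f x g1 g2) \<and>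
     (\<forall>c g1 g2 g3.
        dual_apply (ce_d uea_dual_act (alpha_tilde f) [g1, g2, g3]) (uea_unit c) = c * f [g1, g2, g3]) \<and>
     alpha f \<in> ce_cocycles uea_aug_dual_act 2 \<and>
     ce_class trivial_act 3 f =
       ce_connecting trivial_act uea_dual_act uea_dual_counit uea_dual_restrict 2
         (ce_class uea_aug_dual_act 2 (alpha f))"
proof (intro conjI allI)
  show "alpha_tilde f \<in> ce_cochains 2" "alpha f \<in> ce_cocycles uea_aug_dual_act 2"
    by (rule alpha_tilde_cochain[OF assms] alpha_cocycle[OF assms])+
  show "dual_apply (alpha_tilde f [g1, g2]) x = alpha_tilde_form f x g1 g2" for x g1 g2
    by (rule dual_apply_alpha_tilde[OF assms])
  show "dual_apply (ce_d uea_dual_act (alpha_tilde f) [g1, g2, g3]) (uea_unit c) = c * f [g1, g2, g3]" for c g1 g2 g3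
    by (simp add: ce_d_alpha_tilde[OF assms] uea_dual_counit.rep_eq uea_unit_def
        clinear_scaleC[OF clinear_uea_counit] uea_counit_one scaleC_complex_def)
  show "ce_class trivial_act 3 f =
       ce_connecting trivial_act uea_dual_act uea_dual_counit uea_dual_restrict 2
         (ce_class uea_aug_dual_act 2 (alpha f))"
    using alpha_cocycle[OF assms]
    unfolding alpha_def[abs_def]
    by (intro ce_connecting_2[OF short_exact_uea_dual alpha_tilde_cochain[OF assms] assms
          ce_d_alpha_tilde[OF assms], symmetric])
qed

end
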